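(* Let $\mathcal{A}$ be a plus-one generated arrangement of lines in $\mathbb{P}^2=\mathbb{P}^2(\mathbb{C})$ of exponents $(a,b)$ and level $d$. Let $l\in\mathcal{A}$ and suppose $h=|l\cap\mathcal{A}|=d+1$. Then $\mathcal{A}\setminus\{l\}$ is free with exponents $(a-1,b-1)$.
   Context: An arrangement $\mathcal{A}$ is a finite set of $n=|\mathcal{A}|$ distinct lines in $\mathbb{P}^2=\mathbb{P}^2(\mathbb{C})$, with defining polynomial $f_{\mathcal{A}}=\prod_{H\in\mathcal{A}}\alpha_H$, where $\alpha_H\in\mathbb{C}[x,y,z]$ is a linear form defining $H$. The vector bundle associated to $\mathcal{A}$ is the rank $2$ vector bundle $\mathcal{T}_{\mathcal{A}}=\ker\big(\nabla f_{\mathcal{A}}:\mathcal{O}_{\mathbb{P}^2}^3\to\mathcal{O}_{\mathbb{P}^2}(n-1)\big)$, where $\nabla f_{\mathcal{A}}=[\partial_x f_{\mathcal{A}}\ \partial_y f_{\mathcal{A}}\ \partial_z f_{\mathcal{A}}]$. $\mathcal{A}$ is free with exponents $(a,b)$, $a,b\in\mathbb{N}$, if $\mathcal{T}_{\mathcal{A}}\cong\mathcal{O}_{\mathbb{P}^2}(-a)\oplus\mathcal{O}_{\mathbb{P}^2}(-b)$. $\mathcal{A}$ is plus-one generated of exponents (type) $(a,b)$ and level $d$, where $a\le b\le d$, if there is an exact sequence $$0\to\mathcal{O}_{\mathbb{P}^2}(-1-d)\to\mathcal{O}_{\mathbb{P}^2}(-d)\oplus\mathcal{O}_{\mathbb{P}^2}(-b)\oplus\mathcal{O}_{\mathbb{P}^2}(-a)\to\mathcal{T}_{\mathcal{A}}\to0.$$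 For $l\in\mathcal{A}$, $|l\cap\mathcal{A}|$ is the number of distinct points of $l$ at which $l$ meets the other lines of $\mathcal{A}$. *)

theory Defs
  imports "HOL-Analysis.Analysis"
begin

subsection \<open>The projective plane\<close>

text \<open>
  A point of the complex projective plane is a one-dimensional subspace of \<open>\<complex>\<^sup>3\<close>.
\<close>

type_synonym point = "(complex^3) set"
type_synonym line = "point set"

definition proj_plane :: "point set" where
  "proj_plane = {vec.span {v} |v. v \<noteq> 0}"

definition linear_form :: "complex^3 \<Rightarrow> complex^3 \<Rightarrow> complex" where
  "linear_form \<alpha> v = (\<Sum>i\<in>UNIV. \<alpha> $ i * v $ i)"

definition defines_line :: "complex^3 \<Rightarrow> line \<Rightarrow> bool" where
  "defines_line \<alpha> H \<longleftrightarrow>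
     \<alpha> \<noteq> 0 \<and> H = {p \<in> proj_plane. \<forall>v\<in>p. linear_form \<alpha> v = 0}"

definition arrangement :: "line set \<Rightarrow> bool" where
  "arrangement \<A> \<longleftrightarrow> finite \<A> \<and> (\<forall>H\<in>\<A>. \<exists>\<alpha>. defines_line \<alpha> H)"

text \<open>
  Over the infinite field \<open>\<complex>\<close> polynomials in \<open>x, y, z\<close> are identified with the functions on
  \<open>\<complex>\<^sup>3\<close> they induce. In particular the zero function is homogeneous of every degree.
\<close>

definition homogeneous_poly :: "nat \<Rightarrow> (complex^3 \<Rightarrow> complex) \<Rightarrow> bool" where
  "homogeneous_poly k P \<longleftrightarrow>
     (\<exists>c :: nat \<Rightarrow> nat \<Rightarrow> complex.
        \<forall>v. P v = (\<Sum>i\<le>k. \<Sum>j\<le>k - i. c i j * v $ 1 ^ i * v $ 2 ^ j * v $ 3 ^ (k - i - j)))"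

definition zariski_open :: "point set \<Rightarrow> bool" where
  "zariski_open U \<longleftrightarrow>
     (\<exists>F. (\<forall>P\<in>F. \<exists>k. homogeneous_poly k P) \<and>
          U = proj_plane - {p \<in> proj_plane. \<forall>P\<in>F. \<forall>v\<in>p. P v = 0})"


subsection \<open>Sheaves of modules\<close>

text \<open>
  The punctured affine cone over \<open>U\<close>. A section of \<open>\<O>(k)\<close> over \<open>U\<close> is a function on this cone
  that is locally a quotient of homogeneous polynomials whose degrees differ by \<open>k\<close>. All sheaves
  below consist of such functions, with values in \<open>\<complex>\<^sup>n\<close>; so that equality of sections is equality of
  functions, they are extended by zero outside the cone.
\<close>

definition cone :: "point set \<Rightarrow> (complex^3) set" where
  "cone U = {v. v \<noteq> 0 \<and> vec.span {v} \<in> U}"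

definition twist_sections :: "int \<Rightarrow> point set \<Rightarrow> (complex^3 \<Rightarrow> complex) set" where
  "twist_sections k U =
     {s. (\<forall>v. v \<notin> cone U \<longrightarrow> s v = 0) \<and>
         (\<forall>p\<in>U. \<exists>V. zariski_open V \<and> p \<in> V \<and> V \<subseteq> U \<and>
            (\<exists>m n P Q. homogeneous_poly m P \<and> homogeneous_poly n Q \<and> int m - int n = k \<and>
               (\<forall>v\<in>cone V. Q v \<noteq> 0 \<and> s v = P v / Q v)))}"

type_synonym 'n sheaf = "point set \<Rightarrow> (complex^3 \<Rightarrow> complex^'n) set"

text \<open>The direct sum of the line bundles \<open>\<O>(k\<^sub>i)\<close>.\<close>

definition twist_sum :: "int^'n \<Rightarrow> ('n::finite) sheaf" where
  "twist_sum k U = {s. \<forall>i. (\<lambda>v. s v $ i) \<in> twist_sections (k $ i) U}"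

definition restrict_section ::
    "point set \<Rightarrow> (complex^3 \<Rightarrow> complex^'n) \<Rightarrow> complex^3 \<Rightarrow> complex^'n" where
  "restrict_section V s = (\<lambda>v. if v \<in> cone V then s v else 0)"

type_synonym ('m, 'n) sheaf_map =
  "point set \<Rightarrow> (complex^3 \<Rightarrow> complex^'m) \<Rightarrow> complex^3 \<Rightarrow> complex^'n"

definition sheaf_hom :: "('m::finite) sheaf \<Rightarrow> ('n::finite) sheaf \<Rightarrow> ('m, 'n) sheaf_map \<Rightarrow> bool" where
  "sheaf_hom F G \<phi> \<longleftrightarrow>
     (\<forall>U. zariski_open U \<longrightarrow>
        (\<forall>s\<in>F U. \<phi> U s \<in> G U) \<and>
        (\<forall>s\<in>F U. \<forall>t\<in>F U. \<phi> U (\<lambda>v. s v + t v) = (\<lambda>v. \<phi> U s v + \<phi> U t v)) \<and>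
        (\<forall>g\<in>twist_sections 0 U. \<forall>s\<in>F U. \<phi> U (\<lambda>v. g v *s s v) = (\<lambda>v. g v *s \<phi> U s v)) \<and>
        (\<forall>V. zariski_open V \<and> V \<subseteq> U \<longrightarrow>
           (\<forall>s\<in>F U. \<phi> V (restrict_section V s) = restrict_section V (\<phi> U s))))"

definition sheaf_isomorphic :: "('m::finite) sheaf \<Rightarrow> ('n::finite) sheaf \<Rightarrow> bool" where
  "sheaf_isomorphic F G \<longleftrightarrow>
     (\<exists>\<phi>. sheaf_hom F G \<phi> \<and> (\<forall>U. zariski_open U \<longrightarrow> bij_betw (\<phi> U) (F U) (G U)))"

text \<open>Membership in the image sheaf, that is, in the sheafification of the image presheaf.\<close>

definition in_image_sheaf ::
    "('m::finite) sheaf \<Rightarrow> ('m, 'n::finite) sheaf_map \<Rightarrow> point set \<Rightarrow> (complex^3 \<Rightarrow> complex^'n) \<Rightarrow> bool" where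
  "in_image_sheaf F \<phi> U t \<longleftrightarrow>
     (\<forall>p\<in>U. \<exists>V. zariski_open V \<and> p \<in> V \<and> V \<subseteq> U \<and>
        (\<exists>s\<in>F V. \<phi> V s = restrict_section V t))"

definition short_exact ::
    "('l::finite) sheaf \<Rightarrow> ('m::finite) sheaf \<Rightarrow> ('n::finite) sheaf \<Rightarrow> ('l, 'm) sheaf_map \<Rightarrow> ('m, 'n) sheaf_map \<Rightarrow> bool" where
  "short_exact F G H \<phi> \<psi> \<longleftrightarrow>
     sheaf_hom F G \<phi> \<and> sheaf_hom G H \<psi> \<and>
     (\<forall>U. zariski_open U \<longrightarrow>
        inj_on (\<phi> U) (F U) \<and>
        (\<forall>t\<in>G U. \<psi> U t = (\<lambda>v. 0) \<longleftrightarrow> in_image_sheaf F \<phi> U t) \<and>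
        (\<forall>u\<in>H U. in_image_sheaf G \<psi> U u))"


subsection \<open>The vector bundle of an arrangement\<close>

text \<open>
  The defining polynomial depends on the choice of the linear forms only up to a nonzero scalar
  factor, which affects none of the notions below.
\<close>

definition form_of :: "line \<Rightarrow> complex^3" where
  "form_of H = (SOME \<alpha>. defines_line \<alpha> H)"

definition defining_poly :: "line set \<Rightarrow> complex^3 \<Rightarrow> complex" where
  "defining_poly \<A> v = (\<Prod>H\<in>\<A>. linear_form (form_of H) v)"

definition partial_deriv :: "3 \<Rightarrow> (complex^3 \<Rightarrow> complex) \<Rightarrow> complex^3 \<Rightarrow> complex" where
  "partial_deriv i f v = deriv (\<lambda>t. f (v + t *s axis i 1)) 0"

text \<open>The kernel of the gradient of the defining polynomial on \<open>\<O>\<^sup>3\<close>.\<close>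

definition arrangement_bundle :: "line set \<Rightarrow> 3 sheaf" where
  "arrangement_bundle \<A> U =
     {s \<in> twist_sum 0 U. \<forall>v. (\<Sum>i\<in>UNIV. partial_deriv i (defining_poly \<A>) v * s v $ i) = 0}"

text \<open>
  Exponents and levels are natural numbers; they are typed as integers, with the sign condition
  made explicit, so that twists such as \<open>-a\<close> and shifted exponents such as \<open>a - 1\<close> are untruncated.
\<close>

definition free_with_exponents :: "line set \<Rightarrow> int \<Rightarrow> int \<Rightarrow> bool" where
  "free_with_exponents \<A> a b \<longleftrightarrow>
     0 \<le> a \<and> 0 \<le> b \<and>
     sheaf_isomorphic (arrangement_bundle \<A>) (twist_sum (vector [- a, - b] :: int^2))"

definition plus_one_generated :: "line set \<Rightarrow> int \<Rightarrow> int \<Rightarrow> int \<Rightarrow> bool" where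
  "plus_one_generated \<A> a b d \<longleftrightarrow>
     0 \<le> a \<and> a \<le> b \<and> b \<le> d \<and>
     (\<exists>\<phi> \<psi>. short_exact
        (twist_sum (vector [- 1 - d] :: int^1))
        (twist_sum (vector [- d, - b, - a] :: int^3))
        (arrangement_bundle \<A>) \<phi> \<psi>)"

definition points_on :: "line \<Rightarrow> line set \<Rightarrow> point set" where
  "points_on l \<A> = {p \<in> l. \<exists>l'\<in>\<A> - {l}. p \<in> l'}"

end

theory Submission
  imports Defs "HOL-Computational_Algebra.Fundamental_Theorem_Algebra"
begin

text \<open>
  A section of the bundle of \<open>\<A>\<close> is a vector field that kills the defining polynomial \<open>f\<close>. Write \<open>f = \<alpha> f'\<close>
  with \<open>\<alpha>\<close> the linear form of \<open>l\<close>, let \<open>n\<close> be the number of lines and \<open>E\<close> the Euler field \<open>v \<mapsto> v\<close>.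

  Global sections of \<open>\<O>(k)\<close> are homogeneous polynomials of degree \<open>k\<close> (\<open>global_sections_twist\<close>), so the maps
  in the exact sequence are polynomial matrices (\<open>sheaf_hom_matrix\<close>). The sequence becomes a presentation
  (\<open>presentation_of_short_exact\<close>): three polynomial vector fields of degrees \<open>d, b, a\<close> that kill \<open>f\<close> and
  generate all such fields locally, and one relation, with coefficients of degrees \<open>1, d + 1 - b, d + 1 - a\<close>,
  that locally generates all relations.

  Restrict a field \<open>\<theta>\<close> of degree \<open>m \<le> d\<close> to \<open>l\<close>. It is tangent to all lines of \<open>\<A>\<close>, so at each of the \<open>d + 1\<close> points
  of \<open>l\<close> on other lines it is radial, that is, a multiple of \<open>E\<close>. Being radial at a point is the vanishing of a
  form of degree \<open>m + 1\<close> on \<open>l\<close>. For \<open>m < d\<close> the field is therefore radial along all of \<open>l\<close>, and for \<open>m = d\<close> only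
  one scalar obstructs this (\<open>radial_of_many_points\<close>). Some generator is not radial
  (\<open>nonradial_generator\<close>); it has degree \<open>d\<close>, and after subtracting multiples of it from the others
  exactly one generator, \<open>\<theta>\<^sub>p\<close>, is not radial (\<open>presentation_change_generators\<close>). The other two have degrees
  \<open>a\<close> and \<open>b\<close>.

  Restricted to \<open>l\<close>, the relation shows that the linear coefficient \<open>r\<^sub>p\<close> of \<open>\<theta>\<^sub>p\<close> vanishes on \<open>l\<close>, hence
  \<open>r\<^sub>p = c \<alpha>\<close>. The constant \<open>c\<close> is nonzero (\<open>presentation_coefficient_nonzero\<close>): otherwise the two other
  coefficients, which have positive degree, would have a common zero by Bezout (\<open>plane_curves_meet\<close>), and
  the bundle would not be generated there.

  A radial field \<open>\<theta>\<close> of degree \<open>m\<close> has the form \<open>\<alpha> \<eta> + g E\<close> with \<open>\<eta>\<close> of degree \<open>m - 1\<close> killing \<open>f'\<close>. So the two radial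
  generators yield fields \<open>\<eta>\<^sub>1, \<eta>\<^sub>2\<close> of degrees \<open>a - 1, b - 1\<close> in the bundle of \<open>\<A> \<setminus> {l}\<close>. Conversely, if \<open>\<tau>\<close> kills \<open>f'\<close>
  then \<open>\<alpha> \<tau> - \<tau>(\<alpha>) E / n\<close> kills \<open>f\<close> and is radial along \<open>l\<close>; the relation, in which \<open>\<theta>\<^sub>p\<close> has the coefficient \<open>c \<alpha>\<close>,
  eliminates \<open>\<theta>\<^sub>p\<close> from its expansion. Hence \<open>\<eta>\<^sub>1, \<eta>\<^sub>2\<close> form a basis (\<open>basis_of_deletion\<close>), which defines the
  isomorphism with \<open>\<O>(1 - a) \<oplus> \<O>(1 - b)\<close> (\<open>sheaf_isomorphic_of_basis\<close>).
\<close>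

section \<open>Polynomial functions on the affine cone\<close>

text \<open>
  Building polynomials from monomials makes their homogeneous parts visible; the ring operations follow.
\<close>

inductive polyfun :: "(complex^3 \<Rightarrow> complex) \<Rightarrow> bool" where
  monomial: "polyfun (\<lambda>v. c * v $ 1 ^ i * v $ 2 ^ j * v $ 3 ^ k)"
| add: "polyfun P \<Longrightarrow> polyfun Q \<Longrightarrow> polyfun (\<lambda>v. P v + Q v)"

lemma polyfun_const [simp]: "polyfun (\<lambda>v. c)"
  using polyfun.monomial[of c 0 0 0] by simp

lemma polyfun_coord [simp]: "polyfun (\<lambda>v. v $ i)"
proof -
  have "i = 1 \<or> i = 2 \<or> i = 3" by (rule exhaust_3)
  then show ?thesis
    using polyfun.monomial[of 1 1 0 0] polyfun.monomial[of 1 0 1 0] polyfun.monomial[of 1 0 0 1] by auto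
qed

lemma polyfun_add [simp]: "polyfun P \<Longrightarrow> polyfun Q \<Longrightarrow> polyfun (\<lambda>v. P v + Q v)"
  by (rule polyfun.add)

lemma polyfun_mult [simp]: "polyfun P \<Longrightarrow> polyfun Q \<Longrightarrow> polyfun (\<lambda>v. P v * Q v)"
proof (induction P arbitrary: Q rule: polyfun.induct)
  case (monomial c i j k)
  from monomial show ?case
  proof (induction Q rule: polyfun.induct)
    case (monomial c' i' j' k')
    have "(\<lambda>v::complex^3. (c * v $ 1 ^ i * v $ 2 ^ j * v $ 3 ^ k) * (c' * v $ 1 ^ i' * v $ 2 ^ j' * v $ 3 ^ k'))
       = (\<lambda>v. (c * c') * v $ 1 ^ (i + i') * v $ 2 ^ (j + j') * v $ 3 ^ (k + k'))"
      by (auto simp: power_add algebra_simps)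
    then show ?case using polyfun.monomial by presburger
  next
    case (add P Q)
    then show ?case using polyfun.add[OF add.IH] by (simp add: distrib_left)
  qed
next
  case (add P P')
  then show ?case using polyfun.add[of "\<lambda>v. P v * Q v" "\<lambda>v. P' v * Q v"] by (simp add: distrib_right)
qed

lemma polyfun_minus [simp]: "polyfun P \<Longrightarrow> polyfun (\<lambda>v. - P v)"
  using polyfun_mult[OF polyfun_const[of "-1"]] by simp

lemma polyfun_diff [simp]: "polyfun P \<Longrightarrow> polyfun Q \<Longrightarrow> polyfun (\<lambda>v. P v - Q v)"
  using polyfun_add[OF _ polyfun_minus, of P Q] by simp

lemma polyfun_power [simp]: "polyfun P \<Longrightarrow> polyfun (\<lambda>v. P v ^ n)"
  by (induction n) simp_all

lemma polyfun_sum [simp]: "(\<And>i. i \<in> I \<Longrightarrow> polyfun (P i)) \<Longrightarrow> polyfun (\<lambda>v. \<Sum>i\<in>I. P i v)"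
  by (induction I rule: infinite_finite_induct) simp_all

lemma polyfun_prod [simp]: "(\<And>i. i \<in> I \<Longrightarrow> polyfun (P i)) \<Longrightarrow> polyfun (\<lambda>v. \<Prod>i\<in>I. P i v)"
  by (induction I rule: infinite_finite_induct) simp_all

lemma polyfun_linear_form [simp]: "polyfun (linear_form \<alpha>)"
  unfolding linear_form_def [abs_def] by simp

text \<open>
  Statements about composition, restriction and division are proved along the ring operations instead of
  along monomials.
\<close>

lemma polyfun_induct [consumes 1, case_names const coord add mult]:
  assumes "polyfun P"
    and "\<And>c. R (\<lambda>v. c)" and "\<And>i. R (\<lambda>v. v $ i)"
    and "\<And>P Q. polyfun P \<Longrightarrow> polyfun Q \<Longrightarrow> R P \<Longrightarrow> R Q \<Longrightarrow> R (\<lambda>v. P v + Q v)"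
    and mult: "\<And>P Q. polyfun P \<Longrightarrow> polyfun Q \<Longrightarrow> R P \<Longrightarrow> R Q \<Longrightarrow> R (\<lambda>v. P v * Q v)"
  shows "R P"
  using assms(1)
proof (induction rule: polyfun.induct)
  case (monomial c i j k)
  have pow: "R (\<lambda>v. v $ l ^ n)" for l n
  proof (induction n)
    case 0
    then show ?case using assms(2)[of 1] by simp
  next
    case (Suc n)
    then show ?case using mult[OF polyfun_coord polyfun_power[OF polyfun_coord] assms(3) Suc] by simp
  qed
  show ?case by (intro mult pow assms(2)) auto
qed (auto intro: assms(4))

lemma linear_form_add [simp]: "linear_form \<alpha> (v + w) = linear_form \<alpha> v + linear_form \<alpha> w"
  by (simp add: linear_form_def algebra_simps sum.distrib)
lemma linear_form_diff [simp]: "linear_form \<alpha> (v - w) = linear_form \<alpha> v - linear_form \<alpha> w"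
  by (simp add: linear_form_def algebra_simps sum_subtractf)
lemma linear_form_scale [simp]: "linear_form \<alpha> (c *s v) = c * linear_form \<alpha> v"
  by (simp add: linear_form_def algebra_simps sum_distrib_left)
lemma linear_form_zero [simp]: "linear_form \<alpha> 0 = 0"
  by (simp add: linear_form_def)

lemma polyfun_compose_affine:
  assumes "polyfun P" and "\<And>i. polyfun (\<lambda>v. g v $ i)"
  shows "polyfun (\<lambda>v. P (g v))"
  using assms(1) by (induction rule: polyfun_induct) (auto intro: assms(2))

section \<open>Restriction to lines\<close>

lemma poly_eq_0_off_origin:
  fixes p :: "complex poly"
  assumes "\<And>t. t \<noteq> 0 \<Longrightarrow> poly p t = 0" shows "p = 0"
proof (rule ccontr)
  assume "p \<noteq> 0"
  then have "finite {t. poly p t = 0}" by (rule poly_roots_finite)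
  moreover have "UNIV - {0} \<subseteq> {t. poly p t = 0}" using assms by auto
  ultimately have "finite (UNIV - {0 :: complex})" using finite_subset by blast
  then show False by (simp add: infinite_UNIV_char_0)
qed

lemma polyfun_on_line:
  assumes "polyfun P"
  shows "\<exists>p. \<forall>t. P (a + t *s b) = poly p t"
  using assms
proof (induction rule: polyfun_induct)
  case (const c)
  show ?case by (rule exI[of _ "[:c:]"]) simp
next
  case (coord i)
  show ?case by (rule exI[of _ "[:a $ i, b $ i:]"]) simp
next
  case (add P Q)
  then obtain p q where "\<forall>t. P (a + t *s b) = poly p t" "\<forall>t. Q (a + t *s b) = poly q t" by blast
  then show ?case by (intro exI[of _ "p + q"]) simp
next
  case (mult P Q)
  then obtain p q where "\<forall>t. P (a + t *s b) = poly p t" "\<forall>t. Q (a + t *s b) = poly q t" by blast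
  then show ?case by (intro exI[of _ "p * q"]) simp
qed

text \<open>
  On the line through two points of \<open>S\<close> both functions become polynomials in one variable, and these
  form an integral domain. The sets of interest are the whole space and planes through the origin.
\<close>

lemma polyfun_domain_on:
  assumes "polyfun P" "polyfun Q"
    and S: "\<And>v w t. v \<in> S \<Longrightarrow> w \<in> S \<Longrightarrow> v + t *s (w - v) \<in> S"
    and z: "\<And>v. v \<in> S \<Longrightarrow> P v * Q v = 0"
    and "v0 \<in> S" "Q v0 \<noteq> 0" "v \<in> S"
  shows "P v = 0"
proof -
  obtain p where p: "\<And>t. P (v + t *s (v0 - v)) = poly p t" using polyfun_on_line[OF assms(1)] by blast
  obtain q where q: "\<And>t. Q (v + t *s (v0 - v)) = poly q t" using polyfun_on_line[OF assms(2)] by blast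
  have "poly (p * q) t = 0" for t
    using z[OF S[OF assms(7) assms(5), of t]] unfolding p q by simp
  then have "p * q = 0" using poly_all_0_iff_0 by blast
  moreover have "q \<noteq> 0" using q[of 1] assms(6) by auto
  ultimately have "p = 0" by simp
  then show ?thesis using p[of 0] by simp
qed

lemma polyfun_domain:
  assumes "polyfun P" "polyfun Q" "\<And>v. P v * Q v = 0" "Q v0 \<noteq> 0"
  shows "P v = 0"
  using polyfun_domain_on[of P Q UNIV v0 v] assms by simp

lemma polyfun_zero_off_zeros:
  assumes "polyfun P" "polyfun Q" "Q v0 \<noteq> 0" "\<And>v. Q v \<noteq> 0 \<Longrightarrow> P v = 0" shows "P v = 0"
proof (rule polyfun_domain[where Q = Q and ?v0.0 = v0])
  show "P v * Q v = 0" for v using assms(4)[of v] by auto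
qed (use assms in auto)

lemma polyfun_domain_plane:
  assumes "polyfun P" "polyfun Q" "\<And>v. linear_form \<alpha> v = 0 \<Longrightarrow> P v * Q v = 0"
    "linear_form \<alpha> v0 = 0" "Q v0 \<noteq> 0" "linear_form \<alpha> v = 0"
  shows "P v = 0"
  using polyfun_domain_on[of P Q "{v. linear_form \<alpha> v = 0}" v0 v] assms by simp

lemma linear_form_nonzero:
  assumes "\<alpha> \<noteq> 0"
  obtains u where "linear_form \<alpha> u = 1"
proof -
  obtain i where i: "\<alpha> $ i \<noteq> 0" using assms by (metis vec_eq_iff zero_index)
  have "linear_form \<alpha> (axis i (1 / \<alpha> $ i)) = (\<Sum>j\<in>UNIV. if j = i then 1 else 0)"
    unfolding linear_form_def by (intro sum.cong) (auto simp: axis_def i)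
  then show ?thesis using that by simp
qed

text \<open>
  The substitution of \<open>v - \<alpha>(v) u\<close>, where \<open>\<alpha>(u) = 1\<close>, projects onto the zero set of \<open>\<alpha>\<close>. By induction over
  the ring operations it changes every polynomial function by a multiple of \<open>\<alpha>\<close>, and it kills \<open>P\<close>.
\<close>

lemma polyfun_divide:
  assumes "polyfun P" "\<alpha> \<noteq> 0" "\<And>v. linear_form \<alpha> v = 0 \<Longrightarrow> P v = 0"
  obtains Q where "polyfun Q" "\<And>v. P v = linear_form \<alpha> v * Q v"
proof -
  obtain u where u: "linear_form \<alpha> u = 1" using linear_form_nonzero[OF assms(2)] .
  define \<pi> where "\<pi> v = v - linear_form \<alpha> v *s u" for v
  have pol: "polyfun P \<Longrightarrow> polyfun (\<lambda>v. P (\<pi> v))" for P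
    by (rule polyfun_compose_affine) (auto simp: \<pi>_def)
  have "\<exists>Q. polyfun Q \<and> (\<forall>v. P v - P (\<pi> v) = linear_form \<alpha> v * Q v)"
    using assms(1)
  proof (induction rule: polyfun_induct)
    case (const c)
    show ?case by (rule exI[of _ "\<lambda>v. 0"]) simp
  next
    case (coord i)
    show ?case by (rule exI[of _ "\<lambda>v. u $ i"]) (simp add: \<pi>_def)
  next
    case (add P Q)
    then obtain P' Q' where 1: "polyfun P'" "polyfun Q'" "\<forall>v. P v - P (\<pi> v) = linear_form \<alpha> v * P' v"
      "\<forall>v. Q v - Q (\<pi> v) = linear_form \<alpha> v * Q' v" by blast
    have "P v + Q v - (P (\<pi> v) + Q (\<pi> v)) = linear_form \<alpha> v * (P' v + Q' v)" for v
      unfolding distrib_left 1(3)[rule_format, symmetric] 1(4)[rule_format, symmetric] by simp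
    then show ?case using 1(1,2) by (intro exI[of _ "\<lambda>v. P' v + Q' v"]) simp
  next
    case (mult P Q)
    then obtain P' Q' where 1: "polyfun P'" "polyfun Q'" "\<forall>v. P v - P (\<pi> v) = linear_form \<alpha> v * P' v"
      "\<forall>v. Q v - Q (\<pi> v) = linear_form \<alpha> v * Q' v" by blast
    have "P v * Q v - P (\<pi> v) * Q (\<pi> v) = linear_form \<alpha> v * (P' v * Q v + P (\<pi> v) * Q' v)" for v
    proof -
      have "P v * Q v - P (\<pi> v) * Q (\<pi> v) = (P v - P (\<pi> v)) * Q v + P (\<pi> v) * (Q v - Q (\<pi> v))"
        by (simp add: algebra_simps)
      then show ?thesis unfolding 1(3)[rule_format] 1(4)[rule_format] by (simp add: algebra_simps)
    qed
    with 1 mult show ?case by (intro exI[of _ "\<lambda>v. P' v * Q v + P (\<pi> v) * Q' v"]) (simp add: pol)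
  qed
  then obtain Q where Q: "polyfun Q" "\<And>v. P v - P (\<pi> v) = linear_form \<alpha> v * Q v" by blast
  have "P (\<pi> v) = 0" for v using assms(3)[of "\<pi> v"] by (simp add: \<pi>_def u)
  then show ?thesis using that[OF Q(1)] Q(2) by simp
qed

section \<open>Homogeneous polynomial functions\<close>

text \<open>
  Degrees are integers because they arise as differences of twists; a degree that turns out to be
  negative then forces the function to vanish.
\<close>

definition hompoly :: "int \<Rightarrow> (complex^3 \<Rightarrow> complex) \<Rightarrow> bool" where
  "hompoly k P \<longleftrightarrow> polyfun P \<and> (\<forall>t v. t \<noteq> 0 \<longrightarrow> P (t *s v) = t powi k * P v)"

lemma hompoly_polyfun [simp]: "hompoly k P \<Longrightarrow> polyfun P"
  by (simp add: hompoly_def)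
lemma hompoly_scale: "hompoly k P \<Longrightarrow> t \<noteq> 0 \<Longrightarrow> P (t *s v) = t powi k * P v"
  by (simp add: hompoly_def)
lemma hompoly_zero [simp]: "hompoly k (\<lambda>v. 0)"
  by (simp add: hompoly_def)
lemma hompoly_const [simp]: "hompoly 0 (\<lambda>v. c)"
  by (simp add: hompoly_def)
lemma hompoly_coord [simp]: "hompoly 1 (\<lambda>v. v $ i)"
  by (simp add: hompoly_def)
lemma hompoly_linear_form [simp]: "hompoly 1 (linear_form \<alpha>)"
  by (simp add: hompoly_def)
lemma hompoly_add: "hompoly k P \<Longrightarrow> hompoly k Q \<Longrightarrow> hompoly k (\<lambda>v. P v + Q v)"
  by (simp add: hompoly_def algebra_simps)
lemma hompoly_diff: "hompoly k P \<Longrightarrow> hompoly k Q \<Longrightarrow> hompoly k (\<lambda>v. P v - Q v)"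
  by (simp add: hompoly_def algebra_simps)
lemma hompoly_minus: "hompoly k P \<Longrightarrow> hompoly k (\<lambda>v. - P v)"
  by (simp add: hompoly_def algebra_simps)
lemma hompoly_mult: "hompoly k P \<Longrightarrow> hompoly m Q \<Longrightarrow> k + m = n \<Longrightarrow> hompoly n (\<lambda>v. P v * Q v)"
  by (auto simp: hompoly_def power_int_add algebra_simps)
lemma hompoly_cmult: "hompoly k P \<Longrightarrow> hompoly k (\<lambda>v. c * P v)"
  by (rule hompoly_mult[OF hompoly_const]) simp_all
lemma hompoly_sum: "(\<And>i. i \<in> I \<Longrightarrow> hompoly k (P i)) \<Longrightarrow> hompoly k (\<lambda>v. \<Sum>i\<in>I. P i v)"
  by (induction I rule: infinite_finite_induct) (simp_all add: hompoly_add)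
lemma hompoly_prod:
  "finite I \<Longrightarrow> (\<And>i. i \<in> I \<Longrightarrow> hompoly (k i) (P i)) \<Longrightarrow> hompoly (\<Sum>i\<in>I. k i) (\<lambda>v. \<Prod>i\<in>I. P i v)"
  by (induction I rule: finite_induct) (auto intro!: hompoly_mult)
lemma hompoly_power: "hompoly k P \<Longrightarrow> hompoly (int n * k) (\<lambda>v. P v ^ n)"
  by (induction n) (auto intro!: hompoly_mult simp: algebra_simps)
lemma hompoly_coord_power [simp]: "hompoly (int n) (\<lambda>v. v $ i ^ n)"
  using hompoly_power[OF hompoly_coord[of i], of n] by simp

text \<open>
  Multiplied by \<open>A\<close>, the equation that expresses homogeneity of \<open>Q\<close> holds, and \<open>A\<close> can be cancelled.
\<close>

lemma hompoly_quotient: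
  assumes "hompoly k (\<lambda>v. A v * Q v)" "hompoly j A" "polyfun Q" "A v0 \<noteq> 0"
  shows "hompoly (k - j) Q"
proof -
  have "Q (t *s v) - t powi (k - j) * Q v = 0" if t: "t \<noteq> 0" for t v
  proof (rule polyfun_domain[where Q = A and ?v0.0 = v0 and P = "\<lambda>v. Q (t *s v) - t powi (k - j) * Q v"])
    show "polyfun (\<lambda>v. Q (t *s v) - t powi (k - j) * Q v)"
      using assms(3) by (intro polyfun_diff polyfun_compose_affine[OF assms(3)] polyfun_mult) auto
    fix v
    have "A (t *s v) * Q (t *s v) = t powi k * (A v * Q v)"
      using hompoly_scale[OF assms(1) t] by simp
    then have "t powi j * (A v * Q (t *s v)) = t powi j * (t powi (k - j) * (A v * Q v))"
      using hompoly_scale[OF assms(2) t, of v] t by (simp add: power_int_diff)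
    then have "A v * Q (t *s v) = t powi (k - j) * (A v * Q v)" using t by simp
    then show "(Q (t *s v) - t powi (k - j) * Q v) * A v = 0" by (simp add: algebra_simps)
  qed (use assms in auto)
  then show ?thesis using assms(3) by (simp add: hompoly_def)
qed

lemma homogeneous_poly_add:
  assumes "homogeneous_poly n P" "homogeneous_poly n Q"
  shows "homogeneous_poly n (\<lambda>v. P v + Q v)"
proof -
  obtain c d where "\<forall>v. P v = (\<Sum>i\<le>n. \<Sum>j\<le>n - i. c i j * v $ 1 ^ i * v $ 2 ^ j * v $ 3 ^ (n - i - j))"
     "\<forall>v. Q v = (\<Sum>i\<le>n. \<Sum>j\<le>n - i. d i j * v $ 1 ^ i * v $ 2 ^ j * v $ 3 ^ (n - i - j))"
    using assms unfolding homogeneous_poly_def by blast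
  then show ?thesis unfolding homogeneous_poly_def
    by (intro exI[of _ "\<lambda>i j. c i j + d i j"]) (simp add: algebra_simps sum.distrib)
qed

lemma homogeneous_poly_zero: "homogeneous_poly n (\<lambda>v. 0)"
  unfolding homogeneous_poly_def by (intro exI[of _ "\<lambda>i j. 0"]) simp

lemma homogeneous_poly_monomial:
  assumes "i + j + k = n"
  shows "homogeneous_poly n (\<lambda>v. c * v $ 1 ^ i * v $ 2 ^ j * v $ 3 ^ k)"
  unfolding homogeneous_poly_def
proof (intro exI[of _ "\<lambda>i' j'. if i' = i then (if j' = j then c else 0) else 0"] allI)
  fix v :: "complex^3"
  have "(\<Sum>i'\<le>n. \<Sum>j'\<le>n - i'. (if i' = i then if j' = j then c else 0 else 0) * v $ 1 ^ i' * v $ 2 ^ j' * v $ 3 ^ (n - i' - j'))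
    = (\<Sum>i'\<le>n. if i' = i then (\<Sum>j'\<le>n - i. if j' = j then c * v $ 1 ^ i * v $ 2 ^ j * v $ 3 ^ (n - i - j) else 0) else 0)"
    by (intro sum.cong refl) (simp add: if_distrib[of "\<lambda>x. x * _"] cong: if_cong)
  also have "\<dots> = c * v $ 1 ^ i * v $ 2 ^ j * v $ 3 ^ (n - i - j)"
    using assms by simp
  also have "n - i - j = k" using assms by simp
  finally show "c * v $ 1 ^ i * v $ 2 ^ j * v $ 3 ^ k = (\<Sum>i'\<le>n. \<Sum>j'\<le>n - i'. (if i' = i then if j' = j then c else 0 else 0) * v $ 1 ^ i' * v $ 2 ^ j' * v $ 3 ^ (n - i' - j'))" by simp
qed

text \<open>
  The homogeneous parts of \<open>P\<close> are the coefficients of the polynomials \<open>t \<mapsto> P (t v)\<close>.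
\<close>

lemma polyfun_homogeneous_parts:
  assumes "polyfun P"
  shows "\<exists>H N. (\<forall>k. homogeneous_poly k (H k)) \<and> (\<forall>n\<ge>N. \<forall>t v. P (t *s v) = (\<Sum>k<n. H k v * t ^ k))"
  using assms
proof (induction rule: polyfun.induct)
  case (monomial c i j l)
  let ?H = "\<lambda>k (v::complex^3). if k = i + j + l then c * v $ 1 ^ i * v $ 2 ^ j * v $ 3 ^ l else 0 :: complex"
  have "homogeneous_poly k (?H k)" for k
    by (cases "k = i + j + l") (simp_all add: homogeneous_poly_zero homogeneous_poly_monomial)
  moreover have "(\<Sum>k<n. ?H k v * t ^ k) = c * (t *s v) $ 1 ^ i * (t *s v) $ 2 ^ j * (t *s v) $ 3 ^ l"
    if "n \<ge> Suc (i + j + l)" for n t v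
  proof -
    have "(\<Sum>k<n. ?H k v * t ^ k) = (\<Sum>k<n. if k = i + j + l then c * v $ 1 ^ i * v $ 2 ^ j * v $ 3 ^ l * t ^ (i + j + l) else 0)"
      by (intro sum.cong) auto
    also have "\<dots> = c * v $ 1 ^ i * v $ 2 ^ j * v $ 3 ^ l * t ^ (i + j + l)"
      using that by auto
    finally show ?thesis by (simp add: power_mult_distrib power_add algebra_simps)
  qed
  ultimately show ?case by (intro exI[of _ ?H] exI[of _ "Suc (i + j + l)"]) auto
next
  case (add P Q)
  then obtain H N H' N' where 1: "\<forall>k. homogeneous_poly k (H k)" "\<forall>n\<ge>N. \<forall>t v. P (t *s v) = (\<Sum>k<n. H k v * t ^ k)"
    "\<forall>k. homogeneous_poly k (H' k)" "\<forall>n\<ge>N'. \<forall>t v. Q (t *s v) = (\<Sum>k<n. H' k v * t ^ k)" by blast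
  then show ?case
    by (intro exI[of _ "\<lambda>k v. H k v + H' k v"] exI[of _ "max N N'"])
       (auto simp: homogeneous_poly_add algebra_simps sum.distrib)
qed

text \<open>
  The polynomial \<open>t\<^bsup>-k\<^esup> P (t v)\<close> in \<open>t\<close> equals \<open>P v\<close> for \<open>t \<noteq> 0\<close> and vanishes at \<open>t = 0\<close>.
\<close>

lemma hompoly_neg:
  assumes "hompoly k P" "k < 0"
  shows "P v = 0"
proof -
  obtain p where p: "\<And>t. P (0 + t *s v) = poly p t" using polyfun_on_line[of P 0 v] assms by auto
  have "poly (monom 1 (nat (- k)) * p - [:P v:]) t = 0" if "t \<noteq> 0" for t
  proof -
    have "poly p t = t powi k * P v" using hompoly_scale[OF assms(1) that, of v] p[of t] by simp
    moreover have "t ^ nat (- k) = t powi (- k)" using assms(2) by (simp add: power_int_def)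
    ultimately show ?thesis using that by (simp add: poly_monom power_int_minus)
  qed
  then have "monom 1 (nat (- k)) * p - [:P v:] = 0" by (rule poly_eq_0_off_origin)
  then have "poly (monom 1 (nat (- k)) * p - [:P v:]) 0 = 0" by simp
  then show ?thesis using assms(2) by (simp add: poly_monom power_0_left)
qed

lemma hompoly_0_constant:
  assumes "hompoly 0 P" shows "P v = P 0"
proof -
  obtain q where q: "\<And>t. P (0 + t *s v) = poly q t" using polyfun_on_line[OF hompoly_polyfun[OF assms]] by blast
  have "q - [:P v:] = 0"
    by (rule poly_eq_0_off_origin) (use q hompoly_scale[OF assms, of _ v] in simp)
  then show ?thesis using q[of 0] by simp
qed

text \<open>
  Along \<open>t \<mapsto> P (t v)\<close> only the coefficient of \<open>t\<^sup>n\<close> survives, so that \<open>P\<close> is one of its homogeneous parts.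
\<close>

lemma hompoly_imp_homogeneous_poly:
  assumes "hompoly (int n) P"
  shows "homogeneous_poly n P"
proof -
  obtain H N where H: "\<And>k. homogeneous_poly k (H k)" "\<And>m t v. m \<ge> N \<Longrightarrow> P (t *s v) = (\<Sum>k<m. H k v * t ^ k)"
    using polyfun_homogeneous_parts[OF hompoly_polyfun[OF assms]] by blast
  define M where "M = max N (Suc n)"
  have "P v = H n v" for v
  proof -
    define p where "p = (\<Sum>k<M. monom (H k v) k)"
    have "poly (p - monom (P v) n) t = 0" if "t \<noteq> 0" for t
      using H(2)[of M t v] hompoly_scale[OF assms that, of v]
      by (simp add: p_def poly_sum poly_monom M_def algebra_simps)
    then have "p - monom (P v) n = 0" by (rule poly_eq_0_off_origin)
    then have "coeff p n = P v" by simp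
    moreover have "coeff p n = (\<Sum>k<M. if k = n then H n v else 0)"
      unfolding p_def coeff_sum by (intro sum.cong) auto
    then have "coeff p n = H n v" by (simp add: M_def)
    ultimately show ?thesis by simp
  qed
  then have "P = H n" by auto
  then show ?thesis using H(1) by simp
qed

lemma homogeneous_poly_imp_hompoly:
  assumes "homogeneous_poly n P"
  shows "hompoly (int n) P"
proof -
  obtain c where c: "\<And>v. P v = (\<Sum>i\<le>n. \<Sum>j\<le>n - i. c i j * v $ 1 ^ i * v $ 2 ^ j * v $ 3 ^ (n - i - j))"
    using assms unfolding homogeneous_poly_def by blast
  have "P = (\<lambda>v. \<Sum>i\<le>n. \<Sum>j\<le>n - i. c i j * v $ 1 ^ i * v $ 2 ^ j * v $ 3 ^ (n - i - j))" using c by auto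
  moreover have "hompoly (int n) (\<lambda>v. \<Sum>i\<le>n. \<Sum>j\<le>n - i. c i j * v $ 1 ^ i * v $ 2 ^ j * v $ 3 ^ (n - i - j))"
    by (intro hompoly_sum hompoly_mult[OF hompoly_mult[OF hompoly_cmult[OF hompoly_coord_power] hompoly_coord_power refl] hompoly_coord_power]) auto
  ultimately show ?thesis by simp
qed

section \<open>Zariski open sets and local sections in terms of polynomial functions\<close>

lemma mem_span_singleton: "w \<in> vec.span {v} \<longleftrightarrow> (\<exists>c. w = c *s v)" for v w :: "complex^3"
  by (auto simp: vec.span_singleton)

lemma span_scale: "t \<noteq> 0 \<Longrightarrow> vec.span {t *s v} = vec.span {v}" for v :: "complex^3"
proof -
  assume t: "t \<noteq> 0"
  have "w \<in> vec.span {t *s v} \<longleftrightarrow> w \<in> vec.span {v}" for w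
  proof
    assume "w \<in> vec.span {v}"
    then obtain c where "w = c *s v" by (auto simp: mem_span_singleton)
    then have "w = (c / t) *s (t *s v)" using t by simp
    then show "w \<in> vec.span {t *s v}" unfolding mem_span_singleton by blast
  next
    assume "w \<in> vec.span {t *s v}"
    then obtain c where "w = c *s (t *s v)" by (auto simp: mem_span_singleton)
    then have "w = (c * t) *s v" by simp
    then show "w \<in> vec.span {v}" unfolding mem_span_singleton by blast
  qed
  then show ?thesis by blast
qed

lemma cone_scale: "t \<noteq> 0 \<Longrightarrow> t *s v \<in> cone U \<longleftrightarrow> v \<in> cone U"
  by (auto simp: cone_def span_scale)

lemma cone_Int: "cone (U \<inter> V) = cone U \<inter> cone V"
  by (auto simp: cone_def)

lemma hompoly_at_zero:
  assumes "hompoly n Q" "0 < n" shows "Q 0 = 0"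
proof -
  have "Q 0 = 2 powi n * Q 0" using hompoly_scale[OF assms(1), of 2 0] by simp
  moreover have "(2::complex) powi n \<noteq> 1"
  proof -
    have "n = int (nat n)" using assms by simp
    then have "(2::complex) powi n = of_nat (2 ^ nat n)" by (metis of_nat_numeral of_nat_power power_int_of_nat)
    moreover have "2 ^ nat n \<noteq> (1::nat)" using assms by simp
    ultimately show ?thesis by (metis of_nat_eq_1_iff)
  qed
  ultimately show ?thesis by (metis mult_cancel_right1)
qed

lemma hompoly_nat: "hompoly n Q \<Longrightarrow> 0 \<le> n \<Longrightarrow> homogeneous_poly (nat n) Q"
  by (rule hompoly_imp_homogeneous_poly) simp

text \<open>
  One of the equations of the complement is nonzero at \<open>v\<close>. The extra factor, a coordinate that does not
  vanish at \<open>v\<close>, makes the degree positive; hence \<open>Q\<close> vanishes at the origin, which lies in no cone.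
\<close>

lemma zariski_open_cone_nhd:
  assumes "zariski_open V" "v \<in> cone V"
  obtains Q n where "hompoly n Q" "0 < n" "Q v \<noteq> 0" "\<And>w. Q w \<noteq> 0 \<Longrightarrow> w \<in> cone V"
proof -
  obtain F where F: "\<forall>P\<in>F. \<exists>k. homogeneous_poly k P"
    "V = proj_plane - {p \<in> proj_plane. \<forall>P\<in>F. \<forall>v\<in>p. P v = 0}"
    using assms(1) unfolding zariski_open_def by blast
  have "v \<noteq> 0" "vec.span {v} \<in> V" using assms(2) by (auto simp: cone_def)
  then obtain P w where P: "P \<in> F" "w \<in> vec.span {v}" "P w \<noteq> 0" using F(2) by blast
  obtain k where k: "homogeneous_poly k P" using F(1) P(1) by blast
  obtain c where c: "w = c *s v" using P(2) by (auto simp: mem_span_singleton)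
  have Pv: "P v \<noteq> 0"
  proof (cases "c = 0 \<and> k = 0")
    case True
    then show ?thesis using k P(3) by (auto simp: homogeneous_poly_def)
  next
    case False
    have h: "hompoly (int k) P" using homogeneous_poly_imp_hompoly[OF k] .
    show ?thesis
    proof (cases "c = 0")
      case True
      then show ?thesis using False hompoly_at_zero[OF h] P(3) c by simp
    next
      case c0: False
      then show ?thesis using hompoly_scale[OF h, of c v] P(3) c by auto
    qed
  qed
  obtain i where i: "v $ i \<noteq> 0" using \<open>v \<noteq> 0\<close> by (metis vec_eq_iff zero_index)
  show ?thesis
  proof (rule that[of "int k + 1" "\<lambda>v. P v * v $ i"])
    show "hompoly (int k + 1) (\<lambda>v. P v * v $ i)"
      by (rule hompoly_mult[OF homogeneous_poly_imp_hompoly[OF k] hompoly_coord refl])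
    show "P v * v $ i \<noteq> 0" using Pv i by simp
    fix w assume "P w * w $ i \<noteq> 0"
    then have "w \<noteq> 0" "P w \<noteq> 0" by auto
    moreover have "w \<in> vec.span {w}" by (simp add: vec.span_base)
    ultimately show "w \<in> cone V" using P(1) unfolding cone_def F(2) proj_plane_def by blast
  qed simp
qed

lemma zariski_open_subset: "zariski_open V \<Longrightarrow> V \<subseteq> proj_plane"
  by (auto simp: zariski_open_def)

text \<open>
  The equations of the complement are all the \<open>Q\<close> whose nonvanishing set lies in the cone.
\<close>

lemma zariski_openI:
  assumes "V \<subseteq> proj_plane"
    and nhd: "\<And>v. v \<in> cone V \<Longrightarrow> \<exists>Q n. hompoly n Q \<and> 0 < n \<and> Q v \<noteq> 0 \<and> (\<forall>w. Q w \<noteq> 0 \<longrightarrow> w \<in> cone V)"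
  shows "zariski_open V"
  unfolding zariski_open_def
proof (intro exI conjI)
  let ?F = "{Q. \<exists>n. hompoly n Q \<and> 0 < n \<and> (\<forall>w. Q w \<noteq> 0 \<longrightarrow> w \<in> cone V)}"
  show "\<forall>P\<in>?F. \<exists>k. homogeneous_poly k P" using hompoly_nat by fastforce
  have mem: "p \<in> V \<longleftrightarrow> (\<exists>Q\<in>?F. \<exists>w\<in>p. Q w \<noteq> 0)" if p: "p \<in> proj_plane" for p
  proof -
    obtain v where v: "v \<noteq> 0" "p = vec.span {v}" using p by (auto simp: proj_plane_def)
    show ?thesis
    proof
      assume "p \<in> V"
      then have "v \<in> cone V" using v by (simp add: cone_def)
      then obtain Q n where "hompoly n Q" "0 < n" "Q v \<noteq> 0" "\<forall>w. Q w \<noteq> 0 \<longrightarrow> w \<in> cone V" using nhd by blast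
      moreover have "v \<in> p" using v by (simp add: vec.span_base)
      ultimately show "\<exists>Q\<in>?F. \<exists>w\<in>p. Q w \<noteq> 0" by blast
    next
      assume "\<exists>Q\<in>?F. \<exists>w\<in>p. Q w \<noteq> 0"
      then obtain w where w: "w \<in> p" "w \<in> cone V" by blast
      obtain c where c: "w = c *s v" using w(1) v by (auto simp: mem_span_singleton)
      have "c \<noteq> 0" using w(2) c by (auto simp: cone_def)
      then have "v \<in> cone V" using w(2) c cone_scale by blast
      then show "p \<in> V" using v by (simp add: cone_def)
    qed
  qed
  show "V = proj_plane - {p \<in> proj_plane. \<forall>P\<in>?F. \<forall>v\<in>p. P v = 0}"
    using mem assms(1) by blast
qed

lemma zariski_open_Int:
  assumes "zariski_open U" "zariski_open V"
  shows "zariski_open (U \<inter> V)"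
proof (rule zariski_openI)
  show "U \<inter> V \<subseteq> proj_plane" using zariski_open_subset[OF assms(1)] by blast
  fix v assume "v \<in> cone (U \<inter> V)"
  then have v: "v \<in> cone U" "v \<in> cone V" by (auto simp: cone_Int)
  obtain P m where P: "hompoly m P" "0 < m" "P v \<noteq> 0" "\<And>w. P w \<noteq> 0 \<Longrightarrow> w \<in> cone U"
    using zariski_open_cone_nhd[OF assms(1) v(1)] by blast
  obtain Q n where Q: "hompoly n Q" "0 < n" "Q v \<noteq> 0" "\<And>w. Q w \<noteq> 0 \<Longrightarrow> w \<in> cone V"
    using zariski_open_cone_nhd[OF assms(2) v(2)] by blast
  show "\<exists>Q n. hompoly n Q \<and> 0 < n \<and> Q v \<noteq> 0 \<and> (\<forall>w. Q w \<noteq> 0 \<longrightarrow> w \<in> cone (U \<inter> V))"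
    using P Q by (intro exI[of _ "\<lambda>v. P v * Q v"] exI[of _ "m + n"]) (auto simp: cone_Int intro: hompoly_mult)
qed

definition basic_open :: "(complex^3 \<Rightarrow> complex) \<Rightarrow> point set" where
  "basic_open Q = {p \<in> proj_plane. \<exists>v\<in>p. Q v \<noteq> 0}"

lemma cone_basic_open:
  assumes "hompoly n Q" "0 < n"
  shows "cone (basic_open Q) = {w. Q w \<noteq> 0}"
proof -
  have Q0: "Q 0 = 0" by (rule hompoly_at_zero[OF assms])
  have "w \<in> cone (basic_open Q) \<longleftrightarrow> Q w \<noteq> 0" for w
  proof
    assume "w \<in> cone (basic_open Q)"
    then obtain c where c: "Q (c *s w) \<noteq> 0" by (auto simp: cone_def basic_open_def mem_span_singleton)
    then have "c \<noteq> 0" using Q0 by auto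
    then show "Q w \<noteq> 0" using c hompoly_scale[OF assms(1), of c w] by auto
  next
    assume w: "Q w \<noteq> 0"
    then have "w \<noteq> 0" using Q0 by auto
    then show "w \<in> cone (basic_open Q)" using w vec.span_base[of w "{w}"]
      by (auto simp: cone_def basic_open_def proj_plane_def)
  qed
  then show ?thesis by auto
qed

lemma zariski_open_basic_open:
  assumes "hompoly n Q" "0 < n"
  shows "zariski_open (basic_open Q)"
proof (rule zariski_openI)
  show "basic_open Q \<subseteq> proj_plane" by (auto simp: basic_open_def)
qed (use assms cone_basic_open[OF assms] in auto)

lemma zariski_open_proj_plane: "zariski_open proj_plane"
  unfolding zariski_open_def
  using hompoly_imp_homogeneous_poly[of 0 "\<lambda>v. 1"]
  by (intro exI[of _ "{\<lambda>v. 1}"]) (auto simp: proj_plane_def intro: vec.span_base)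

lemma cone_proj_plane: "v \<in> cone proj_plane \<longleftrightarrow> v \<noteq> 0"
  by (auto simp: cone_def proj_plane_def)

abbreviation chart :: "3 \<Rightarrow> point set" where "chart i \<equiv> basic_open (\<lambda>v. v $ i)"

lemma cone_chart: "v \<in> cone (chart i) \<longleftrightarrow> v $ i \<noteq> 0"
  using cone_basic_open[OF hompoly_coord[of i]] by auto

lemma zariski_open_chart: "zariski_open (chart i)"
  by (rule zariski_open_basic_open[OF hompoly_coord]) simp

lemma subset_iff_cone:
  assumes "zariski_open U" "zariski_open V"
  shows "U \<subseteq> V \<longleftrightarrow> cone U \<subseteq> cone V"
proof
  assume c: "cone U \<subseteq> cone V"
  show "U \<subseteq> V"
  proof
    fix p assume p: "p \<in> U"
    then obtain v where "v \<noteq> 0" "p = vec.span {v}"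
      using zariski_open_subset[OF assms(1)] by (auto simp: proj_plane_def)
    then show "p \<in> V" using c p by (auto simp: cone_def)
  qed
qed (auto simp: cone_def)

text \<open>
  A local quotient that is valid on the whole nonvanishing set of its denominator. The positive degree of
  \<open>Q\<close> keeps the origin out of that set.
\<close>

definition regular_at :: "int \<Rightarrow> point set \<Rightarrow> (complex^3 \<Rightarrow> complex) \<Rightarrow> complex^3 \<Rightarrow> bool" where
  "regular_at k U s v \<longleftrightarrow> (\<exists>P Q n. hompoly n Q \<and> 0 < n \<and> hompoly (n + k) P \<and> Q v \<noteq> 0 \<and>
      (\<forall>w. Q w \<noteq> 0 \<longrightarrow> w \<in> cone U \<and> s w = P w / Q w))"

lemma regular_atE:
  assumes "regular_at k U s v"
  obtains P Q n where "hompoly n Q" "0 < n" "hompoly (n + k) P" "Q v \<noteq> 0"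
     "\<And>w. Q w \<noteq> 0 \<Longrightarrow> w \<in> cone U" "\<And>w. Q w \<noteq> 0 \<Longrightarrow> s w = P w / Q w"
  using assms unfolding regular_at_def by blast

text \<open>
  Local quotients on neighbourhoods of points of \<open>U\<close> are replaced by quotients on nonvanishing sets of
  homogeneous polynomials, so that open sets no longer have to be mentioned.
\<close>

lemma twist_sections_iff:
  assumes "zariski_open U"
  shows "s \<in> twist_sections k U \<longleftrightarrow> (\<forall>v. v \<notin> cone U \<longrightarrow> s v = 0) \<and> (\<forall>v\<in>cone U. regular_at k U s v)"
proof (intro iffI conjI)
  assume s: "s \<in> twist_sections k U"
  then show "\<forall>v. v \<notin> cone U \<longrightarrow> s v = 0" by (simp add: twist_sections_def)
  show "\<forall>v\<in>cone U. regular_at k U s v"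
  proof
    fix v assume v: "v \<in> cone U"
    then have "vec.span {v} \<in> U" "v \<noteq> 0" by (auto simp: cone_def)
    then obtain V m n P Q where V: "zariski_open V" "vec.span {v} \<in> V" "V \<subseteq> U"
      and PQ: "homogeneous_poly m P" "homogeneous_poly n Q" "int m - int n = k"
        "\<And>v. v \<in> cone V \<Longrightarrow> Q v \<noteq> 0 \<and> s v = P v / Q v"
      using s unfolding twist_sections_def by blast
    have vV: "v \<in> cone V" using V(2) \<open>v \<noteq> 0\<close> by (simp add: cone_def)
    obtain G g where G: "hompoly g G" "0 < g" "G v \<noteq> 0" "\<And>w. G w \<noteq> 0 \<Longrightarrow> w \<in> cone V"
      using zariski_open_cone_nhd[OF V(1) vV] by blast
    have sub: "cone V \<subseteq> cone U" using V(3) by (auto simp: cone_def)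
    show "regular_at k U s v"
      unfolding regular_at_def
    proof (intro exI conjI allI impI)
      show "hompoly (int n + g) (\<lambda>v. Q v * G v)"
        using homogeneous_poly_imp_hompoly[OF PQ(2)] G(1) by (rule hompoly_mult) simp
      show "hompoly (int n + g + k) (\<lambda>v. P v * G v)"
        using homogeneous_poly_imp_hompoly[OF PQ(1)] G(1) by (rule hompoly_mult) (use PQ(3) in simp)
    qed (use G PQ(4) vV sub in auto)
  qed
next
  assume s: "(\<forall>v. v \<notin> cone U \<longrightarrow> s v = 0) \<and> (\<forall>v\<in>cone U. regular_at k U s v)"
  show "s \<in> twist_sections k U"
    unfolding twist_sections_def
  proof (intro CollectI conjI ballI)
    fix p assume p: "p \<in> U"
    then obtain v where v: "v \<noteq> 0" "p = vec.span {v}"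
      using zariski_open_subset[OF assms] by (auto simp: proj_plane_def)
    then have "v \<in> cone U" using p by (simp add: cone_def)
    then have "regular_at k U s v" using s by blast
    then obtain P Q n where PQ: "hompoly n Q" "0 < n" "hompoly (n + k) P" "Q v \<noteq> 0"
      "\<And>w. Q w \<noteq> 0 \<Longrightarrow> w \<in> cone U" "\<And>w. Q w \<noteq> 0 \<Longrightarrow> s w = P w / Q w" by (rule regular_atE) blast
    let ?V = "basic_open Q"
    have cV: "cone ?V = {w. Q w \<noteq> 0}" by (rule cone_basic_open[OF PQ(1,2)])
    have oV: "zariski_open ?V" by (rule zariski_open_basic_open[OF PQ(1,2)])
    \<comment> \<open>a power of the denominator makes the degree of the numerator nonnegative\<close>
    define N where "N = nat \<bar>k\<bar>"
    have hQ: "hompoly (int N * n + n) (\<lambda>v. Q v ^ N * Q v)"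
      by (rule hompoly_mult[OF hompoly_power[OF PQ(1)] PQ(1) refl])
    have hP: "hompoly (int N * n + (n + k)) (\<lambda>v. Q v ^ N * P v)"
      by (rule hompoly_mult[OF hompoly_power[OF PQ(1)] PQ(3) refl])
    have "int N * n \<ge> int N * 1" using PQ(2) by (intro mult_left_mono) auto
    then have ge: "int N * n \<ge> \<bar>k\<bar>" unfolding N_def by simp
    show "\<exists>V. zariski_open V \<and> p \<in> V \<and> V \<subseteq> U \<and>
            (\<exists>m n P Q. homogeneous_poly m P \<and> homogeneous_poly n Q \<and> int m - int n = k \<and>
               (\<forall>v\<in>cone V. Q v \<noteq> 0 \<and> s v = P v / Q v))"
    proof (intro exI conjI ballI)
      show "zariski_open ?V" by (rule oV)
      have "v \<in> cone ?V" using cV PQ(4) by simp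
      then show "p \<in> ?V" using v by (simp add: cone_def)
      show "?V \<subseteq> U" using PQ(5) by (subst subset_iff_cone[OF oV assms]) (auto simp: cV)
      show "homogeneous_poly (nat (int N * n + (n + k))) (\<lambda>v. Q v ^ N * P v)"
        using hP ge PQ(2) by (intro hompoly_nat) auto
      show "homogeneous_poly (nat (int N * n + n)) (\<lambda>v. Q v ^ N * Q v)"
        using hQ ge PQ(2) by (intro hompoly_nat) auto
      show "int (nat (int N * n + (n + k))) - int (nat (int N * n + n)) = k"
        using ge PQ(2) by simp
    qed (use PQ(6) cV in auto)
  qed (use s in auto)
qed

lemma twist_section_outside: "s \<in> twist_sections k U \<Longrightarrow> v \<notin> cone U \<Longrightarrow> s v = 0"
  by (simp add: twist_sections_def)

lemma twist_section_regular:
  "zariski_open U \<Longrightarrow> s \<in> twist_sections k U \<Longrightarrow> v \<in> cone U \<Longrightarrow> regular_at k U s v"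
  by (simp add: twist_sections_iff)

lemma regular_at_add:
  assumes "regular_at k U s v" "regular_at k U t v"
  shows "regular_at k U (\<lambda>v. s v + t v) v"
proof -
  obtain P Q n where 1: "hompoly n Q" "0 < n" "hompoly (n + k) P" "Q v \<noteq> 0"
      "\<And>w. Q w \<noteq> 0 \<Longrightarrow> w \<in> cone U" "\<And>w. Q w \<noteq> 0 \<Longrightarrow> s w = P w / Q w" using assms(1) by (rule regular_atE) blast
  obtain P' Q' n' where 2: "hompoly n' Q'" "0 < n'" "hompoly (n' + k) P'" "Q' v \<noteq> 0"
      "\<And>w. Q' w \<noteq> 0 \<Longrightarrow> w \<in> cone U" "\<And>w. Q' w \<noteq> 0 \<Longrightarrow> t w = P' w / Q' w" using assms(2) by (rule regular_atE) blast
  show ?thesis unfolding regular_at_def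
  proof (intro exI conjI allI impI)
    show "hompoly (n + n') (\<lambda>v. Q v * Q' v)" by (rule hompoly_mult[OF 1(1) 2(1) refl])
    show "hompoly (n + n' + k) (\<lambda>v. P v * Q' v + P' v * Q v)"
      by (intro hompoly_add hompoly_mult[OF 1(3) 2(1)] hompoly_mult[OF 2(3) 1(1)]) auto
  qed (use 1 2 in \<open>auto simp: field_simps\<close>)
qed

lemma regular_at_mult:
  assumes "regular_at k U s v" "regular_at m U t v"
  shows "regular_at (k + m) U (\<lambda>v. s v * t v) v"
proof -
  obtain P Q n where 1: "hompoly n Q" "0 < n" "hompoly (n + k) P" "Q v \<noteq> 0"
      "\<And>w. Q w \<noteq> 0 \<Longrightarrow> w \<in> cone U" "\<And>w. Q w \<noteq> 0 \<Longrightarrow> s w = P w / Q w" using assms(1) by (rule regular_atE) blast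
  obtain P' Q' n' where 2: "hompoly n' Q'" "0 < n'" "hompoly (n' + m) P'" "Q' v \<noteq> 0"
      "\<And>w. Q' w \<noteq> 0 \<Longrightarrow> w \<in> cone U" "\<And>w. Q' w \<noteq> 0 \<Longrightarrow> t w = P' w / Q' w" using assms(2) by (rule regular_atE) blast
  show ?thesis unfolding regular_at_def
  proof (intro exI conjI allI impI)
    show "hompoly (n + n') (\<lambda>v. Q v * Q' v)" by (rule hompoly_mult[OF 1(1) 2(1) refl])
    show "hompoly (n + n' + (k + m)) (\<lambda>v. P v * P' v)"
      by (rule hompoly_mult[OF 1(3) 2(3)]) auto
  qed (use 1 2 in auto)
qed

text \<open>
  Regularity at a point depends only on the values near that point.
\<close>

lemma regular_at_restrict:
  assumes "regular_at k U s v" "zariski_open V" "v \<in> cone V"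
    and "\<And>w. w \<in> cone U \<Longrightarrow> w \<in> cone V \<Longrightarrow> w \<in> cone W \<and> t w = s w"
  shows "regular_at k W t v"
proof -
  obtain P Q n where 1: "hompoly n Q" "0 < n" "hompoly (n + k) P" "Q v \<noteq> 0"
      "\<And>w. Q w \<noteq> 0 \<Longrightarrow> w \<in> cone U" "\<And>w. Q w \<noteq> 0 \<Longrightarrow> s w = P w / Q w" using assms(1) by (rule regular_atE) blast
  obtain G g where G: "hompoly g G" "0 < g" "G v \<noteq> 0" "\<And>w. G w \<noteq> 0 \<Longrightarrow> w \<in> cone V"
      using zariski_open_cone_nhd[OF assms(2,3)] by blast
  show ?thesis unfolding regular_at_def
  proof (intro exI conjI allI impI)
    show "hompoly (n + g) (\<lambda>v. Q v * G v)" by (rule hompoly_mult[OF 1(1) G(1) refl])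
    show "hompoly (n + g + k) (\<lambda>v. P v * G v)"
      by (rule hompoly_mult[OF 1(3) G(1)]) auto
  qed (use 1 G assms(4) in auto)
qed

lemma regular_at_hompoly:
  assumes "hompoly k P" "zariski_open U" "v \<in> cone U" "\<And>w. w \<in> cone U \<Longrightarrow> s w = P w"
  shows "regular_at k U s v"
proof -
  obtain G g where G: "hompoly g G" "0 < g" "G v \<noteq> 0" "\<And>w. G w \<noteq> 0 \<Longrightarrow> w \<in> cone U"
      using zariski_open_cone_nhd[OF assms(2,3)] by blast
  show ?thesis unfolding regular_at_def
  proof (intro exI conjI allI impI)
    show "hompoly g G" by (rule G(1))
    show "hompoly (g + k) (\<lambda>v. G v * P v)"
      by (rule hompoly_mult[OF G(1) assms(1)]) auto
  qed (use G assms(4) in auto)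
qed

lemma regular_at_diff:
  assumes "zariski_open U" "v \<in> cone U" "regular_at k U s v" "regular_at k U t v"
  shows "regular_at k U (\<lambda>v. s v - t v) v"
proof -
  have "regular_at 0 U (\<lambda>v. -1) v" by (rule regular_at_hompoly[OF hompoly_const assms(1,2)]) simp
  from regular_at_add[OF assms(3) regular_at_mult[OF assms(4) this, simplified]] show ?thesis by simp
qed

lemma twist_sections_add:
  "zariski_open U \<Longrightarrow> s \<in> twist_sections k U \<Longrightarrow> t \<in> twist_sections k U \<Longrightarrow> (\<lambda>v. s v + t v) \<in> twist_sections k U"
  by (simp add: twist_sections_iff regular_at_add)

lemma twist_sections_mult:
  "zariski_open U \<Longrightarrow> s \<in> twist_sections k U \<Longrightarrow> t \<in> twist_sections m U \<Longrightarrow> k + m = n \<Longrightarrow>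
   (\<lambda>v. s v * t v) \<in> twist_sections n U"
  using regular_at_mult by (auto simp: twist_sections_iff)

lemma twist_sections_hompoly:
  assumes "hompoly k P" "zariski_open U"
  shows "(\<lambda>v. if v \<in> cone U then P v else 0) \<in> twist_sections k U"
  using regular_at_hompoly[OF assms] assms(2) by (auto simp: twist_sections_iff)

lemma twist_sections_zero: "zariski_open U \<Longrightarrow> (\<lambda>v. 0) \<in> twist_sections k U"
  using twist_sections_hompoly[OF hompoly_zero] by simp

lemma twist_sections_sum:
  "zariski_open U \<Longrightarrow> (\<And>i. i \<in> I \<Longrightarrow> s i \<in> twist_sections k U) \<Longrightarrow> (\<lambda>v. \<Sum>i\<in>I. s i v) \<in> twist_sections k U"
  by (induction I rule: infinite_finite_induct) (simp_all add: twist_sections_zero twist_sections_add)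

lemma twist_sections_restrict:
  assumes "zariski_open U" "zariski_open V" "V \<subseteq> U" "s \<in> twist_sections k U"
  shows "(\<lambda>v. if v \<in> cone V then s v else 0) \<in> twist_sections k V"
proof -
  have sub: "cone V \<subseteq> cone U" using assms by (auto simp: cone_def)
  have "regular_at k V (\<lambda>v. if v \<in> cone V then s v else 0) v" if "v \<in> cone V" for v
    by (rule regular_at_restrict[OF twist_section_regular[OF assms(1,4)] assms(2) that]) (use that sub in auto)
  then show ?thesis using assms(2) by (auto simp: twist_sections_iff)
qed

text \<open>
  Where the \<open>i\<close>-th coordinate does not vanish, its \<open>k\<close>-th power trivializes \<open>\<O>(k)\<close>.
\<close>

lemma twist_sections_coord_power:
  assumes "zariski_open U" "\<And>v. v \<in> cone U \<Longrightarrow> v $ i \<noteq> 0"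
  shows "(\<lambda>v. if v \<in> cone U then (v $ i) powi k else 0) \<in> twist_sections k U"
proof -
  have "regular_at k U (\<lambda>v. if v \<in> cone U then (v $ i) powi k else 0) v" if v: "v \<in> cone U" for v
  proof -
    obtain G g where G: "hompoly g G" "0 < g" "G v \<noteq> 0" "\<And>w. G w \<noteq> 0 \<Longrightarrow> w \<in> cone U"
      using zariski_open_cone_nhd[OF assms(1) v] by blast
    show ?thesis unfolding regular_at_def
    proof (intro exI conjI allI impI)
      show "hompoly (g + int (nat (-k))) (\<lambda>v. G v * v $ i ^ nat (-k))"
        by (rule hompoly_mult[OF G(1) hompoly_coord_power refl])
      show "hompoly (g + int (nat (-k)) + k) (\<lambda>v. G v * v $ i ^ nat k)"
        by (rule hompoly_mult[OF G(1) hompoly_coord_power]) simp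
      fix w assume "G w * w $ i ^ nat (- k) \<noteq> 0"
      then show "(if w \<in> cone U then (w $ i) powi k else 0) = G w * w $ i ^ nat k / (G w * w $ i ^ nat (-k))"
        using G(4)[of w] assms(2)[of w] by (simp add: power_int_def field_simps)
    qed (use G assms(2) v in auto)
  qed
  then show ?thesis using assms by (auto simp: twist_sections_iff)
qed

lemma twist_section_scale:
  assumes "zariski_open U" "s \<in> twist_sections k U" "t \<noteq> 0"
  shows "s (t *s v) = t powi k * s v"
proof (cases "v \<in> cone U")
  case True
  obtain P Q n where 1: "hompoly n Q" "0 < n" "hompoly (n + k) P" "Q v \<noteq> 0"
      "\<And>w. Q w \<noteq> 0 \<Longrightarrow> w \<in> cone U" "\<And>w. Q w \<noteq> 0 \<Longrightarrow> s w = P w / Q w"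
    using twist_section_regular[OF assms(1,2) True] by (rule regular_atE) blast
  have "Q (t *s v) \<noteq> 0" using hompoly_scale[OF 1(1) assms(3)] 1(4) assms(3) by simp
  then show ?thesis using 1(4,6) hompoly_scale[OF 1(1) assms(3), of v] hompoly_scale[OF 1(3) assms(3), of v] assms(3)
    by (simp add: power_int_add)
next
  case False
  then show ?thesis using assms twist_section_outside cone_scale by (metis mult_zero_right)
qed

lemma common_denominator:
  fixes s :: "'i::finite \<Rightarrow> complex^3 \<Rightarrow> complex"
  assumes "\<And>i. regular_at (k i) U (s i) v"
  obtains P Q n where "hompoly n Q" "0 < n" "\<And>i. hompoly (n + k i) (P i)" "Q v \<noteq> 0"
     "\<And>w. Q w \<noteq> 0 \<Longrightarrow> w \<in> cone U" "\<And>i w. Q w \<noteq> 0 \<Longrightarrow> s i w = P i w / Q w"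
proof -
  have "\<forall>i. \<exists>P Q n. hompoly n Q \<and> 0 < n \<and> hompoly (n + k i) P \<and> Q v \<noteq> 0 \<and>
      (\<forall>w. Q w \<noteq> 0 \<longrightarrow> w \<in> cone U \<and> s i w = P w / Q w)"
    using assms unfolding regular_at_def by blast
  then obtain P Q n where 1: "\<And>i. hompoly (n i) (Q i)" "\<And>i. 0 < n i" "\<And>i. hompoly (n i + k i) (P i)"
    "\<And>i. Q i v \<noteq> 0" "\<And>i w. Q i w \<noteq> 0 \<Longrightarrow> w \<in> cone U \<and> s i w = P i w / Q i w"
    by metis
  define R where "R = (\<lambda>v. \<Prod>i\<in>UNIV. Q i v)"
  define P' where "P' = (\<lambda>i v. P i v * (\<Prod>j\<in>UNIV - {i}. Q j v))"
  have R: "R w = Q i w * (\<Prod>j\<in>UNIV - {i}. Q j w)" for i w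
    unfolding R_def by (simp add: prod.remove)
  show ?thesis
  proof (rule that[of "\<Sum>i\<in>UNIV. n i" R P'])
    show "hompoly (\<Sum>i\<in>UNIV. n i) R" unfolding R_def by (rule hompoly_prod) (auto simp: 1)
    show "0 < (\<Sum>i\<in>UNIV. n i)" by (rule sum_pos) (auto simp: 1)
    show "hompoly ((\<Sum>i\<in>UNIV. n i) + k i) (P' i)" for i
      unfolding P'_def
      by (rule hompoly_mult[OF 1(3) hompoly_prod[of _ n]]) (auto simp: 1 sum.remove[of UNIV i n])
    show "R v \<noteq> 0" using 1(4) by (simp add: R_def)
    show "w \<in> cone U" if "R w \<noteq> 0" for w using that 1(5)[of undefined w] R[of w undefined] by auto
    show "s i w = P' i w / R w" if "R w \<noteq> 0" for w i
      using that 1(5)[of i w] R[of w i] by (simp add: P'_def)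
  qed
qed

section \<open>Global sections of line bundles\<close>

text \<open>
  One representation \<open>q g = p\<close> holds off the zeros of some polynomial and hence everywhere, by comparison
  with the local quotient at each point. A zero of \<open>q\<close> is then also a zero of \<open>p\<close>, and the common factor
  cancels; this continues until \<open>q\<close> is constant.
\<close>

lemma locally_rational_imp_polynomial:
  fixes g :: "complex \<Rightarrow> complex"
  assumes loc: "\<And>t0. \<exists>p q. poly q t0 \<noteq> 0 \<and> (\<forall>t. poly q t \<noteq> 0 \<longrightarrow> g t = poly p t / poly q t)"
  shows "\<exists>G. \<forall>t. g t = poly G t"
proof -
  have ext: "poly q t1 * g t1 = poly p t1"
    if "r \<noteq> 0" "\<And>t. poly r t \<noteq> 0 \<Longrightarrow> poly q t * g t = poly p t" for p q r t1
  proof -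
    obtain p2 q2 where 2: "poly q2 t1 \<noteq> 0" "\<And>t. poly q2 t \<noteq> 0 \<Longrightarrow> g t = poly p2 t / poly q2 t"
      using loc[of t1] by blast
    have "poly ((p * q2 - p2 * q) * (r * q2)) t = 0" for t
    proof (cases "poly r t = 0 \<or> poly q2 t = 0")
      case False
      then have "poly p t = poly q t * g t" "g t * poly q2 t = poly p2 t"
        using that(2)[of t] 2(2)[of t] by auto
      then have "poly p t * poly q2 t = poly p2 t * poly q t" by (simp add: mult_ac)
      then show ?thesis by simp
    qed auto
    then have "(p * q2 - p2 * q) * (r * q2) = 0" using poly_all_0_iff_0 by blast
    moreover have "q2 \<noteq> 0" using 2(1) by auto
    ultimately have "p * q2 = p2 * q" using that(1) by simp
    then have "poly p t1 * poly q2 t1 = poly p2 t1 * poly q t1" by (metis poly_mult)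
    moreover have "poly p2 t1 = g t1 * poly q2 t1" using 2 by simp
    ultimately have "poly q2 t1 * (poly q t1 * g t1) = poly q2 t1 * poly p t1" by algebra
    then show ?thesis using 2(1) mult_left_cancel by blast
  qed
  have main: "\<exists>G. \<forall>t. g t = poly G t" if "q \<noteq> 0" "\<And>t. poly q t * g t = poly p t" for p q
    using that
  proof (induction "degree q" arbitrary: p q rule: less_induct)
    case less
    show ?case
    proof (cases "\<exists>t1. poly q t1 = 0")
      case True
      then obtain t1 where t1: "poly q t1 = 0" by blast
      then obtain q' where q': "q = [:- t1, 1:] * q'" using poly_eq_0_iff_dvd by (metis dvdE)
      have "poly p t1 = 0" using less.prems(2)[of t1] t1 by simp
      then obtain p' where p': "p = [:- t1, 1:] * p'" using poly_eq_0_iff_dvd by (metis dvdE)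
      have "q' \<noteq> 0" using less.prems(1) q' by auto
      then have "degree q = Suc (degree q')" unfolding q' by (subst degree_mult_eq) auto
      moreover have "poly q' t * g t = poly p' t" for t
      proof (rule ext[of "[:- t1, 1:]"])
        fix t assume "poly [:- t1, 1:] t \<noteq> 0"
        moreover have "poly [:- t1, 1:] t * (poly q' t * g t) = poly [:- t1, 1:] t * poly p' t"
          using less.prems(2)[of t] unfolding q' p' poly_mult by (simp only: mult.assoc)
        ultimately show "poly q' t * g t = poly p' t" using mult_left_cancel by blast
      qed simp
      ultimately show ?thesis using less.hyps[of q' p'] \<open>q' \<noteq> 0\<close> by simp
    next
      case False
      then have "constant (poly q)" using fundamental_theorem_of_algebra by blast
      then obtain c where "\<And>t. poly q t = c" by (auto simp: constant_def)
      moreover from this have "c \<noteq> 0" using False by auto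
      ultimately have "g t = poly (smult (1 / c) p) t" for t
        using less.prems(2)[of t] by (simp add: field_simps)
      then show ?thesis by blast
    qed
  qed
  obtain p q where pq: "poly q 0 \<noteq> 0" "\<And>t. poly q t \<noteq> 0 \<Longrightarrow> g t = poly p t / poly q t" using loc[of 0] by blast
  have q0: "q \<noteq> 0" using pq(1) by auto
  have "poly q t * g t = poly p t" for t
    by (rule ext[OF q0]) (use pq(2) in simp)
  then show ?thesis by (rule main[OF q0])
qed

lemma global_section_on_line:
  assumes s: "s \<in> twist_sections k proj_plane" and nz: "\<And>t. a + t *s b \<noteq> 0"
  shows "\<exists>G. \<forall>t. s (a + t *s b) = poly G t"
proof (rule locally_rational_imp_polynomial)
  fix t0
  have "a + t0 *s b \<in> cone proj_plane" using nz by (simp add: cone_proj_plane)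
  then have "regular_at k proj_plane s (a + t0 *s b)"
    by (rule twist_section_regular[OF zariski_open_proj_plane s])
  then obtain P Q n where 1: "hompoly n Q" "hompoly (n + k) P" "Q (a + t0 *s b) \<noteq> 0"
      "\<And>w. Q w \<noteq> 0 \<Longrightarrow> s w = P w / Q w" by (rule regular_atE) blast
  obtain p where "\<And>t. P (a + t *s b) = poly p t" using polyfun_on_line[OF hompoly_polyfun[OF 1(2)]] by blast
  moreover obtain q where "\<And>t. Q (a + t *s b) = poly q t" using polyfun_on_line[OF hompoly_polyfun[OF 1(1)]] by blast
  ultimately show "\<exists>p q. poly q t0 \<noteq> 0 \<and> (\<forall>t. poly q t \<noteq> 0 \<longrightarrow> s (a + t *s b) = poly p t / poly q t)"
    using 1(3,4) by metis
qed

text \<open>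
  If the degree of \<open>G\<close> exceeded \<open>k\<close>, the reversed polynomial of \<open>G\<close> would be \<open>H\<close> times a positive power of
  \<open>t\<close>, but its value at \<open>0\<close> is the leading coefficient of \<open>G\<close>.
\<close>

lemma degree_le_if_reciprocal:
  fixes G H :: "complex poly"
  assumes "\<And>t. t \<noteq> 0 \<Longrightarrow> poly H t = t powi k * poly G (1 / t)" "G \<noteq> 0"
  shows "int (degree G) \<le> k"
proof (rule ccontr)
  assume "\<not> ?thesis"
  then have k: "k < int (degree G)" by simp
  define m where "m = nat (int (degree G) - k)"
  have "poly (monom 1 m * H - reflect_poly G) t = 0" if t: "t \<noteq> 0" for t
  proof -
    have "int (degree G) = int m + k" using k by (simp add: m_def)
    then have "t ^ degree G = t ^ m * t powi k" using t
      by (metis power_int_add power_int_of_nat)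
    then show ?thesis using assms(1)[OF t] poly_reflect_poly_nz[OF t, of G]
      by (simp add: poly_monom inverse_eq_divide)
  qed
  then have "monom 1 m * H - reflect_poly G = 0" by (rule poly_eq_0_off_origin)
  then have "poly (monom 1 m * H - reflect_poly G) 0 = 0" by simp
  then show False using k assms(2) by (simp add: poly_monom power_0_left m_def)
qed

text \<open>
  By homogeneity, the section on the line \<open>b + t a\<close> is \<open>t\<^sup>k\<close> times its value at parameter \<open>1 / t\<close> of the line
  \<open>a + t b\<close>, and it is regular at \<open>t = 0\<close>.
\<close>

lemma global_section_degree:
  assumes s: "s \<in> twist_sections k proj_plane"
    and ind: "\<And>c d. c *s a + d *s b = 0 \<Longrightarrow> c = 0 \<and> d = 0"
    and G: "\<And>t. s (a + t *s b) = poly G t" and "G \<noteq> 0"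
  shows "int (degree G) \<le> k"
proof -
  have "b + t *s a \<noteq> 0" for t using ind[of t 1] by (auto simp: add.commute)
  then obtain H where H: "\<And>t. s (b + t *s a) = poly H t" using global_section_on_line[OF s] by blast
  show ?thesis
  proof (rule degree_le_if_reciprocal[of H k G])
    fix t :: complex assume t: "t \<noteq> 0"
    then have "b + t *s a = t *s (a + (1 / t) *s b)" by (simp add: vector_add_ldistrib)
    then show "poly H t = t powi k * poly G (1 / t)"
      using twist_section_scale[OF zariski_open_proj_plane s t, of "a + (1 / t) *s b"] G H by metis
  qed fact
qed

text \<open>
  Interpolation at the nodes \<open>0, ..., n\<close>; it turns a function that is polynomial of bounded degree in each
  of two variables into a polynomial in both.
\<close>

lemma lagrange_basis:
  "\<exists>L :: nat \<Rightarrow> complex poly. (\<forall>j. degree (L j) \<le> n) \<and>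
    (\<forall>p z. degree p \<le> n \<longrightarrow> poly p z = (\<Sum>j\<le>n. poly (L j) z * poly p (of_nat j)))"
proof -
  define L where "L j = smult (1 / (\<Prod>i\<in>{..n} - {j}. (of_nat j - of_nat i))) (\<Prod>i\<in>{..n} - {j}. [:- of_nat i, 1::complex:])"
    for j :: nat
  have deg: "degree (\<Prod>i\<in>{..n} - {j}. [:- of_nat i, 1::complex:]) \<le> n" if "j \<le> n" for j
  proof -
    have "degree (\<Prod>i\<in>{..n} - {j}. [:- of_nat i, 1::complex:]) \<le> (\<Sum>i\<in>{..n} - {j}. degree [:- of_nat i, 1::complex:])"
      using degree_prod_sum_le[of "{..n} - {j}" "\<lambda>i. [:- of_nat i, 1::complex:]"] by (simp add: comp_def)
    also have "\<dots> = n" using that by simp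
    finally show ?thesis .
  qed
  have node: "poly (L j) (of_nat l) = (if j = l then 1 else 0 :: complex)" if "j \<le> n" "l \<le> n" for j l
  proof (cases "j = l")
    case True
    have "(\<Prod>i\<in>{..n} - {j}. (of_nat j - of_nat i :: complex)) \<noteq> 0" by auto
    moreover have "poly (\<Prod>i\<in>{..n} - {j}. [:- of_nat i, 1::complex:]) (of_nat j) = (\<Prod>i\<in>{..n} - {j}. (of_nat j - of_nat i))"
      by (simp add: poly_prod)
    ultimately show ?thesis unfolding L_def using True by (simp del: prod_zero_iff)
  next
    case False
    have "(\<Prod>i\<in>{..n} - {j}. (of_nat l - of_nat i :: complex)) = 0" using that False by (auto intro: prod_zero)
    then show ?thesis using False by (simp add: L_def poly_prod)
  qed
  define L' where "L' j = (if j \<le> n then L j else 0)" for j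
  show ?thesis
  proof (intro exI[of _ L'] conjI allI impI)
    show dL: "degree (L' j) \<le> n" for j
      using deg[of j] degree_smult_le order_trans by (auto simp: L_def L'_def)
    fix p :: "complex poly" and z assume p: "degree p \<le> n"
    define D where "D = p - (\<Sum>j\<le>n. smult (poly p (of_nat j)) (L' j))"
    have "degree D \<le> n" unfolding D_def
      using dL p by (intro degree_diff_le degree_sum_le) (auto intro: order_trans[OF degree_smult_le])
    moreover have "of_nat ` {..n} \<subseteq> {z. poly D z = 0}"
    proof clarsimp
      fix l assume l: "l \<le> n"
      have "(\<Sum>j\<le>n. poly p (of_nat j) * poly (L' j) (of_nat l)) = (\<Sum>j\<le>n. if j = l then poly p (of_nat l) else 0)"
        using l by (intro sum.cong) (auto simp: node L'_def)
      then show "poly D (of_nat l) = 0" using l by (simp add: D_def poly_sum)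
    qed
    moreover have "card (of_nat ` {..n} :: complex set) = Suc n" by (simp add: card_image inj_on_def)
    ultimately have "D = 0"
      using card_poly_roots_bound[of D] card_mono[OF poly_roots_finite, of D "of_nat ` {..n}"] by fastforce
    then have "poly p z = poly (\<Sum>j\<le>n. smult (poly p (of_nat j)) (L' j)) z" by (simp add: D_def)
    then show "poly p z = (\<Sum>j\<le>n. poly (L' j) z * poly p (of_nat j))" by (simp add: poly_sum mult.commute)
  qed
qed

lemma linear_form_axis: "linear_form (axis i 1) v = v $ i"
proof -
  have "linear_form (axis i 1) v = (\<Sum>j\<in>UNIV. if j = i then v $ i else 0)"
    unfolding linear_form_def by (intro sum.cong) (auto simp: axis_def)
  then show ?thesis by simp
qed

lemma axis_1_coords [simp]:
  "axis (1::3) (1::complex) $ 1 = 1" "axis (1::3) (1::complex) $ 2 = 0" "axis (1::3) (1::complex) $ 3 = 0"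
  "axis (2::3) (1::complex) $ 1 = 0" "axis (2::3) (1::complex) $ 2 = 1" "axis (2::3) (1::complex) $ 3 = 0"
  "axis (3::3) (1::complex) $ 1 = 0" "axis (3::3) (1::complex) $ 2 = 0" "axis (3::3) (1::complex) $ 3 = 1"
  by (simp_all add: axis_def)

lemma polyfun_zero_off_origin:
  assumes "polyfun P" "\<And>v. v \<noteq> 0 \<Longrightarrow> P v = 0" shows "P v = 0"
proof (rule polyfun_domain[where Q = "\<lambda>v. v $ 1" and ?v0.0 = "axis 1 1"])
  show "P v * v $ 1 = 0" for v using assms(2)[of v] by (cases "v = 0") auto
qed (use assms in auto)

text \<open>
  A pole of a global section along the line \<open>v $ 1 = 0\<close> can be removed one order at a time.
\<close>

lemma global_section_clear_denominator:
  assumes s: "s \<in> twist_sections k proj_plane"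
    and "polyfun W" "\<And>v. v $ 1 \<noteq> 0 \<Longrightarrow> W v = v $ 1 ^ m * s v"
  shows "\<exists>W. polyfun W \<and> (\<forall>v. v \<noteq> 0 \<longrightarrow> W v = s v)"
proof -
  have ext: "W v = v $ 1 ^ m * s v"
    if W: "polyfun W" "\<And>v. v $ 1 \<noteq> 0 \<Longrightarrow> W v = v $ 1 ^ m * s v" and v: "v \<noteq> 0" for W m v
  proof (cases "v $ 1 = 0")
    case True
    have "v + t *s axis 1 1 \<noteq> 0" for t
    proof
      assume "v + t *s axis 1 1 = 0"
      then have c: "(v + t *s axis 1 1) $ i = 0" for i by simp
      show False using c[of 1] c[of 2] c[of 3] True v by (auto simp: vec_eq_iff forall_3)
    qed
    then obtain G where G: "\<And>t. s (v + t *s axis 1 1) = poly G t" using global_section_on_line[OF s] by blast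
    obtain w where w: "\<And>t. W (v + t *s axis 1 1) = poly w t" using polyfun_on_line[OF W(1)] by blast
    have "poly (w - monom 1 m * G) t = 0" if "t \<noteq> 0" for t
      using W(2)[of "v + t *s axis 1 1"] True that G w by (simp add: poly_monom)
    then have "w - monom 1 m * G = 0" by (rule poly_eq_0_off_origin)
    then have "poly (w - monom 1 m * G) 0 = 0" by simp
    then show ?thesis using w[of 0] G[of 0] True by (simp add: poly_monom)
  qed (use W in auto)
  show ?thesis using assms(2,3)
  proof (induction m arbitrary: W)
    case 0
    then show ?case using ext[of W 0] by auto
  next
    case (Suc m)
    have z: "W v = 0" if "v $ 1 = 0" for v
    proof (rule polyfun_domain_plane[of W "\<lambda>v. v $ 2" "axis 1 1" "axis 2 1"])
      fix v assume "linear_form (axis 1 1) v = 0"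
      then show "W v * v $ 2 = 0" using ext[OF Suc.prems, of v] by (cases "v = 0") (auto simp: linear_form_axis)
    qed (use Suc.prems that in \<open>auto simp: linear_form_axis\<close>)
    have "axis (1::3) (1::complex) \<noteq> 0" by (metis axis_1_coords(1) zero_index zero_neq_one)
    then obtain W' where W': "polyfun W'" "\<And>v. W v = v $ 1 * W' v"
      using polyfun_divide[OF Suc.prems(1), of "axis 1 1"] z by (auto simp: linear_form_axis)
    show ?case
    proof (rule Suc.IH[OF W'(1)])
      fix v :: "complex^3" assume "v $ 1 \<noteq> 0"
      then show "W' v = v $ 1 ^ m * s v" using Suc.prems(2)[of v] W'(2)[of v] by simp
    qed
  qed
qed

definition affine_pt :: "complex \<Rightarrow> complex \<Rightarrow> complex^3" where
  "affine_pt y z = vector [1, y, z]"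

lemma affine_pt_coords [simp]: "affine_pt y z $ 1 = 1" "affine_pt y z $ 2 = y" "affine_pt y z $ 3 = z"
  by (simp_all add: affine_pt_def)

text \<open>
  The restriction of \<open>s\<close> to every line that misses the origin is a polynomial, of degree at most \<open>k\<close>. For
  \<open>k < 0\<close> this leaves only zero. Otherwise interpolation in one of the two affine coordinates shows that \<open>s\<close>
  is a polynomial on the affine chart where the first coordinate is \<open>1\<close>. Homogenizing introduces a
  denominator, a power of the first coordinate, which is removed afterwards.
\<close>

theorem global_sections_twist:
  assumes s: "s \<in> twist_sections k proj_plane"
  shows "\<exists>P. hompoly k P \<and> (\<forall>v. v \<noteq> 0 \<longrightarrow> s v = P v)"
proof (cases "k < 0")
  case True
  have "s v = 0" if v: "v \<noteq> 0" for v
  proof (rule ccontr)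
    assume sv: "s v \<noteq> 0"
    obtain i where i: "v $ i \<noteq> 0" using v by (metis vec_eq_iff zero_index)
    obtain j :: 3 where j: "j \<noteq> i" by (metis zero_neq_one)
    have ind: "c = 0 \<and> d = 0" if "c *s v + d *s axis j 1 = 0" for c d
    proof -
      have e: "(c *s v + d *s axis j 1) $ l = 0" for l using that by simp
      have "c = 0" using e[of i] i j by (simp add: axis_def)
      then show ?thesis using e[of j] by (simp add: axis_def)
    qed
    have "v + t *s axis j 1 \<noteq> 0" for t using ind[of 1 t] by auto
    then obtain G where G: "\<And>t. s (v + t *s axis j 1) = poly G t" using global_section_on_line[OF s] by blast
    have "G \<noteq> 0" using G[of 0] sv by auto
    then show False using global_section_degree[OF s ind G] True by simp
  qed
  then show ?thesis by (intro exI[of _ "\<lambda>v. 0"]) auto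
next
  case False
  define n where "n = nat k"
  have k: "k = int n" using False by (simp add: n_def)
  obtain L :: "nat \<Rightarrow> complex poly" where "(\<forall>j. degree (L j) \<le> n) \<and>
    (\<forall>p z. degree p \<le> n \<longrightarrow> poly p z = (\<Sum>j\<le>n. poly (L j) z * poly p (of_nat j)))"
    using lagrange_basis[of n] by (rule exE)
  then have L: "\<forall>j. degree (L j) \<le> n"
    "\<forall>p z. degree p \<le> n \<longrightarrow> poly p z = (\<Sum>j\<le>n. poly (L j) z * poly p (of_nat j))"
    by (rule conjunct1, rule conjunct2)
  have line: "\<exists>G. degree G \<le> n \<and> (\<forall>t. s (a + t *s axis i 1) = poly G t)" if "a $ 1 \<noteq> 0" "i \<noteq> 1" for a and i :: 3
  proof -
    have ind: "c = 0 \<and> d = 0" if z: "c *s a + d *s axis i 1 = 0" for c d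
    proof -
      have e: "(c *s a + d *s axis i 1) $ l = 0" for l using z by simp
      have "c = 0" using e[of 1] \<open>i \<noteq> 1\<close> \<open>a $ 1 \<noteq> 0\<close> by (simp add: axis_def)
      then show ?thesis using e[of i] by (simp add: axis_def)
    qed
    have "a + t *s axis i 1 \<noteq> 0" for t using ind[of 1 t] by auto
    then obtain G where G: "\<And>t. s (a + t *s axis i 1) = poly G t" using global_section_on_line[OF s] by blast
    have "degree G \<le> n" using global_section_degree[OF s ind G] k by (cases "G = 0") auto
    then show ?thesis using G by blast
  qed
  have "\<forall>j. \<exists>G. degree G \<le> n \<and> (\<forall>y. s (affine_pt y (of_nat j)) = poly G y)"
  proof
    fix j
    have "affine_pt 0 (of_nat j) + y *s axis 2 1 = affine_pt y (of_nat j)" for y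
      by (simp add: vec_eq_iff forall_3)
    then show "\<exists>G. degree G \<le> n \<and> (\<forall>y. s (affine_pt y (of_nat j)) = poly G y)"
      using line[of "affine_pt 0 (of_nat j)" 2] by simp
  qed
  then obtain G where G: "\<And>j. degree (G j) \<le> n" "\<And>j y. s (affine_pt y (of_nat j)) = poly (G j) y" by metis
  have F: "s (affine_pt y z) = (\<Sum>j\<le>n. poly (L j) z * poly (G j) y)" for y z
  proof -
    have "affine_pt y 0 + z *s axis 3 1 = affine_pt y z" for z
      by (simp add: vec_eq_iff forall_3)
    then obtain H where H: "degree H \<le> n" "\<And>z. s (affine_pt y z) = poly H z"
      using line[of "affine_pt y 0" 3] by auto
    show ?thesis using L(2)[rule_format, OF H(1), of z] by (simp add: H(2)[symmetric] G(2))
  qed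
  \<comment> \<open>homogenize the interpolation formula\<close>
  define hom where "hom p i v = (\<Sum>l\<le>n. coeff p l * v $ i ^ l * v $ 1 ^ (n - l))"
    for p and i :: 3 and v :: "complex^3"
  have pol: "polyfun (hom p i)" for p i unfolding hom_def[abs_def] by simp
  have hom: "hom p i v = v $ 1 ^ n * poly p (v $ i / v $ 1)" if "degree p \<le> n" "v $ 1 \<noteq> 0" for p i v
  proof -
    have "poly p (v $ i / v $ 1) = (\<Sum>l\<le>n. coeff p l * (v $ i / v $ 1) ^ l)"
      unfolding poly_altdef using that(1)
      by (intro sum.mono_neutral_left) (auto simp: coeff_eq_0)
    moreover have "v $ 1 ^ n * (coeff p l * (v $ i / v $ 1) ^ l) = coeff p l * v $ i ^ l * v $ 1 ^ (n - l)" if "l \<le> n" for l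
      using that \<open>v $ 1 \<noteq> 0\<close> by (simp add: power_divide power_diff)
    ultimately show ?thesis unfolding hom_def sum_distrib_left
      by (metis (no_types, lifting) atMost_iff sum.cong sum_distrib_left)
  qed
  define W where "W v = (\<Sum>j\<le>n. hom (L j) 3 v * hom (G j) 2 v)" for v
  have "W v = v $ 1 ^ n * s v" if v: "v $ 1 \<noteq> 0" for v
  proof -
    have e: "v = v $ 1 *s affine_pt (v $ 2 / v $ 1) (v $ 3 / v $ 1)"
      using v by (simp add: vec_eq_iff forall_3)
    have "s v = v $ 1 ^ n * s (affine_pt (v $ 2 / v $ 1) (v $ 3 / v $ 1))"
      using twist_section_scale[OF zariski_open_proj_plane s v, of "affine_pt (v $ 2 / v $ 1) (v $ 3 / v $ 1)"] e k by simp
    moreover have "W v = v $ 1 ^ n * (v $ 1 ^ n * s (affine_pt (v $ 2 / v $ 1) (v $ 3 / v $ 1)))"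
      unfolding F W_def by (simp add: hom L(1) G(1) v sum_distrib_left mult_ac)
    ultimately show ?thesis by simp
  qed
  then obtain P where P: "polyfun P" "\<And>v. v \<noteq> 0 \<Longrightarrow> P v = s v"
    using global_section_clear_denominator[OF s, of W n] pol unfolding W_def by auto
  have "P (t *s v) - t powi k * P v = 0" if t: "t \<noteq> 0" for t v
  proof (rule polyfun_domain[where Q = "\<lambda>v. v $ 1" and ?v0.0 = "axis 1 1" and P = "\<lambda>v. P (t *s v) - t powi k * P v"])
    show "polyfun (\<lambda>v. P (t *s v) - t powi k * P v)"
      using P(1) by (intro polyfun_diff polyfun_compose_affine[OF P(1)] polyfun_mult) auto
    fix v :: "complex^3"
    show "(P (t *s v) - t powi k * P v) * v $ 1 = 0"
    proof (cases "v $ 1 = 0")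
      case False
      then have "v \<noteq> 0" "t *s v \<noteq> 0" using t by (auto simp: vec_eq_iff)
      then show ?thesis using twist_section_scale[OF zariski_open_proj_plane s t] P(2) by simp
    qed simp
  qed auto
  then have "hompoly k P" using P(1) by (simp add: hompoly_def)
  then show ?thesis using P(2) by auto
qed

section \<open>Homomorphisms out of sums of line bundles are polynomial matrices\<close>

lemma twist_sum_component: "s \<in> twist_sum K U \<Longrightarrow> (\<lambda>v. s v $ i) \<in> twist_sections (K $ i) U"
  by (simp add: twist_sum_def)

lemma twist_sum_zero: "zariski_open U \<Longrightarrow> (\<lambda>v. 0) \<in> twist_sum K U"
  by (simp add: twist_sum_def twist_sections_zero)

lemma twist_sum_add: "zariski_open U \<Longrightarrow> s \<in> twist_sum K U \<Longrightarrow> t \<in> twist_sum K U \<Longrightarrow> (\<lambda>v. s v + t v) \<in> twist_sum K U"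
  by (simp add: twist_sum_def twist_sections_add)

lemma twist_sum_scale:
  "zariski_open U \<Longrightarrow> g \<in> twist_sections 0 U \<Longrightarrow> s \<in> twist_sum K U \<Longrightarrow> (\<lambda>v. g v *s s v) \<in> twist_sum K U"
  using twist_sections_mult[of U g 0 _ _ _] by (auto simp: twist_sum_def)

lemma restrict_section_component:
  "(\<lambda>v. restrict_section V s v $ i) = (\<lambda>v. if v \<in> cone V then s v $ i else 0)"
  by (auto simp: restrict_section_def)

lemma twist_sum_restrict:
  "zariski_open U \<Longrightarrow> zariski_open V \<Longrightarrow> V \<subseteq> U \<Longrightarrow> s \<in> twist_sum K U \<Longrightarrow> restrict_section V s \<in> twist_sum K V"
  by (simp add: twist_sum_def restrict_section_component twist_sections_restrict)

lemma twist_sum_outside: "s \<in> twist_sum K U \<Longrightarrow> v \<notin> cone U \<Longrightarrow> s v = 0"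
  using twist_section_outside[OF twist_sum_component] by (auto simp: vec_eq_iff)

lemma sheaf_homD:
  assumes "sheaf_hom F G \<phi>" "zariski_open U" "s \<in> F U"
  shows "\<phi> U s \<in> G U"
    and "t \<in> F U \<Longrightarrow> \<phi> U (\<lambda>v. s v + t v) = (\<lambda>v. \<phi> U s v + \<phi> U t v)"
    and "g \<in> twist_sections 0 U \<Longrightarrow> \<phi> U (\<lambda>v. g v *s s v) = (\<lambda>v. g v *s \<phi> U s v)"
    and "zariski_open V \<Longrightarrow> V \<subseteq> U \<Longrightarrow> \<phi> V (restrict_section V s) = restrict_section V (\<phi> U s)"
  using assms unfolding sheaf_hom_def by blast+

lemma twist_sum_sum:
  "zariski_open U \<Longrightarrow> (\<And>j. j \<in> J \<Longrightarrow> S j \<in> twist_sum K U) \<Longrightarrow> (\<lambda>v. \<Sum>j\<in>J. S j v) \<in> twist_sum K U"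
  by (induction J rule: infinite_finite_induct) (simp_all add: twist_sum_zero twist_sum_add)

lemma sheaf_hom_sum:
  assumes hom: "sheaf_hom (twist_sum K) G \<phi>" and U: "zariski_open U" and "finite J"
    and S: "\<And>j. j \<in> J \<Longrightarrow> S j \<in> twist_sum K U"
  shows "\<phi> U (\<lambda>v. \<Sum>j\<in>J. S j v) = (\<lambda>v. \<Sum>j\<in>J. \<phi> U (S j) v)"
  using \<open>finite J\<close> S
proof (induction J rule: finite_induct)
  case empty
  have "\<phi> U (\<lambda>v. 0 + 0) = (\<lambda>v. \<phi> U (\<lambda>v. 0) v + \<phi> U (\<lambda>v. 0) v)"
    by (rule sheaf_homD(2)[OF hom U twist_sum_zero[OF U] twist_sum_zero[OF U]])
  then have "\<phi> U (\<lambda>v. 0) v = \<phi> U (\<lambda>v. 0) v + \<phi> U (\<lambda>v. 0) v" for v by (metis add_0)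
  then show ?case by auto
next
  case (insert j J)
  have "\<phi> U (\<lambda>v. S j v + (\<Sum>j\<in>J. S j v)) = (\<lambda>v. \<phi> U (S j) v + \<phi> U (\<lambda>v. \<Sum>j\<in>J. S j v) v)"
    by (rule sheaf_homD(2)[OF hom U]) (auto intro!: insert.prems twist_sum_sum U)
  then show ?case using insert by simp
qed

text \<open>
  The section of \<open>\<Oplus>\<^sub>j \<O>(K\<^sub>j)\<close> over a chart that trivializes the summand \<open>j\<close>.
\<close>

definition generator :: "int^'m \<Rightarrow> 3 \<Rightarrow> 'm \<Rightarrow> complex^3 \<Rightarrow> complex^('m::finite)" where
  "generator K i j v = (if v $ i \<noteq> 0 then axis j ((v $ i) powi (K $ j)) else 0)"

lemma generator_in_twist_sum: "generator K i j \<in> twist_sum K (chart i)"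
proof -
  have "(\<lambda>v. generator K i j v $ l) \<in> twist_sections (K $ l) (chart i)" for l
  proof (cases "l = j")
    case True
    then have "(\<lambda>v. generator K i j v $ l) = (\<lambda>v. if v \<in> cone (chart i) then (v $ i) powi (K $ l) else 0)"
      by (auto simp: generator_def cone_chart axis_def)
    then show ?thesis using twist_sections_coord_power[OF zariski_open_chart] by (simp add: cone_chart)
  next
    case False
    then have "(\<lambda>v. generator K i j v $ l) = (\<lambda>v. 0)" by (auto simp: generator_def axis_def)
    then show ?thesis by (simp add: twist_sections_zero zariski_open_chart)
  qed
  then show ?thesis by (simp add: twist_sum_def)
qed

text \<open>
  Over the part of \<open>U\<close> in chart \<open>i\<close>, the section \<open>s\<close> is a combination of the generators with regular functions
  as coefficients, and \<open>\<phi>\<close> commutes with restriction and is linear over regular functions.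
\<close>

lemma sheaf_hom_on_chart:
  assumes hom: "sheaf_hom (twist_sum K) G \<phi>" and U: "zariski_open U" and s: "s \<in> twist_sum K U"
    and v: "v \<in> cone U" "v $ i \<noteq> 0"
  shows "\<phi> U s v = (\<Sum>j\<in>UNIV. (s v $ j * (v $ i) powi (- K $ j)) *s \<phi> (chart i) (generator K i j) v)"
proof -
  define V where "V = U \<inter> chart i"
  have V: "zariski_open V" unfolding V_def by (intro zariski_open_Int U zariski_open_chart)
  have cV: "cone V = cone U \<inter> {v. v $ i \<noteq> 0}" by (auto simp: V_def cone_Int cone_chart)
  have vV: "v \<in> cone V" using v by (simp add: cV)
  define g where "g j v = (if v \<in> cone V then s v $ j else 0) * (if v \<in> cone V then (v $ i) powi (- K $ j) else 0)" for j v
  define e where "e j = restrict_section V (generator K i j)" for j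
  have e: "e j \<in> twist_sum K V" for j unfolding e_def
    by (rule twist_sum_restrict[OF zariski_open_chart V _ generator_in_twist_sum]) (simp add: V_def)
  have g: "g j \<in> twist_sections 0 V" for j unfolding g_def
    by (rule twist_sections_mult[OF V twist_sections_restrict[OF U V _ twist_sum_component[OF s]] twist_sections_coord_power[OF V]])
       (auto simp: V_def cone_Int cone_chart)
  have "restrict_section V s = (\<lambda>v. \<Sum>j\<in>UNIV. g j v *s e j v)"
  proof
    fix w
    have "(\<Sum>j\<in>UNIV. g j w *s e j w) $ l = restrict_section V s w $ l" for l
    proof (cases "w \<in> cone V")
      case True
      then have wi: "w $ i \<noteq> 0" by (simp add: cV)
      have "(\<Sum>j\<in>UNIV. g j w *s e j w) $ l = (\<Sum>j\<in>UNIV. if j = l then s w $ l else 0)"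
        unfolding sum_component
        using True wi by (intro sum.cong) (auto simp: g_def e_def restrict_section_def generator_def axis_def power_int_minus)
      then show ?thesis using True by (simp add: restrict_section_def)
    qed (simp add: g_def restrict_section_def)
    then show "restrict_section V s w = (\<Sum>j\<in>UNIV. g j w *s e j w)" by (simp add: vec_eq_iff)
  qed
  then have "restrict_section V (\<phi> U s) = \<phi> V (\<lambda>v. \<Sum>j\<in>UNIV. g j v *s e j v)"
    using sheaf_homD(4)[OF hom U s V] by (simp add: V_def)
  also have "\<dots> = (\<lambda>v. \<Sum>j\<in>UNIV. \<phi> V (\<lambda>v. g j v *s e j v) v)"
    by (rule sheaf_hom_sum[OF hom V]) (auto intro: twist_sum_scale[OF V g e])
  also have "\<dots> = (\<lambda>v. \<Sum>j\<in>UNIV. g j v *s \<phi> V (e j) v)"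
    using sheaf_homD(3)[OF hom V e g] by simp
  also have "\<dots> = (\<lambda>v. \<Sum>j\<in>UNIV. g j v *s restrict_section V (\<phi> (chart i) (generator K i j)) v)"
    using sheaf_homD(4)[OF hom zariski_open_chart generator_in_twist_sum V] by (simp add: V_def e_def)
  finally have "restrict_section V (\<phi> U s) v = (\<Sum>j\<in>UNIV. g j v *s restrict_section V (\<phi> (chart i) (generator K i j)) v)"
    by meson
  then show ?thesis using vV by (simp add: restrict_section_def g_def)
qed

text \<open>
  The images of the generators of different charts agree after division by powers of the coordinates,
  so that they glue to global sections of line bundles, which are homogeneous polynomials.
\<close>

theorem sheaf_hom_matrix:
  fixes \<phi> :: "('m::finite, 'n::finite) sheaf_map"
  assumes hom: "sheaf_hom (twist_sum K) G \<phi>" and G: "\<And>U. zariski_open U \<Longrightarrow> G U \<subseteq> twist_sum M U"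
  shows "\<exists>\<theta> :: 'm \<Rightarrow> complex^3 \<Rightarrow> complex^'n.
    (\<forall>j i. hompoly (M $ i - K $ j) (\<lambda>v. \<theta> j v $ i)) \<and>
    (\<forall>U s v. zariski_open U \<longrightarrow> s \<in> twist_sum K U \<longrightarrow> v \<in> cone U \<longrightarrow> \<phi> U s v = (\<Sum>j\<in>UNIV. s v $ j *s \<theta> j v))"
proof -
  define pick where "pick v = (SOME i. v $ i \<noteq> 0)" for v :: "complex^3"
  have pick: "v $ pick v \<noteq> 0" if "v \<noteq> 0" for v
  proof -
    have "\<exists>i. v $ i \<noteq> 0" using that by (auto simp: vec_eq_iff)
    then show ?thesis unfolding pick_def by (rule someI_ex)
  qed
  define \<phi>g where "\<phi>g i j = \<phi> (chart i) (generator K i j)" for i j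
  define \<theta> where "\<theta> j v = (if v = 0 then 0 else (v $ pick v) powi (- K $ j) *s \<phi>g (pick v) j v)" for j v
  have indep: "\<theta> j v = (v $ i) powi (- K $ j) *s \<phi>g i j v" if vi: "v $ i \<noteq> 0" for j v i
  proof -
    have v0: "v \<noteq> 0" using vi by auto
    let ?k = "pick v"
    have vk: "v $ ?k \<noteq> 0" by (rule pick[OF v0])
    have "\<phi>g ?k j v = (\<Sum>j'\<in>UNIV. (generator K ?k j v $ j' * (v $ i) powi (- K $ j')) *s \<phi>g i j' v)"
      unfolding \<phi>g_def
      by (rule sheaf_hom_on_chart[OF hom zariski_open_chart generator_in_twist_sum _ vi]) (simp add: cone_chart vk)
    also have "\<dots> = (\<Sum>j'\<in>UNIV. if j' = j then ((v $ ?k) powi (K $ j) * (v $ i) powi (- K $ j)) *s \<phi>g i j v else 0)"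
    proof (intro sum.cong refl)
      fix j'
      have "generator K ?k j v $ j' = (if j' = j then (v $ ?k) powi (K $ j) else 0)"
        using vk by (simp add: generator_def axis_def)
      then show "(generator K ?k j v $ j' * (v $ i) powi (- K $ j')) *s \<phi>g i j' v =
          (if j' = j then ((v $ ?k) powi (K $ j) * (v $ i) powi (- K $ j)) *s \<phi>g i j v else 0)"
        by (cases "j' = j") simp_all
    qed
    finally have "\<phi>g ?k j v = ((v $ ?k) powi (K $ j) * (v $ i) powi (- K $ j)) *s \<phi>g i j v" by simp
    then show ?thesis using vk v0 by (simp add: \<theta>_def power_int_minus)
  qed
  have sec: "(\<lambda>v. \<theta> j v $ i) \<in> twist_sections (M $ i - K $ j) proj_plane" for i j
    unfolding twist_sections_iff[OF zariski_open_proj_plane]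
  proof (intro conjI allI impI ballI)
    fix v assume "v \<in> cone proj_plane"
    then have vk: "v $ pick v \<noteq> 0" by (intro pick) (simp add: cone_proj_plane)
    define k where "k = pick v"
    have "\<phi>g k j \<in> twist_sum M (chart k)"
      using sheaf_homD(1)[OF hom zariski_open_chart generator_in_twist_sum] G[OF zariski_open_chart] unfolding \<phi>g_def by blast
    then have 1: "(\<lambda>v. (if v \<in> cone (chart k) then (v $ k) powi (- K $ j) else 0) * \<phi>g k j v $ i) \<in> twist_sections (M $ i - K $ j) (chart k)"
      by (intro twist_sections_mult[OF zariski_open_chart twist_sections_coord_power[OF zariski_open_chart] twist_sum_component])
         (auto simp: cone_chart)
    show "regular_at (M $ i - K $ j) proj_plane (\<lambda>v. \<theta> j v $ i) v"
    proof (rule regular_at_restrict[OF twist_section_regular[OF zariski_open_chart 1] zariski_open_chart[of k]])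
      fix w assume "w \<in> cone (chart k)"
      then have wk: "w $ k \<noteq> 0" by (simp add: cone_chart)
      then show "w \<in> cone proj_plane \<and> \<theta> j w $ i = (if w \<in> cone (chart k) then (w $ k) powi (- K $ j) else 0) * \<phi>g k j w $ i"
        using indep[OF wk, of j] by (auto simp: cone_chart cone_proj_plane)
    qed (use vk in \<open>auto simp: k_def cone_chart\<close>)
  qed (simp add: \<theta>_def cone_proj_plane)
  have "\<forall>j i. \<exists>P. hompoly (M $ i - K $ j) P \<and> (\<forall>v. v \<noteq> 0 \<longrightarrow> \<theta> j v $ i = P v)"
    using global_sections_twist[OF sec] by blast
  then obtain P where P: "\<And>j i. hompoly (M $ i - K $ j) (P j i)" "\<And>j i v. v \<noteq> 0 \<Longrightarrow> \<theta> j v $ i = P j i v"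
    by metis
  show ?thesis
  proof (intro exI[of _ "\<lambda>j v. \<chi> i. P j i v"] conjI allI impI)
    show "hompoly (M $ i - K $ j) (\<lambda>v. (\<chi> i. P j i v) $ i)" for i j using P(1) by simp
    fix U s v assume 1: "zariski_open U" "s \<in> twist_sum K U" "v \<in> cone U"
    then have v0: "v \<noteq> 0" by (simp add: cone_def)
    have e: "(\<chi> i. P j i v) = \<theta> j v" for j using P(2)[OF v0] by (simp add: vec_eq_iff)
    have "\<phi> U s v = (\<Sum>j\<in>UNIV. (s v $ j * (v $ pick v) powi (- K $ j)) *s \<phi>g (pick v) j v)"
      unfolding \<phi>g_def by (rule sheaf_hom_on_chart[OF hom 1 pick[OF v0]])
    also have "\<dots> = (\<Sum>j\<in>UNIV. s v $ j *s \<theta> j v)"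
      by (simp add: indep[OF pick[OF v0]])
    finally show "\<phi> U s v = (\<Sum>j\<in>UNIV. s v $ j *s (\<chi> i. P j i v))" by (simp add: e)
  qed
qed

section \<open>The gradient of the defining polynomial\<close>

abbreviation form :: "line \<Rightarrow> complex^3 \<Rightarrow> complex" where
  "form H \<equiv> linear_form (form_of H)"

text \<open>
  The derivative of the defining polynomial at \<open>v\<close> in the direction \<open>w\<close>.
\<close>

definition gradient :: "line set \<Rightarrow> complex^3 \<Rightarrow> complex^3 \<Rightarrow> complex" where
  "gradient \<A> v w = (\<Sum>i\<in>UNIV. partial_deriv i (defining_poly \<A>) v * w $ i)"

lemma linear_form_axis_right: "linear_form \<alpha> (axis i 1) = \<alpha> $ i"
proof -
  have "linear_form \<alpha> (axis i 1) = (\<Sum>j\<in>UNIV. if j = i then \<alpha> $ i else 0)"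
    unfolding linear_form_def by (intro sum.cong) (auto simp: axis_def)
  then show ?thesis by simp
qed

lemma partial_deriv_defining_poly:
  assumes "finite \<A>"
  shows "partial_deriv i (defining_poly \<A>) v = (\<Sum>H\<in>\<A>. form_of H $ i * (\<Prod>H'\<in>\<A> - {H}. form H' v))"
proof -
  have "((\<lambda>t. \<Prod>H\<in>\<A>. form H v + t * form_of H $ i) has_field_derivative
      (\<Sum>H\<in>\<A>. form_of H $ i * (\<Prod>H'\<in>\<A> - {H}. form H' v + 0 * form_of H' $ i))) (at 0)"
    by (rule has_field_derivative_prod) (auto intro!: derivative_eq_intros)
  then show ?thesis
    unfolding partial_deriv_def defining_poly_def
    by (simp add: linear_form_axis_right DERIV_imp_deriv)
qed

lemma gradient_eq:
  assumes "finite \<A>"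
  shows "gradient \<A> v w = (\<Sum>H\<in>\<A>. form H w * (\<Prod>H'\<in>\<A> - {H}. form H' v))"
proof -
  have "gradient \<A> v w = (\<Sum>i\<in>UNIV. \<Sum>H\<in>\<A>. form_of H $ i * (\<Prod>H'\<in>\<A> - {H}. form H' v) * w $ i)"
    unfolding gradient_def partial_deriv_defining_poly[OF assms] by (simp add: sum_distrib_right)
  also have "\<dots> = (\<Sum>H\<in>\<A>. \<Sum>i\<in>UNIV. form_of H $ i * (\<Prod>H'\<in>\<A> - {H}. form H' v) * w $ i)"
    by (rule sum.swap)
  finally show ?thesis by (simp add: linear_form_def sum_distrib_right mult_ac)
qed

lemma gradient_add: "gradient \<A> v (w + w') = gradient \<A> v w + gradient \<A> v w'"
  by (simp add: gradient_def algebra_simps sum.distrib)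
lemma gradient_diff: "gradient \<A> v (w - w') = gradient \<A> v w - gradient \<A> v w'"
  by (simp add: gradient_def algebra_simps sum_subtractf)
lemma gradient_scale: "gradient \<A> v (c *s w) = c * gradient \<A> v w"
  by (simp add: gradient_def algebra_simps sum_distrib_left)
lemma gradient_zero [simp]: "gradient \<A> v 0 = 0"
  by (simp add: gradient_def)
lemma gradient_sum: "gradient \<A> v (\<Sum>j\<in>J. w j) = (\<Sum>j\<in>J. gradient \<A> v (w j))"
  by (induction J rule: infinite_finite_induct) (simp_all add: gradient_add)

lemma defining_poly_remove:
  "finite \<A> \<Longrightarrow> l \<in> \<A> \<Longrightarrow> defining_poly \<A> v = form l v * defining_poly (\<A> - {l}) v"
  by (simp add: defining_poly_def prod.remove)

text \<open>
  The Leibniz rule for the factor that belongs to \<open>l\<close>.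
\<close>

lemma gradient_remove:
  assumes "finite \<A>" "l \<in> \<A>"
  shows "gradient \<A> v w = form l w * defining_poly (\<A> - {l}) v + form l v * gradient (\<A> - {l}) v w"
proof -
  have "(\<Sum>H\<in>\<A> - {l}. form H w * (\<Prod>H'\<in>\<A> - {H}. form H' v))
     = (\<Sum>H\<in>\<A> - {l}. form l v * (form H w * (\<Prod>H'\<in>\<A> - {l} - {H}. form H' v)))"
  proof (intro sum.cong refl)
    fix H assume H: "H \<in> \<A> - {l}"
    have "(\<Prod>H'\<in>\<A> - {H}. form H' v) = form l v * (\<Prod>H'\<in>\<A> - {H} - {l}. form H' v)"
      using H assms by (intro prod.remove) auto
    moreover have "\<A> - {H} - {l} = \<A> - {l} - {H}" by auto
    ultimately show "form H w * (\<Prod>H'\<in>\<A> - {H}. form H' v) = form l v * (form H w * (\<Prod>H'\<in>\<A> - {l} - {H}. form H' v))"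
      by simp
  qed
  then show ?thesis
    using assms by (simp add: gradient_eq sum.remove[of \<A> l] defining_poly_def sum_distrib_left)
qed

lemma euler_identity:
  assumes "finite \<A>"
  shows "gradient \<A> v v = of_nat (card \<A>) * defining_poly \<A> v"
proof -
  have "gradient \<A> v v = (\<Sum>H\<in>\<A>. defining_poly \<A> v)"
    unfolding gradient_eq[OF assms] defining_poly_def
    by (intro sum.cong refl) (simp add: prod.remove[OF assms])
  then show ?thesis by simp
qed

lemma polyfun_gradient:
  assumes "finite \<A>" "\<And>i. polyfun (\<lambda>v. \<theta> v $ i)"
  shows "polyfun (\<lambda>v. gradient \<A> v (\<theta> v))"
proof -
  have "polyfun (\<lambda>v. linear_form \<alpha> (\<theta> v))" for \<alpha>
    unfolding linear_form_def using assms(2) by (intro polyfun_sum polyfun_mult polyfun_const) auto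
  then show ?thesis
    unfolding gradient_eq[OF assms(1)] by (intro polyfun_sum polyfun_mult polyfun_prod polyfun_linear_form)
qed

definition hom_field :: "int \<Rightarrow> (complex^3 \<Rightarrow> complex^'n) \<Rightarrow> bool" where
  "hom_field k \<theta> \<longleftrightarrow> (\<forall>i. hompoly k (\<lambda>v. \<theta> v $ i))"

lemma hom_fieldD: "hom_field k \<theta> \<Longrightarrow> hompoly k (\<lambda>v. \<theta> v $ i)"
  by (simp add: hom_field_def)
lemma hom_field_polyfun: "hom_field k \<theta> \<Longrightarrow> polyfun (\<lambda>v. \<theta> v $ i)"
  using hom_fieldD hompoly_polyfun by blast
lemma hom_field_add: "hom_field k \<theta> \<Longrightarrow> hom_field k \<eta> \<Longrightarrow> hom_field k (\<lambda>v. \<theta> v + \<eta> v)"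
  by (simp add: hom_field_def hompoly_add)
lemma hom_field_diff: "hom_field k \<theta> \<Longrightarrow> hom_field k \<eta> \<Longrightarrow> hom_field k (\<lambda>v. \<theta> v - \<eta> v)"
  by (simp add: hom_field_def hompoly_diff)
lemma hom_field_scale: "hompoly k g \<Longrightarrow> hom_field m \<theta> \<Longrightarrow> k + m = n \<Longrightarrow> hom_field n (\<lambda>v. g v *s \<theta> v)"
  using hompoly_mult[of k g m] by (auto simp: hom_field_def)
lemma hom_field_euler: "hom_field 1 (\<lambda>v. v)"
  by (simp add: hom_field_def)
lemma hom_field_const: "hom_field 0 (\<lambda>v. u)"
  by (simp add: hom_field_def)

lemma hompoly_form_field:
  assumes "hom_field k \<theta>" shows "hompoly k (\<lambda>v. linear_form \<alpha> (\<theta> v))"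
  unfolding linear_form_def by (intro hompoly_sum hompoly_cmult hom_fieldD assms)

lemma hompoly_defining_poly:
  assumes "finite \<A>" shows "hompoly (int (card \<A>)) (defining_poly \<A>)"
  using hompoly_prod[OF assms, of "\<lambda>_. 1" form] by (simp add: defining_poly_def[abs_def])

lemma hompoly_gradient:
  assumes "finite \<A>" "hom_field k \<theta>"
  shows "hompoly (int (card \<A>) - 1 + k) (\<lambda>v. gradient \<A> v (\<theta> v))"
  unfolding gradient_eq[OF assms(1)]
proof (rule hompoly_sum)
  fix H assume H: "H \<in> \<A>"
  have "hompoly (\<Sum>H'\<in>\<A> - {H}. 1) (\<lambda>v. \<Prod>H'\<in>\<A> - {H}. form H' v)"
    using assms(1) by (intro hompoly_prod) auto
  moreover have "int (card \<A>) > 0" using H assms(1) by (metis card_gt_0_iff empty_iff of_nat_0_less_iff)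
  ultimately have "hompoly (int (card \<A>) - 1) (\<lambda>v. \<Prod>H'\<in>\<A> - {H}. form H' v)"
    using H assms(1) by (simp add: of_nat_diff Suc_leI)
  with hompoly_form_field[OF assms(2)]
  show "hompoly (int (card \<A>) - 1 + k) (\<lambda>v. form H (\<theta> v) * (\<Prod>H'\<in>\<A> - {H}. form H' v))"
    by (rule hompoly_mult) simp
qed

section \<open>Polynomial presentations\<close>

definition killed_by_gradient :: "line set \<Rightarrow> (complex^3 \<Rightarrow> complex^3) \<Rightarrow> bool" where
  "killed_by_gradient \<A> \<theta> \<longleftrightarrow> (\<forall>v. gradient \<A> v (\<theta> v) = 0)"

text \<open>
  The surjectivity of a map onto the bundle, with cleared denominators: near \<open>v\<close>, that is, where \<open>Q\<close> does
  not vanish, \<open>\<tau>\<close> is a combination of the \<open>\<theta> j\<close> with coefficients \<open>P j / Q\<close>.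
\<close>

definition locally_generates ::
    "line set \<Rightarrow> ('m::finite \<Rightarrow> int) \<Rightarrow> ('m \<Rightarrow> complex^3 \<Rightarrow> complex^3) \<Rightarrow> bool" where
  "locally_generates \<A> \<delta> \<theta> \<longleftrightarrow> (\<forall>m \<tau> v. hom_field m \<tau> \<and> killed_by_gradient \<A> \<tau> \<and> v \<noteq> 0 \<longrightarrow>
     (\<exists>n Q P. hompoly n Q \<and> Q v \<noteq> 0 \<and> (\<forall>j. hompoly (n + m - \<delta> j) (P j)) \<and>
        (\<forall>w. Q w *s \<tau> w = (\<Sum>j\<in>UNIV. P j w *s \<theta> j w))))"

text \<open>
  Exactness in the middle, with cleared denominators: near \<open>v\<close> every syzygy is the multiple \<open>E / Q\<close> of \<open>r\<close>.
\<close>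

definition syzygies_generated_by ::
    "int \<Rightarrow> ('m::finite \<Rightarrow> int) \<Rightarrow> ('m \<Rightarrow> complex^3 \<Rightarrow> complex^3) \<Rightarrow> ('m \<Rightarrow> complex^3 \<Rightarrow> complex) \<Rightarrow> bool" where
  "syzygies_generated_by e \<delta> \<theta> r \<longleftrightarrow> (\<forall>m A v. (\<forall>j. hompoly (m - \<delta> j) (A j)) \<and>
     (\<forall>w. (\<Sum>j\<in>UNIV. A j w *s \<theta> j w) = 0) \<and> v \<noteq> 0 \<longrightarrow>
     (\<exists>n Q E. hompoly n Q \<and> Q v \<noteq> 0 \<and> hompoly (n + m - e) E \<and> (\<forall>j w. Q w * A j w = E w * r j w)))"

definition presentation ::
    "line set \<Rightarrow> int \<Rightarrow> ('m::finite \<Rightarrow> int) \<Rightarrow> ('m \<Rightarrow> complex^3 \<Rightarrow> complex^3) \<Rightarrow> ('m \<Rightarrow> complex^3 \<Rightarrow> complex) \<Rightarrow> bool" where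
  "presentation \<A> e \<delta> \<theta> r \<longleftrightarrow>
     (\<forall>j. hom_field (\<delta> j) (\<theta> j) \<and> killed_by_gradient \<A> (\<theta> j) \<and> hompoly (e - \<delta> j) (r j)) \<and>
     (\<exists>j v. r j v \<noteq> 0) \<and> (\<forall>v. (\<Sum>j\<in>UNIV. r j v *s \<theta> j v) = 0) \<and>
     locally_generates \<A> \<delta> \<theta> \<and> syzygies_generated_by e \<delta> \<theta> r"

lemma powi_nat_diff:
  "(x::complex) \<noteq> 0 \<Longrightarrow> x powi (- m) * x ^ nat m = x ^ nat (- m)"
  by (simp add: power_int_def field_simps)

lemma arrangement_bundle_outside: "s \<in> arrangement_bundle \<A> U \<Longrightarrow> v \<notin> cone U \<Longrightarrow> s v = 0"
  by (auto simp: arrangement_bundle_def intro: twist_sum_outside)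

lemma arrangement_bundle_iff:
  "s \<in> arrangement_bundle \<A> U \<longleftrightarrow> s \<in> twist_sum 0 U \<and> (\<forall>v. gradient \<A> v (s v) = 0)"
  by (simp add: arrangement_bundle_def gradient_def)

lemma short_exactD:
  assumes "short_exact F G H \<phi> \<psi>" "zariski_open U"
  shows "inj_on (\<phi> U) (F U)" "t \<in> G U \<Longrightarrow> \<psi> U t = (\<lambda>v. 0) \<longleftrightarrow> in_image_sheaf F \<phi> U t"
    "u \<in> H U \<Longrightarrow> in_image_sheaf G \<psi> U u"
  using assms unfolding short_exact_def by blast+

lemma in_image_sheaf_nhd:
  assumes "in_image_sheaf F \<phi> U t" "v \<in> cone U"
  obtains V s where "zariski_open V" "v \<in> cone V" "V \<subseteq> U" "cone V \<subseteq> cone U" "s \<in> F V" "\<phi> V s = restrict_section V t"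
proof -
  have "vec.span {v} \<in> U" "v \<noteq> 0" using assms(2) by (auto simp: cone_def)
  then obtain V s where V: "zariski_open V" "vec.span {v} \<in> V" "V \<subseteq> U" "s \<in> F V" "\<phi> V s = restrict_section V t"
    using assms(1) unfolding in_image_sheaf_def by blast
  show ?thesis by (rule that[OF V(1) _ V(3) _ V(4,5)]) (use V \<open>v \<noteq> 0\<close> in \<open>auto simp: cone_def\<close>)
qed

text \<open>
  Both maps are given by polynomial matrices. A polynomial field or syzygy of degree \<open>m\<close> becomes a section
  over the chart \<open>i\<close> after multiplication by the power \<open>-m\<close> of the \<open>i\<close>-th coordinate; exactness produces a
  local preimage, and clearing denominators gives an identity on a nonvanishing set, hence everywhere.
\<close>

theorem presentation_of_short_exact:
  fixes \<kappa> :: "int^1" and K :: "int^('m::finite)"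
  assumes fin: "finite \<A>"
    and ex: "short_exact (twist_sum \<kappa>) (twist_sum K) (arrangement_bundle \<A>) \<phi> \<psi>"
  shows "\<exists>\<theta> r. presentation \<A> (- \<kappa> $ 1) (\<lambda>j. - K $ j) \<theta> r"
proof -
  have \<phi>: "sheaf_hom (twist_sum \<kappa>) (twist_sum K) \<phi>" and \<psi>: "sheaf_hom (twist_sum K) (arrangement_bundle \<A>) \<psi>"
    using ex by (simp_all add: short_exact_def)
  have sub: "\<And>U. zariski_open U \<Longrightarrow> arrangement_bundle \<A> U \<subseteq> twist_sum 0 U" by (auto simp: arrangement_bundle_def)
  obtain \<theta> :: "'m \<Rightarrow> complex^3 \<Rightarrow> complex^3" where \<theta>': "\<forall>j i. hompoly (0 $ i - K $ j) (\<lambda>v. \<theta> j v $ i)"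
    "\<forall>U s v. zariski_open U \<longrightarrow> s \<in> twist_sum K U \<longrightarrow> v \<in> cone U \<longrightarrow> \<psi> U s v = (\<Sum>j\<in>UNIV. s v $ j *s \<theta> j v)"
    using sheaf_hom_matrix[OF \<psi> sub] by blast
  have \<theta>: "\<And>j i. hompoly (- K $ j) (\<lambda>v. \<theta> j v $ i)"
    "\<And>U s v. zariski_open U \<Longrightarrow> s \<in> twist_sum K U \<Longrightarrow> v \<in> cone U \<Longrightarrow> \<psi> U s v = (\<Sum>j\<in>UNIV. s v $ j *s \<theta> j v)"
    using \<theta>' by simp_all
  obtain \<rho> :: "1 \<Rightarrow> complex^3 \<Rightarrow> complex^'m" where \<rho>': "\<forall>j i. hompoly (K $ i - \<kappa> $ j) (\<lambda>v. \<rho> j v $ i)"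
    "\<forall>U s v. zariski_open U \<longrightarrow> s \<in> twist_sum \<kappa> U \<longrightarrow> v \<in> cone U \<longrightarrow> \<phi> U s v = (\<Sum>j\<in>UNIV. s v $ j *s \<rho> j v)"
    using sheaf_hom_matrix[OF \<phi> subset_refl] by blast
  have \<rho>: "\<And>j i. hompoly (K $ i - \<kappa> $ j) (\<lambda>v. \<rho> j v $ i)"
    "\<And>U s v. zariski_open U \<Longrightarrow> s \<in> twist_sum \<kappa> U \<Longrightarrow> v \<in> cone U \<Longrightarrow> \<phi> U s v = (\<Sum>j\<in>UNIV. s v $ j *s \<rho> j v)"
    using \<rho>' by blast+
  define r where "r j v = \<rho> 1 v $ j" for j v
  have \<phi>_eq: "\<phi> U s v $ j = s v $ 1 * r j v" if "zariski_open U" "s \<in> twist_sum \<kappa> U" "v \<in> cone U" for U s v j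
    using \<rho>(2)[OF that] by (simp add: r_def UNIV_1)
  have hr: "hompoly (- \<kappa> $ 1 - (- K $ j)) (r j)" for j
    using \<rho>(1)[of j 1] by (simp add: r_def[abs_def])
  have h\<theta>: "hom_field (- K $ j) (\<theta> j)" for j using \<theta>(1) by (simp add: hom_field_def)
  have gen_nz: "v \<in> cone (chart i) \<longleftrightarrow> v $ i \<noteq> 0" for v i by (rule cone_chart)
  have kill: "killed_by_gradient \<A> (\<theta> j)" for j
    unfolding killed_by_gradient_def
  proof
    fix v show "gradient \<A> v (\<theta> j v) = 0"
    proof (rule polyfun_zero_off_origin[of "\<lambda>v. gradient \<A> v (\<theta> j v)"])
      show "polyfun (\<lambda>v. gradient \<A> v (\<theta> j v))" by (rule hompoly_polyfun[OF hompoly_gradient[OF fin h\<theta>]])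
      fix v :: "complex^3" assume "v \<noteq> 0"
      then obtain i where i: "v $ i \<noteq> 0" by (auto simp: vec_eq_iff)
      have "\<psi> (chart i) (generator K i j) v = (\<Sum>j'\<in>UNIV. generator K i j v $ j' *s \<theta> j' v)"
        by (rule \<theta>(2)[OF zariski_open_chart generator_in_twist_sum]) (simp add: gen_nz i)
      also have "\<dots> = (\<Sum>j'\<in>UNIV. if j' = j then (v $ i) powi (K $ j) *s \<theta> j v else 0)"
        using i by (intro sum.cong) (auto simp: generator_def axis_def)
      finally have "\<psi> (chart i) (generator K i j) v = (v $ i) powi (K $ j) *s \<theta> j v" by simp
      moreover have "gradient \<A> v (\<psi> (chart i) (generator K i j) v) = 0"
        using sheaf_homD(1)[OF \<psi> zariski_open_chart generator_in_twist_sum] by (simp add: arrangement_bundle_iff)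
      ultimately show "gradient \<A> v (\<theta> j v) = 0" using i by (simp add: gradient_scale)
    qed
  qed
  have gen1: "generator \<kappa> i 1 v $ 1 = (v $ i) powi (\<kappa> $ 1)" if "v $ i \<noteq> 0" for i v
    using that by (simp add: generator_def axis_def)
  have nz: "\<exists>j v. r j v \<noteq> 0"
  proof (rule ccontr)
    assume "\<not> ?thesis"
    then have r0: "r j v = 0" for j v by simp
    let ?g = "generator \<kappa> 1 1"
    have z: "\<phi> (chart 1) s = (\<lambda>v. 0)" if s: "s \<in> twist_sum \<kappa> (chart 1)" for s
    proof
      fix v
      show "\<phi> (chart 1) s v = 0"
      proof (cases "v \<in> cone (chart 1)")
        case True
        show ?thesis using \<phi>_eq[OF zariski_open_chart s True] r0 by (simp add: vec_eq_iff)
      next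
        case False
        show ?thesis using twist_sum_outside[OF sheaf_homD(1)[OF \<phi> zariski_open_chart s] False] .
      qed
    qed
    have "?g = (\<lambda>v. 0)"
      using short_exactD(1)[OF ex zariski_open_chart[of 1]] z[OF generator_in_twist_sum] z[OF twist_sum_zero[OF zariski_open_chart]]
        generator_in_twist_sum twist_sum_zero[OF zariski_open_chart] by (metis inj_onD)
    then have "?g (axis 1 1) $ 1 = 0" by (metis zero_index)
    then show False using gen1[of "axis 1 1" 1] by simp
  qed
  have rel: "(\<Sum>j\<in>UNIV. r j v *s \<theta> j v) = 0" for v
  proof -
    have "(\<Sum>j\<in>UNIV. r j v *s \<theta> j v) $ l = 0" for l
    proof (rule polyfun_zero_off_origin[of "\<lambda>v. (\<Sum>j\<in>UNIV. r j v *s \<theta> j v) $ l"])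
      show "polyfun (\<lambda>v. (\<Sum>j\<in>UNIV. r j v *s \<theta> j v) $ l)"
        unfolding sum_component vector_smult_component
        by (intro polyfun_sum polyfun_mult hompoly_polyfun[OF hr] hom_field_polyfun[OF h\<theta>])
      fix v :: "complex^3" assume "v \<noteq> 0"
      then obtain i where i: "v $ i \<noteq> 0" by (auto simp: vec_eq_iff)
      let ?t = "\<phi> (chart i) (generator \<kappa> i 1)"
      have t: "?t \<in> twist_sum K (chart i)" by (rule sheaf_homD(1)[OF \<phi> zariski_open_chart generator_in_twist_sum])
      have "?t = restrict_section (chart i) ?t"
        using twist_sum_outside[OF t] by (auto simp: restrict_section_def)
      then have "in_image_sheaf (twist_sum \<kappa>) \<phi> (chart i) ?t"
        unfolding in_image_sheaf_def using zariski_open_chart generator_in_twist_sum by blast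
      then have "\<psi> (chart i) ?t = (\<lambda>v. 0)" using short_exactD(2)[OF ex zariski_open_chart t] by blast
      then have "(\<Sum>j\<in>UNIV. ?t v $ j *s \<theta> j v) = 0"
        using \<theta>(2)[OF zariski_open_chart t, of v] i by (simp add: gen_nz)
      moreover have "?t v $ j = (v $ i) powi (\<kappa> $ 1) * r j v" for j
        using \<phi>_eq[OF zariski_open_chart generator_in_twist_sum, of v i] i gen1[OF i] by (simp add: gen_nz)
      ultimately have "(v $ i) powi (\<kappa> $ 1) *s (\<Sum>j\<in>UNIV. r j v *s \<theta> j v) = 0"
        by (simp add: vec.scale_sum_right)
      then show "(\<Sum>j\<in>UNIV. r j v *s \<theta> j v) $ l = 0" using i by simp
    qed
    then show ?thesis by (simp add: vec_eq_iff)
  qed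
  have gen: "locally_generates \<A> (\<lambda>j. - K $ j) \<theta>"
    unfolding locally_generates_def
  proof (intro allI impI, elim conjE)
    fix m \<tau> and v :: "complex^3"
    assume \<tau>: "hom_field m \<tau>" "killed_by_gradient \<A> \<tau>" and "v \<noteq> 0"
    then obtain i where i: "v $ i \<noteq> 0" by (auto simp: vec_eq_iff)
    define u where "u w = (if w \<in> cone (chart i) then (w $ i) powi (- m) else 0) *s (if w \<in> cone (chart i) then \<tau> w else 0)" for w
    have "(\<lambda>w. u w $ l) \<in> twist_sections 0 (chart i)" for l
    proof -
      have "(\<lambda>w. (if w \<in> cone (chart i) then (w $ i) powi (- m) else 0) * (if w \<in> cone (chart i) then \<tau> w $ l else 0)) \<in> twist_sections 0 (chart i)"
        by (rule twist_sections_mult[OF zariski_open_chart twist_sections_coord_power[OF zariski_open_chart]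
              twist_sections_hompoly[OF hom_fieldD[OF \<tau>(1)] zariski_open_chart]]) (auto simp: gen_nz)
      moreover have "(\<lambda>w. u w $ l) = (\<lambda>w. (if w \<in> cone (chart i) then (w $ i) powi (- m) else 0) * (if w \<in> cone (chart i) then \<tau> w $ l else 0))"
        by (auto simp: u_def)
      ultimately show ?thesis by simp
    qed
    then have "u \<in> arrangement_bundle \<A> (chart i)"
      using \<tau>(2) by (auto simp: arrangement_bundle_iff twist_sum_def u_def gradient_scale killed_by_gradient_def)
    then have "in_image_sheaf (twist_sum K) \<psi> (chart i) u" using short_exactD(3)[OF ex zariski_open_chart] by blast
    then obtain V s where V: "zariski_open V" "v \<in> cone V" "V \<subseteq> chart i" "cone V \<subseteq> cone (chart i)" "s \<in> twist_sum K V" "\<psi> V s = restrict_section V u"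
      by (rule in_image_sheaf_nhd[of _ _ _ _ v]) (use i in \<open>simp add: gen_nz\<close>)
    obtain P Q n where PQ: "hompoly n Q" "0 < n" "\<And>j. hompoly (n + K $ j) (P j)" "Q v \<noteq> 0"
     "\<And>w. Q w \<noteq> 0 \<Longrightarrow> w \<in> cone V" "\<And>j w. Q w \<noteq> 0 \<Longrightarrow> s w $ j = P j w / Q w"
      by (rule common_denominator[of "\<lambda>j. K $ j" V "\<lambda>j w. s w $ j" v, OF twist_section_regular[OF V(1) twist_sum_component[OF V(5)] V(2)]]) (rule that)
    define Q' where "Q' w = Q w * w $ i ^ nat (- m)" for w
    define P' where "P' j w = P j w * w $ i ^ nat m" for j w
    have hQ': "hompoly (n + int (nat (- m))) Q'" unfolding Q'_def[abs_def]
      by (rule hompoly_mult[OF PQ(1) hompoly_coord_power refl])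
    have hP': "hompoly (n + int (nat (- m)) + m - (- K $ j)) (P' j)" for j unfolding P'_def[abs_def]
      by (rule hompoly_mult[OF PQ(3) hompoly_coord_power]) simp
    have "Q' w *s \<tau> w = (\<Sum>j\<in>UNIV. P' j w *s \<theta> j w)" for w
    proof -
      have "(Q' w *s \<tau> w - (\<Sum>j\<in>UNIV. P' j w *s \<theta> j w)) $ l = 0" for l
      proof (rule polyfun_zero_off_zeros[of "\<lambda>w. (Q' w *s \<tau> w - (\<Sum>j\<in>UNIV. P' j w *s \<theta> j w)) $ l" Q v])
        show "polyfun (\<lambda>w. (Q' w *s \<tau> w - (\<Sum>j\<in>UNIV. P' j w *s \<theta> j w)) $ l)"
          unfolding sum_component vector_smult_component vector_minus_component
          by (intro polyfun_sum polyfun_mult polyfun_diff hompoly_polyfun[OF hQ'] hompoly_polyfun[OF hP'] hom_field_polyfun[OF h\<theta>] hom_field_polyfun[OF \<tau>(1)])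
        fix w assume w: "Q w \<noteq> 0"
        have wV: "w \<in> cone V" by (rule PQ(5)[OF w])
        then have wi: "w $ i \<noteq> 0" using V(4) gen_nz by blast
        have "(\<Sum>j\<in>UNIV. s w $ j *s \<theta> j w) = (w $ i) powi (- m) *s \<tau> w"
          using \<theta>(2)[OF V(1) V(5) wV] V(6) wV wi by (simp add: restrict_section_def u_def gen_nz)
        then have "(Q w * w $ i ^ nat m) *s (\<Sum>j\<in>UNIV. s w $ j *s \<theta> j w) = (Q w * (w $ i ^ nat m * (w $ i) powi (- m))) *s \<tau> w"
          by (simp add: mult_ac)
        also have "w $ i ^ nat m * (w $ i) powi (- m) = w $ i ^ nat (- m)" using powi_nat_diff[OF wi, of m] by (simp add: mult.commute)
        also have "(Q w * w $ i ^ nat m) *s (\<Sum>j\<in>UNIV. s w $ j *s \<theta> j w) = (\<Sum>j\<in>UNIV. P' j w *s \<theta> j w)"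
          using w by (simp add: vec.scale_sum_right PQ(6) P'_def mult.commute)
        finally have "(\<Sum>j\<in>UNIV. P' j w *s \<theta> j w) = Q' w *s \<tau> w" by (simp add: Q'_def)
        then show "(Q' w *s \<tau> w - (\<Sum>j\<in>UNIV. P' j w *s \<theta> j w)) $ l = 0" by simp
      qed (use PQ in auto)
      then have "Q' w *s \<tau> w - (\<Sum>j\<in>UNIV. P' j w *s \<theta> j w) = 0" by (simp add: vec_eq_iff)
      then show ?thesis by simp
    qed
    moreover have "Q' v \<noteq> 0" using PQ(4) i by (simp add: Q'_def)
    ultimately show "\<exists>n Q P. hompoly n Q \<and> Q v \<noteq> 0 \<and> (\<forall>j. hompoly (n + m - - K $ j) (P j)) \<and>
        (\<forall>w. Q w *s \<tau> w = (\<Sum>j\<in>UNIV. P j w *s \<theta> j w))"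
      using hQ' hP' by blast
  qed
  have syz: "syzygies_generated_by (- \<kappa> $ 1) (\<lambda>j. - K $ j) \<theta> r"
    unfolding syzygies_generated_by_def
  proof (intro allI impI, elim conjE)
    fix m A and v :: "complex^3"
    assume A: "\<forall>j. hompoly (m - - K $ j) (A j)" and A0: "\<forall>w. (\<Sum>j\<in>UNIV. A j w *s \<theta> j w) = 0" and "v \<noteq> 0"
    then obtain i where i: "v $ i \<noteq> 0" by (auto simp: vec_eq_iff)
    define t where "t w = (\<chi> j. (if w \<in> cone (chart i) then (w $ i) powi (- m) else 0) * (if w \<in> cone (chart i) then A j w else 0))" for w
    have t: "t \<in> twist_sum K (chart i)"
    proof -
      have "(\<lambda>w. (if w \<in> cone (chart i) then (w $ i) powi (- m) else 0) * (if w \<in> cone (chart i) then A j w else 0)) \<in> twist_sections (K $ j) (chart i)" for j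
        by (rule twist_sections_mult[OF zariski_open_chart twist_sections_coord_power[OF zariski_open_chart]
              twist_sections_hompoly[OF A[rule_format] zariski_open_chart]]) (auto simp: gen_nz)
      then show ?thesis by (simp add: twist_sum_def t_def)
    qed
    have "\<psi> (chart i) t w = 0" for w
    proof (cases "w \<in> cone (chart i)")
      case True
      have "\<psi> (chart i) t w = (w $ i) powi (- m) *s (\<Sum>j\<in>UNIV. A j w *s \<theta> j w)"
        using \<theta>(2)[OF zariski_open_chart t True] True by (simp add: t_def vec.scale_sum_right)
      then show ?thesis using A0 by simp
    next
      case False
      show ?thesis using arrangement_bundle_outside[OF sheaf_homD(1)[OF \<psi> zariski_open_chart t] False] .
    qed
    then have "in_image_sheaf (twist_sum \<kappa>) \<phi> (chart i) t" using short_exactD(2)[OF ex zariski_open_chart t] by auto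
    then obtain V s where V: "zariski_open V" "v \<in> cone V" "V \<subseteq> chart i" "cone V \<subseteq> cone (chart i)" "s \<in> twist_sum \<kappa> V" "\<phi> V s = restrict_section V t"
      by (rule in_image_sheaf_nhd[of _ _ _ _ v]) (use i in \<open>simp add: gen_nz\<close>)
    obtain E Q n where EQ: "hompoly n Q" "0 < n" "hompoly (n + \<kappa> $ 1) E" "Q v \<noteq> 0"
     "\<And>w. Q w \<noteq> 0 \<Longrightarrow> w \<in> cone V" "\<And>w. Q w \<noteq> 0 \<Longrightarrow> s w $ 1 = E w / Q w"
      using twist_section_regular[OF V(1) twist_sum_component[OF V(5)] V(2)] by (rule regular_atE) blast
    define Q' where "Q' w = Q w * w $ i ^ nat (- m)" for w
    define E' where "E' w = E w * w $ i ^ nat m" for w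
    have hQ': "hompoly (n + int (nat (- m))) Q'" unfolding Q'_def[abs_def]
      by (rule hompoly_mult[OF EQ(1) hompoly_coord_power refl])
    have hE': "hompoly (n + int (nat (- m)) + m - (- \<kappa> $ 1)) E'" unfolding E'_def[abs_def]
      by (rule hompoly_mult[OF EQ(3) hompoly_coord_power]) simp
    have "Q' w * A j w = E' w * r j w" for w j
    proof -
      have "Q' w * A j w - E' w * r j w = 0"
      proof (rule polyfun_zero_off_zeros[of "\<lambda>w. Q' w * A j w - E' w * r j w" Q v])
        show "polyfun (\<lambda>w. Q' w * A j w - E' w * r j w)"
          by (intro polyfun_mult polyfun_diff hompoly_polyfun[OF hQ'] hompoly_polyfun[OF hE'] hompoly_polyfun[OF hr] hompoly_polyfun[OF A[rule_format]])
        fix w assume w: "Q w \<noteq> 0"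
        have wV: "w \<in> cone V" by (rule EQ(5)[OF w])
        then have wi: "w $ i \<noteq> 0" using V(4) gen_nz by blast
        have "E w / Q w * r j w = (w $ i) powi (- m) * A j w"
          using \<phi>_eq[OF V(1) V(5) wV, of j] V(6) wV wi w by (simp add: restrict_section_def t_def gen_nz EQ(6))
        then have "E w * r j w = Q w * ((w $ i) powi (- m) * A j w)" using w by (simp add: field_simps)
        then have "E' w * r j w = Q w * ((w $ i) powi (- m) * w $ i ^ nat m) * A j w" by (simp add: E'_def)
        then show "Q' w * A j w - E' w * r j w = 0" using powi_nat_diff[OF wi, of m] by (simp add: Q'_def)
      qed (use EQ in auto)
      then show ?thesis by simp
    qed
    moreover have "Q' v \<noteq> 0" using EQ(4) i by (simp add: Q'_def)
    ultimately show "\<exists>n Q E. hompoly n Q \<and> Q v \<noteq> 0 \<and> hompoly (n + m - - \<kappa> $ 1) E \<and> (\<forall>j w. Q w * A j w = E w * r j w)"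
      using hQ' hE' by blast
  qed
  have "presentation \<A> (- \<kappa> $ 1) (\<lambda>j. - K $ j) \<theta> r"
    unfolding presentation_def using h\<theta> kill hr nz rel gen syz by blast
  then show ?thesis by blast
qed

section \<open>Two plane curves meet\<close>

text \<open>
  The polynomial on the line through \<open>b\<close> in direction \<open>a\<close> is, by homogeneity, the one on the given line
  with its coefficients reversed, and its value at \<open>0\<close> is \<open>P b\<close>.
\<close>

lemma hompoly_on_line:
  assumes "hompoly (int n) P"
  obtains p where "\<And>t. P (a + t *s b) = poly p t" "degree p \<le> n" "coeff p n = P b"
proof -
  obtain p where p: "\<And>t. P (a + t *s b) = poly p t" using polyfun_on_line[OF hompoly_polyfun[OF assms]] by blast
  obtain q where q: "\<And>t. P (b + t *s a) = poly q t" using polyfun_on_line[OF hompoly_polyfun[OF assms]] by blast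
  have qp: "poly q t = t ^ n * poly p (1 / t)" if t: "t \<noteq> 0" for t
  proof -
    have "b + t *s a = t *s (a + (1 / t) *s b)" using t by (simp add: vector_add_ldistrib)
    then show ?thesis using hompoly_scale[OF assms t, of "a + (1 / t) *s b"] p q by (metis power_int_of_nat)
  qed
  have deg: "degree p \<le> n"
    using degree_le_if_reciprocal[of q "int n" p] qp by (cases "p = 0") auto
  have "poly (monom 1 (n - degree p) * reflect_poly p - q) t = 0" if t: "t \<noteq> 0" for t
    using deg poly_reflect_poly_nz[OF t, of p] qp[OF t]
    by (simp add: poly_monom inverse_eq_divide flip: mult.assoc power_add)
  then have "monom 1 (n - degree p) * reflect_poly p - q = 0" by (rule poly_eq_0_off_origin)
  then have "poly (monom 1 (n - degree p) * reflect_poly p) 0 = poly q 0" by simp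
  then have "coeff p n = P b"
    using q[of 0] deg by (cases "degree p = n") (auto simp: poly_monom power_0_left coeff_eq_0)
  with p deg show ?thesis by (rule that)
qed

text \<open>
  Without zeros on the affine line the polynomial is constant, so that its coefficient at the positive
  degree \<open>n\<close>, which is \<open>P b\<close>, vanishes.
\<close>

lemma hompoly_zero_on_line:
  assumes "hompoly n P" "0 < n"
  shows "(\<exists>t. P (a + t *s b) = 0) \<or> P b = 0"
proof -
  have "hompoly (int (nat n)) P" using assms by simp
  then obtain p where p: "\<And>t. P (a + t *s b) = poly p t" "degree p \<le> nat n" "coeff p (nat n) = P b"
    by (rule hompoly_on_line[where a = a and b = b]) (rule that)
  show ?thesis
  proof (cases "\<exists>t. poly p t = 0")
    case False
    then have "constant (poly p)" using fundamental_theorem_of_algebra by blast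
    then have "degree p = 0" by (simp add: constant_degree)
    then have "P b = 0" using p(3) assms(2) by (metis coeff_eq_0 zero_less_nat_eq)
    then show ?thesis by simp
  qed (use p(1) in auto)
qed

lemma dvd_mult_no_common_root:
  fixes p :: "complex poly"
  assumes "p \<noteq> 0" "\<And>z. poly p z = 0 \<Longrightarrow> poly q z \<noteq> 0" "p dvd b * q"
  shows "p dvd b"
  using assms
proof (induction "degree p" arbitrary: p b rule: less_induct)
  case less
  show ?case
  proof (cases "\<exists>z. poly p z = 0")
    case False
    then have "constant (poly p)" using fundamental_theorem_of_algebra by blast
    then have "degree p = 0" by (simp add: constant_degree)
    then have "is_unit p" using less.prems(1) by (simp add: is_unit_iff_degree)
    then show ?thesis by (rule unit_imp_dvd)
  next
    case True
    then obtain z where z: "poly p z = 0" by blast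
    then obtain p' where p': "p = [:- z, 1:] * p'" using poly_eq_0_iff_dvd by (metis dvdE)
    have "poly (b * q) z = 0" using less.prems(3) z by (metis dvdE mult_eq_0_iff poly_mult)
    then have "poly b z = 0" using less.prems(2)[OF z] by simp
    then obtain b' where b': "b = [:- z, 1:] * b'" using poly_eq_0_iff_dvd by (metis dvdE)
    have "[:- z, 1:] * p' dvd [:- z, 1:] * (b' * q)" using less.prems(3) p' b' by (simp only: mult.assoc)
    then have dvd: "p' dvd b' * q" by (subst (asm) dvd_mult_cancel_left) auto
    have p'0: "p' \<noteq> 0" using less.prems(1) p' by auto
    then have "degree p = Suc (degree p')" unfolding p' by (subst degree_mult_eq) auto
    moreover have "poly p' x = 0 \<Longrightarrow> poly q x \<noteq> 0" for x using less.prems(2)[of x] p' by simp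
    ultimately have "p' dvd b'" using less.hyps[of p' b'] p'0 dvd by simp
    then show ?thesis unfolding p' b' by (rule mult_dvd_mono[OF dvd_refl])
  qed
qed

text \<open>
  Forms in the first two coordinates, regarded as functions of all three.
\<close>

definition hompoly_xy :: "int \<Rightarrow> (complex^3 \<Rightarrow> complex) \<Rightarrow> bool" where
  "hompoly_xy k b \<longleftrightarrow> hompoly k b \<and> (\<forall>v t. b (v + t *s axis 3 1) = b v)"

lemma hompoly_xyD: "hompoly_xy k b \<Longrightarrow> hompoly k b" "hompoly_xy k b \<Longrightarrow> b (v + t *s axis 3 1) = b v"
  by (simp_all add: hompoly_xy_def)
lemma hompoly_xy_zero: "hompoly_xy k (\<lambda>v. 0)" by (simp add: hompoly_xy_def)
lemma hompoly_xy_mult: "hompoly_xy k a \<Longrightarrow> hompoly_xy m b \<Longrightarrow> k + m = n \<Longrightarrow> hompoly_xy n (\<lambda>v. a v * b v)"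
  by (auto simp: hompoly_xy_def intro: hompoly_mult)
lemma hompoly_xy_cmult: "hompoly_xy k a \<Longrightarrow> hompoly_xy k (\<lambda>v. c * a v)"
  by (auto simp: hompoly_xy_def intro: hompoly_cmult)
lemma hompoly_xy_diff: "hompoly_xy k a \<Longrightarrow> hompoly_xy k b \<Longrightarrow> hompoly_xy k (\<lambda>v. a v - b v)"
  by (auto simp: hompoly_xy_def intro: hompoly_diff)
lemma hompoly_xy_minus: "hompoly_xy k a \<Longrightarrow> hompoly_xy k (\<lambda>v. - a v)"
  by (auto simp: hompoly_xy_def intro: hompoly_minus)
lemma hompoly_xy_sum: "(\<And>i. i \<in> I \<Longrightarrow> hompoly_xy k (a i)) \<Longrightarrow> hompoly_xy k (\<lambda>v. \<Sum>i\<in>I. a i v)"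
  by (auto simp: hompoly_xy_def intro: hompoly_sum)

lemma hompoly_expand:
  assumes "hompoly (int n) P"
  obtains p where "\<And>l. hompoly_xy (int n - int l) (p l)" "\<And>v. P v = (\<Sum>l<Suc n. p l v * v $ 3 ^ l)"
proof -
  obtain c where c: "\<And>v. P v = (\<Sum>i\<le>n. \<Sum>j\<le>n - i. c i j * v $ 1 ^ i * v $ 2 ^ j * v $ 3 ^ (n - i - j))"
    using hompoly_imp_homogeneous_poly[OF assms] unfolding homogeneous_poly_def by blast
  define p where "p l v = (\<Sum>i\<le>n. \<Sum>j\<le>n - i. if n - i - j = l then c i j * v $ 1 ^ i * v $ 2 ^ j else 0)" for l and v :: "complex^3"
  show ?thesis
  proof (rule that[of p])
    show "hompoly_xy (int n - int l) (p l)" for l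
      unfolding p_def[abs_def]
    proof (intro hompoly_xy_sum)
      fix i j assume ij: "i \<in> {..n}" "j \<in> {..n - i}"
      show "hompoly_xy (int n - int l) (\<lambda>v. if n - i - j = l then c i j * v $ 1 ^ i * v $ 2 ^ j else 0)"
      proof (cases "n - i - j = l")
        case True
        have "hompoly (int n - int l) (\<lambda>v. c i j * v $ 1 ^ i * v $ 2 ^ j)"
          by (rule hompoly_mult[OF hompoly_cmult[OF hompoly_coord_power] hompoly_coord_power]) (use ij True in auto)
        then show ?thesis using True by (simp add: hompoly_xy_def)
      qed (simp add: hompoly_xy_zero)
    qed
    fix v
    have "(\<Sum>l<Suc n. p l v * v $ 3 ^ l) = (\<Sum>l<Suc n. \<Sum>i\<le>n. \<Sum>j\<le>n - i. if n - i - j = l then c i j * v $ 1 ^ i * v $ 2 ^ j * v $ 3 ^ l else 0)"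
      unfolding p_def sum_distrib_right by (intro sum.cong refl) simp
    also have "\<dots> = (\<Sum>i\<le>n. \<Sum>l<Suc n. \<Sum>j\<le>n - i. if n - i - j = l then c i j * v $ 1 ^ i * v $ 2 ^ j * v $ 3 ^ l else 0)"
      by (rule sum.swap)
    also have "\<dots> = (\<Sum>i\<le>n. \<Sum>j\<le>n - i. \<Sum>l<Suc n. if n - i - j = l then c i j * v $ 1 ^ i * v $ 2 ^ j * v $ 3 ^ l else 0)"
      by (intro sum.cong refl sum.swap)
    also have "\<dots> = P v" unfolding c by (intro sum.cong refl) (simp add: sum.delta' del: sum.lessThan_Suc)
    finally show "P v = (\<Sum>l<Suc n. p l v * v $ 3 ^ l)" by simp
  qed
qed

text \<open>
  Division with remainder by \<open>r\<close> as a polynomial in the last coordinate. Its leading coefficient is the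
  nonzero constant \<open>r (0, 0, 1)\<close>, so that the division stays within graded polynomials.
\<close>

lemma hompoly_remainder:
  assumes r: "hompoly (int n) r" and lead: "r (axis 3 1) \<noteq> 0"
    and p: "\<And>l. hompoly_xy (D - int l) (p l)"
  shows "\<exists>A m. polyfun A \<and> (\<forall>l. hompoly_xy (D - int l) (m l)) \<and>
     (\<forall>v. (\<Sum>l<k. p l v * v $ 3 ^ l) = A v * r v + (\<Sum>l<n. m l v * v $ 3 ^ l))"
  using p
proof (induction k arbitrary: p)
  case 0
  show ?case by (rule exI[of _ "\<lambda>v. 0"], rule exI[of _ "\<lambda>l v. 0"]) (simp add: hompoly_xy_zero)
next
  case (Suc k)
  obtain \<rho> where \<rho>: "\<And>l. hompoly_xy (int n - int l) (\<rho> l)" "\<And>v. r v = (\<Sum>l<Suc n. \<rho> l v * v $ 3 ^ l)"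
    using hompoly_expand[OF r] by metis
  show ?case
  proof (cases "k < n")
    case True
    define m where "m l = (if l < Suc k then p l else (\<lambda>v. 0))" for l
    have "(\<Sum>l<n. m l v * v $ 3 ^ l) = (\<Sum>l<Suc k. p l v * v $ 3 ^ l)" for v
      unfolding m_def using True by (intro sum.mono_neutral_cong_right) auto
    moreover have "hompoly_xy (D - int l) (m l)" for l by (simp add: m_def Suc.prems hompoly_xy_zero)
    ultimately show ?thesis by (intro exI[of _ "\<lambda>v. 0"] exI[of _ m]) simp
  next
    case False
    \<comment> \<open>the coefficient of the top power is constant\<close>
    define c where "c = r (axis 3 1)"
    have \<rho>n: "\<rho> n v = c" for v
    proof -
      have h0: "hompoly 0 (\<rho> n)" using hompoly_xyD(1)[OF \<rho>(1)[of n]] by simp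
      have "\<rho> n 0 = \<rho> n v" using hompoly_0_constant[OF h0, of v] by simp
      moreover have "\<rho> l (axis 3 1) = (if l = n then \<rho> n 0 else 0)" if "l \<le> n" for l
      proof -
        have "\<rho> l (axis 3 1) = \<rho> l 0" using hompoly_xyD(2)[OF \<rho>(1)[of l], of 0 1] by simp
        then show ?thesis using hompoly_at_zero[OF hompoly_xyD(1)[OF \<rho>(1)[of l]]] that by auto
      qed
      then have "c = (\<Sum>l<Suc n. if l = n then \<rho> n 0 else 0)"
        unfolding c_def \<rho>(2) by (intro sum.cong) auto
      ultimately show ?thesis by simp
    qed
    define p' where "p' l v = p l v - (if k - n \<le> l \<and> l < k then (1 / c) * (p k v * \<rho> (l - (k - n)) v) else 0)" for l v
    have p': "hompoly_xy (D - int l) (p' l)" for l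
    proof (cases "k - n \<le> l \<and> l < k")
      case True
      then show ?thesis unfolding p'_def[abs_def]
        using False by (simp only: if_True simp_thms)
          (intro hompoly_xy_diff hompoly_xy_cmult Suc.prems hompoly_xy_mult[OF Suc.prems \<rho>(1)], use True False in arith)
    next
      case False
      then have "p' l = p l" by (auto simp: p'_def)
      then show ?thesis using Suc.prems by simp
    qed
    obtain A m where Am: "polyfun A" "\<And>l. hompoly_xy (D - int l) (m l)"
      "\<And>v. (\<Sum>l<k. p' l v * v $ 3 ^ l) = A v * r v + (\<Sum>l<n. m l v * v $ 3 ^ l)"
      using Suc.IH[OF p'] by blast
    have "(\<Sum>l<Suc k. p l v * v $ 3 ^ l) = (A v + (1 / c) * p k v * v $ 3 ^ (k - n)) * r v + (\<Sum>l<n. m l v * v $ 3 ^ l)" for v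
    proof -
      have c0: "c \<noteq> 0" using lead by (simp add: c_def)
      have "(1 / c) * p k v * v $ 3 ^ (k - n) * r v = (\<Sum>l<Suc n. (1 / c) * (p k v * \<rho> l v) * v $ 3 ^ (l + (k - n)))"
        unfolding \<rho>(2) sum_distrib_left by (intro sum.cong) (simp_all add: power_add)
      also have "\<dots> = (\<Sum>l<n. (1 / c) * (p k v * \<rho> l v) * v $ 3 ^ (l + (k - n))) + p k v * v $ 3 ^ k"
        using False c0 by (simp add: \<rho>n)
      also have "(\<Sum>l<n. (1 / c) * (p k v * \<rho> l v) * v $ 3 ^ (l + (k - n)))
          = (\<Sum>l\<in>{k - n..<k}. (1 / c) * (p k v * \<rho> (l - (k - n)) v) * v $ 3 ^ l)"
        using False by (intro sum.reindex_bij_witness[of _ "\<lambda>l. l - (k - n)" "\<lambda>l. l + (k - n)"]) auto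
      also have "\<dots> = (\<Sum>l<k. (if k - n \<le> l \<and> l < k then (1 / c) * (p k v * \<rho> (l - (k - n)) v) else 0) * v $ 3 ^ l)"
        by (intro sum.mono_neutral_cong_left) auto
      finally have 1: "(1 / c) * p k v * v $ 3 ^ (k - n) * r v =
        (\<Sum>l<k. (if k - n \<le> l \<and> l < k then (1 / c) * (p k v * \<rho> (l - (k - n)) v) else 0) * v $ 3 ^ l) + p k v * v $ 3 ^ k" .
      have "(\<Sum>l<k. p l v * v $ 3 ^ l) = (\<Sum>l<k. p' l v * v $ 3 ^ l) +
        (\<Sum>l<k. (if k - n \<le> l \<and> l < k then (1 / c) * (p k v * \<rho> (l - (k - n)) v) else 0) * v $ 3 ^ l)"
        unfolding p'_def by (simp only: left_diff_distrib sum_subtractf diff_add_cancel)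
      then have "(\<Sum>l<Suc k. p l v * v $ 3 ^ l) = (\<Sum>l<k. p' l v * v $ 3 ^ l) + (1 / c) * p k v * v $ 3 ^ (k - n) * r v"
        unfolding 1 by simp
      then show ?thesis unfolding Am(3) by (simp add: distrib_right)
    qed
    moreover have "polyfun (\<lambda>v. A v + (1 / c) * p k v * v $ 3 ^ (k - n))"
      by (intro polyfun_add polyfun_mult polyfun_power polyfun_const polyfun_coord Am(1) hompoly_polyfun[OF hompoly_xyD(1)[OF Suc.prems]])
    ultimately show ?thesis using Am(2) by blast
  qed
qed

text \<open>
  Gaussian elimination without division. A pivot is a nonzero entry of the last row, and cross
  multiplication with it preserves the grading, with degrees \<open>u i + w j\<close> of the entries, so that the
  solution is homogeneous too.
\<close>

lemma underdetermined_homogeneous_system: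
  fixes M :: "nat \<Rightarrow> nat \<Rightarrow> complex^3 \<Rightarrow> complex"
  assumes "finite J" "m < card J" "\<And>i j. hompoly_xy (u i + w j) (M i j)"
  shows "\<exists>b D. (\<forall>j. hompoly_xy (D - w j) (b j)) \<and> (\<exists>j\<in>J. \<exists>v. b j v \<noteq> 0) \<and>
     (\<forall>i<m. \<forall>v. (\<Sum>j\<in>J. M i j v * b j v) = 0)"
  using assms
proof (induction m arbitrary: J M u)
  case 0
  then obtain p where p: "p \<in> J" by fastforce
  have "hompoly_xy (w p - w j) (if j = p then (\<lambda>v. 1) else (\<lambda>v. 0))" for j by (simp add: hompoly_xy_def)
  with p show ?case
    by (intro exI[of _ "\<lambda>j. if j = p then (\<lambda>v. 1) else (\<lambda>v. 0)"] exI[of _ "w p"]) auto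
next
  case (Suc m)
  show ?case
  proof (cases "\<exists>p\<in>J. \<exists>v. M m p v \<noteq> 0")
    case False
    have "\<exists>b D. (\<forall>j. hompoly_xy (D - w j) (b j)) \<and> (\<exists>j\<in>J. \<exists>v. b j v \<noteq> 0) \<and>
       (\<forall>i<m. \<forall>v. (\<Sum>j\<in>J. M i j v * b j v) = 0)"
      using Suc.prems by (intro Suc.IH[of J u M]) auto
    then obtain b D where "\<forall>j. hompoly_xy (D - w j) (b j)" "\<exists>j\<in>J. \<exists>v. b j v \<noteq> 0"
       "\<forall>i<m. \<forall>v. (\<Sum>j\<in>J. M i j v * b j v) = 0" by blast
    then show ?thesis using False by (intro exI[of _ b] exI[of _ D]) (auto simp: less_Suc_eq)
  next
    case True
    then obtain p v0 where p: "p \<in> J" "M m p v0 \<noteq> 0" by blast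
    define M' where "M' i j v = M m p v * M i j v - M i p v * M m j v" for i j v
    have "\<exists>b D. (\<forall>j. hompoly_xy (D - w j) (b j)) \<and> (\<exists>j\<in>J - {p}. \<exists>v. b j v \<noteq> 0) \<and>
       (\<forall>i<m. \<forall>v. (\<Sum>j\<in>J - {p}. M' i j v * b j v) = 0)"
    proof (rule Suc.IH[of "J - {p}" "\<lambda>i. u m + w p + u i" M'])
      show "m < card (J - {p})" using Suc.prems(1,2) p(1) by simp
      show "hompoly_xy (u m + w p + u i + w j) (M' i j)" for i j unfolding M'_def[abs_def]
        by (rule hompoly_xy_diff; rule hompoly_xy_mult[OF Suc.prems(3) Suc.prems(3)]) simp_all
    qed (use Suc.prems in auto)
    then obtain b D where b: "\<And>j. hompoly_xy (D - w j) (b j)" "\<exists>j\<in>J - {p}. \<exists>v. b j v \<noteq> 0"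
       "\<And>i v. i < m \<Longrightarrow> (\<Sum>j\<in>J - {p}. M' i j v * b j v) = 0" by blast
    define c where "c j v = (if j = p then - (\<Sum>j\<in>J - {p}. M m j v * b j v) else M m p v * b j v)" for j v
    have hc: "hompoly_xy (u m + w p + D - w j) (c j)" for j
    proof (cases "j = p")
      case True
      have "hompoly_xy (u m + D) (\<lambda>v. - (\<Sum>j\<in>J - {p}. M m j v * b j v))"
        by (intro hompoly_xy_minus hompoly_xy_sum hompoly_xy_mult[OF Suc.prems(3) b(1)]) simp
      then show ?thesis using True by (simp add: c_def[abs_def])
    next
      case False
      have "hompoly_xy (u m + w p + D - w j) (\<lambda>v. M m p v * b j v)"
        by (rule hompoly_xy_mult[OF Suc.prems(3) b(1)]) simp
      then show ?thesis using False by (simp add: c_def[abs_def])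
    qed
    obtain j1 v1 where j1: "j1 \<in> J - {p}" "b j1 v1 \<noteq> 0" using b(2) by blast
    have nz: "\<exists>v. c j1 v \<noteq> 0"
    proof (rule ccontr)
      assume "\<not> ?thesis"
      then have "b j1 v * M m p v = 0" for v using j1(1) by (auto simp: c_def mult.commute)
      then have "b j1 v1 = 0"
        by (rule polyfun_domain[rotated 2])
           (use p(2) hompoly_polyfun[OF hompoly_xyD(1)[OF b(1)]] hompoly_polyfun[OF hompoly_xyD(1)[OF Suc.prems(3)]] in auto)
      then show False using j1 by simp
    qed
    have "(\<Sum>j\<in>J. M i j v * c j v) = 0" if "i < Suc m" for i v
    proof -
      have "(\<Sum>j\<in>J. M i j v * c j v) = M i p v * c p v + (\<Sum>j\<in>J - {p}. M i j v * c j v)"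
        using Suc.prems(1) p(1) by (rule sum.remove)
      also have "M i p v * c p v = (\<Sum>j\<in>J - {p}. - (M i p v * M m j v * b j v))"
        by (simp add: c_def sum_distrib_left sum_negf mult.assoc)
      also have "(\<Sum>j\<in>J - {p}. M i j v * c j v) = (\<Sum>j\<in>J - {p}. M m p v * M i j v * b j v)"
        by (intro sum.cong) (auto simp: c_def)
      also have "(\<Sum>j\<in>J - {p}. - (M i p v * M m j v * b j v)) + \<dots> = (\<Sum>j\<in>J - {p}. M' i j v * b j v)"
        unfolding sum.distrib[symmetric] by (intro sum.cong) (simp_all add: M'_def left_diff_distrib)
      also have "\<dots> = 0"
      proof (cases "i = m")
        case True
        then show ?thesis by (simp add: M'_def)
      qed (use that b(3) in auto)
      finally show ?thesis .
    qed
    then show ?thesis using hc j1(1) nz by (intro exI[of _ c] exI[of _ "u m + w p + D"]) auto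
  qed
qed


lemma hompoly_xy_quotient:
  assumes "hompoly_xy k b" "polyfun c" "\<And>v. b v = linear_form \<alpha> v * c v" "\<alpha> \<noteq> 0" "linear_form \<alpha> (axis 3 1) = 0"
  shows "hompoly_xy (k - 1) c"
proof -
  obtain u where u: "linear_form \<alpha> u = 1" by (rule linear_form_nonzero[OF assms(4)])
  have e: "b = (\<lambda>v. linear_form \<alpha> v * c v)" using assms(3) by auto
  have "hompoly (k - 1) c"
    by (rule hompoly_quotient[where A = "linear_form \<alpha>" and ?v0.0 = u]) (use hompoly_xyD(1)[OF assms(1)] e assms(2) u in auto)
  moreover have "c (v + t *s axis 3 1) = c v" for v t
  proof -
    have "c (v + t *s axis 3 1) - c v = 0"
    proof (rule polyfun_domain[where Q = "linear_form \<alpha>" and ?v0.0 = u and P = "\<lambda>v. c (v + t *s axis 3 1) - c v"])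
      show "polyfun (\<lambda>v. c (v + t *s axis 3 1) - c v)"
        by (intro polyfun_diff polyfun_compose_affine[OF assms(2)] assms(2)) simp
      show "(c (v + t *s axis 3 1) - c v) * linear_form \<alpha> v = 0" for v
        using hompoly_xyD(2)[OF assms(1), of v t] assms(5) unfolding assms(3) by (simp add: algebra_simps)
    qed (use u in auto)
    then show ?thesis by simp
  qed
  ultimately show ?thesis by (simp add: hompoly_xy_def)
qed

text \<open>
  Reducing the multiples \<open>z\<^sup>j s\<close>, \<open>j < n\<close>, modulo \<open>r\<close> gives \<open>n\<close> remainders with \<open>n\<close> coefficients each. Killing the
  \<open>n - 1\<close> coefficients of positive powers of \<open>z\<close> is an underdetermined system, so that there is a relation
  \<open>B r + b s = N\<close> with \<open>b \<noteq> 0\<close> of degree less than \<open>n\<close> in \<open>z\<close> and with \<open>N\<close> a form in \<open>x, y\<close> alone.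
  Suppose that \<open>r\<close> and \<open>s\<close> have no common zero. On a line parallel to the \<open>z\<close>-axis, but not the axis
  itself, \<open>r\<close> and \<open>s\<close> have no common root; if \<open>N\<close> vanishes there, \<open>r\<close> divides \<open>b\<close>, which forces \<open>b = 0\<close>. Hence \<open>N \<noteq> 0\<close>; and a linear factor
  of \<open>N\<close> divides \<open>b\<close> and \<open>B\<close> as well and can be cancelled. In the end \<open>N\<close> is a nonzero constant, although
  the left hand side vanishes at the origin.
\<close>

lemma no_common_zero_on_axis:
  assumes r: "hompoly (int n) r" and s: "hompoly (int k) s"
    and nz: "r (axis 3 1) \<noteq> 0" "s (axis 3 1) \<noteq> 0"
    and pos: "0 < n" "0 < k"
  shows "\<exists>v. v \<noteq> 0 \<and> r v = 0 \<and> s v = 0"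
proof (rule ccontr)
  assume "\<not> ?thesis"
  then have no_zero: "r v \<noteq> 0 \<or> s v \<noteq> 0" if "v \<noteq> 0" for v using that by blast
  have r0: "r 0 = 0" "s 0 = 0" using hompoly_at_zero[OF r] hompoly_at_zero[OF s] pos by auto
  \<comment> \<open>away from the last axis, a relation with small degree in the last variable is trivial\<close>
  have trivial: "b j v = 0"
    if rel: "\<And>t. A (v + t *s axis 3 1) * r (v + t *s axis 3 1)
        + (\<Sum>j<n. b j (v + t *s axis 3 1) * (v + t *s axis 3 1) $ 3 ^ j) * s (v + t *s axis 3 1) = 0"
      and A: "polyfun A" and b: "\<And>j. hompoly_xy (D - int j) (b j)" and j: "j < n"
      and v: "v $ 1 \<noteq> 0 \<or> v $ 2 \<noteq> 0" for A b D v j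
  proof -
    define w where "w = v + (- v $ 3) *s axis 3 1"
    have wc: "w $ 1 = v $ 1" "w $ 2 = v $ 2" "w $ 3 = 0" by (simp_all add: w_def)
    have w0: "w + t *s axis 3 1 \<noteq> 0" for t
    proof
      assume "w + t *s axis 3 1 = 0"
      then have "(w + t *s axis 3 1) $ i = 0" for i by simp
      from this[of 1] this[of 2] show False using v wc by simp
    qed
    have bw: "b j (w + t *s axis 3 1) = b j v" for j t
      using hompoly_xyD(2)[OF b[of j], of v "t - v $ 3"] by (simp add: w_def algebra_simps)
    obtain \<rho> where \<rho>: "\<And>t. r (w + t *s axis 3 1) = poly \<rho> t" "degree \<rho> \<le> n" "coeff \<rho> n = r (axis 3 1)"
      by (rule hompoly_on_line[OF r, where a = w and b = "axis 3 1"]) (rule that)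
    obtain \<sigma> where \<sigma>: "\<And>t. s (w + t *s axis 3 1) = poly \<sigma> t"
      using polyfun_on_line[OF hompoly_polyfun[OF s]] by blast
    obtain a where a: "\<And>t. A (w + t *s axis 3 1) = poly a t" using polyfun_on_line[OF A] by blast
    define \<beta> where "\<beta> = (\<Sum>j<n. monom (b j v) j)"
    have "poly (a * \<rho> + \<beta> * \<sigma>) t = 0" for t
    proof -
      have "v + (t - v $ 3) *s axis 3 1 = w + t *s axis 3 1" by (simp add: w_def algebra_simps)
      then have "A (w + t *s axis 3 1) * r (w + t *s axis 3 1)
        + (\<Sum>j<n. b j (w + t *s axis 3 1) * (w + t *s axis 3 1) $ 3 ^ j) * s (w + t *s axis 3 1) = 0"
        using rel[of "t - v $ 3"] by (simp only:)
      then show ?thesis unfolding bw \<rho> \<sigma> a by (simp add: \<beta>_def poly_sum poly_monom wc)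
    qed
    then have "a * \<rho> + \<beta> * \<sigma> = 0" using poly_all_0_iff_0 by blast
    then have "\<beta> * \<sigma> = \<rho> * (- a)" by (simp add: eq_neg_iff_add_eq_0 mult.commute add.commute)
    then have "\<rho> dvd \<beta> * \<sigma>" by simp
    moreover have "\<rho> \<noteq> 0" using \<rho>(3) nz(1) by auto
    moreover have "poly \<rho> t = 0 \<Longrightarrow> poly \<sigma> t \<noteq> 0" for t using no_zero[OF w0[of t]] \<rho>(1) \<sigma> by auto
    ultimately have "\<rho> dvd \<beta>" using dvd_mult_no_common_root by blast
    moreover have "degree \<rho> = n" using \<rho>(2,3) nz(1) by (metis le_antisym le_degree)
    moreover have "degree \<beta> < n"
    proof -
      have "degree \<beta> \<le> n - 1" unfolding \<beta>_def
        by (rule degree_sum_le) (auto intro: order_trans[OF degree_monom_le])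
      then show ?thesis using pos(1) by simp
    qed
    ultimately have "\<beta> = 0" using dvd_imp_degree_le by fastforce
    then have "coeff \<beta> j = 0" by simp
    moreover have "coeff \<beta> j = (\<Sum>i<n. if i = j then b j v else 0)"
      unfolding \<beta>_def coeff_sum by (intro sum.cong) auto
    ultimately show ?thesis using j by simp
  qed
  \<comment> \<open>remove the zeros of the right hand side one line at a time\<close>
  have descent: False
    if "polyfun A" "\<And>j. hompoly_xy (D - int j) (b j)" "hompoly_xy (int l) N" "N v1 \<noteq> 0"
      "\<And>v. A v * r v + (\<Sum>j<n. b j v * v $ 3 ^ j) * s v = N v" for l A b D N v1
    using that
  proof (induction l arbitrary: A b D N)
    case 0
    have N0: "N 0 = 0" using "0.prems"(5)[of 0] r0 by simp
    have "N 0 = N v1" using hompoly_0_constant[of N v1] hompoly_xyD(1)[OF "0.prems"(3)] by simp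
    then show ?case using N0 "0.prems"(4) by simp
  next
    case (Suc l)
    have hN: "hompoly (int (Suc l)) N" by (rule hompoly_xyD(1)[OF Suc.prems(3)])
    have "(\<exists>t. N (axis 1 1 + t *s axis 2 1) = 0) \<or> N (axis 2 1) = 0"
      by (rule hompoly_zero_on_line[OF hN]) simp
    then obtain z where z: "N z = 0" "z $ 3 = 0" "z $ 1 \<noteq> 0 \<or> z $ 2 \<noteq> 0"
    proof
      assume "\<exists>t. N (axis 1 1 + t *s axis 2 1) = 0"
      then obtain t where "N (axis 1 1 + t *s axis 2 1) = 0" ..
      then show ?thesis by (intro that[of "axis 1 1 + t *s axis 2 1"]) auto
    next
      assume "N (axis 2 1) = 0"
      then show ?thesis by (intro that[of "axis 2 1"]) auto
    qed
    define \<alpha> :: "complex^3" where "\<alpha> = vector [z $ 2, - z $ 1, 0]"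
    have lf: "linear_form \<alpha> v = z $ 2 * v $ 1 - z $ 1 * v $ 2" for v
      by (simp add: linear_form_def \<alpha>_def sum_3)
    have \<alpha>0: "\<alpha> \<noteq> 0" using z(3) by (auto simp: \<alpha>_def vec_eq_iff forall_3)
    have \<alpha>3: "linear_form \<alpha> (axis 3 1) = 0" by (simp add: lf)
    have \<alpha>z: "linear_form \<alpha> z = 0" by (simp add: lf)
    have N_ker: "N v = 0" if v: "linear_form \<alpha> v = 0" for v
    proof -
      obtain c where c: "v $ 1 = c * z $ 1" "v $ 2 = c * z $ 2"
      proof (cases "z $ 1 = 0")
        case True
        then have "z $ 2 \<noteq> 0" using z(3) by simp
        then show ?thesis using v True by (intro that[of "v $ 2 / z $ 2"]) (auto simp: lf)
      next
        case False
        then show ?thesis using v by (intro that[of "v $ 1 / z $ 1"]) (auto simp: lf field_simps)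
      qed
      have e: "v = c *s z + v $ 3 *s axis 3 1" using c z(2) by (simp add: vec_eq_iff forall_3)
      have "N v = N (c *s z)" using hompoly_xyD(2)[OF Suc.prems(3), of "c *s z" "v $ 3"] e by simp
      also have "\<dots> = 0"
        using hompoly_scale[OF hN, of c z] z(1) hompoly_at_zero[OF hN] by (cases "c = 0") auto
      finally show ?thesis .
    qed
    have b_ker: "b j v = 0" if v: "linear_form \<alpha> v = 0" and j: "j < n" for j v
    proof -
      have main: "b j v = 0" if v: "linear_form \<alpha> v = 0" and "v $ 1 \<noteq> 0 \<or> v $ 2 \<noteq> 0" for v
      proof (rule trivial[OF _ Suc.prems(1,2) j that(2)])
        fix t
        have "N (v + t *s axis 3 1) = 0" using v \<alpha>3 by (intro N_ker) simp
        then show "A (v + t *s axis 3 1) * r (v + t *s axis 3 1)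
          + (\<Sum>j<n. b j (v + t *s axis 3 1) * (v + t *s axis 3 1) $ 3 ^ j) * s (v + t *s axis 3 1) = 0"
          unfolding Suc.prems(5) .
      qed
      obtain i where i: "i = 1 \<or> i = 2" "z $ i \<noteq> 0" using z(3) by blast
      show ?thesis
      proof (rule polyfun_domain_plane[of "b j" "\<lambda>v. v $ i" \<alpha> z])
        show "b j v * v $ i = 0" if "linear_form \<alpha> v = 0" for v
          using main[OF that] i(1) by auto
      qed (use i v \<alpha>z hompoly_polyfun[OF hompoly_xyD(1)[OF Suc.prems(2)]] in auto)
    qed
    have A_ker: "A v = 0" if v: "linear_form \<alpha> v = 0" for v
    proof (rule polyfun_domain_plane[of A r \<alpha> "axis 3 1"])
      show "A v * r v = 0" if "linear_form \<alpha> v = 0" for v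
        using Suc.prems(5)[of v] N_ker[OF that] b_ker[OF that] by simp
    qed (use Suc.prems(1) hompoly_polyfun[OF r] \<alpha>3 nz v in auto)
    obtain A' where A': "polyfun A'" "\<And>v. A v = linear_form \<alpha> v * A' v"
      using polyfun_divide[OF Suc.prems(1) \<alpha>0 A_ker] by blast
    obtain N' where N': "polyfun N'" "\<And>v. N v = linear_form \<alpha> v * N' v"
      using polyfun_divide[OF hompoly_polyfun[OF hN] \<alpha>0 N_ker] by blast
    have "\<exists>c. hompoly_xy (D - 1 - int j) c \<and> (j < n \<longrightarrow> (\<forall>v. b j v = linear_form \<alpha> v * c v))" for j
    proof (cases "j < n")
      case True
      obtain c where c: "polyfun c" "\<And>v. b j v = linear_form \<alpha> v * c v"
        using polyfun_divide[OF hompoly_polyfun[OF hompoly_xyD(1)[OF Suc.prems(2)]] \<alpha>0 b_ker[OF _ True]] by blast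
      have "hompoly_xy (D - int j - 1) c" by (rule hompoly_xy_quotient[OF Suc.prems(2) c \<alpha>0 \<alpha>3])
      then show ?thesis using c(2) by (auto simp: algebra_simps)
    qed (use hompoly_xy_zero in blast)
    then obtain b' where b': "\<And>j. hompoly_xy (D - 1 - int j) (b' j)" "\<And>j v. j < n \<Longrightarrow> b j v = linear_form \<alpha> v * b' j v"
      by metis
    have hN': "hompoly_xy (int l) N'" using hompoly_xy_quotient[OF Suc.prems(3) N' \<alpha>0 \<alpha>3] by simp
    have N'1: "N' v1 \<noteq> 0" using N'(2)[of v1] Suc.prems(4) by auto
    show ?case
    proof (rule Suc.IH[OF A'(1) b'(1) hN' N'1])
      fix v
      obtain u where u: "linear_form \<alpha> u = 1" by (rule linear_form_nonzero[OF \<alpha>0])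
      have "(A' v * r v + (\<Sum>j<n. b' j v * v $ 3 ^ j) * s v) - N' v = 0"
      proof (rule polyfun_domain[where Q = "linear_form \<alpha>" and ?v0.0 = u and P = "\<lambda>v. (A' v * r v + (\<Sum>j<n. b' j v * v $ 3 ^ j) * s v) - N' v"])
        show "polyfun (\<lambda>v. (A' v * r v + (\<Sum>j<n. b' j v * v $ 3 ^ j) * s v) - N' v)"
          by (intro polyfun_diff polyfun_add polyfun_mult polyfun_sum polyfun_power polyfun_coord A'(1) N'(1)
              hompoly_polyfun[OF r] hompoly_polyfun[OF s] hompoly_polyfun[OF hompoly_xyD(1)[OF b'(1)]])
        fix v
        have "(\<Sum>j<n. b j v * v $ 3 ^ j) = linear_form \<alpha> v * (\<Sum>j<n. b' j v * v $ 3 ^ j)"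
          unfolding sum_distrib_left by (intro sum.cong) (auto simp: b'(2))
        then show "((A' v * r v + (\<Sum>j<n. b' j v * v $ 3 ^ j) * s v) - N' v) * linear_form \<alpha> v = 0"
          using Suc.prems(5)[of v] unfolding A'(2) N'(2) by (simp add: algebra_simps)
      qed (use u in auto)
      then show "A' v * r v + (\<Sum>j<n. b' j v * v $ 3 ^ j) * s v = N' v" by simp
    qed
  qed
  \<comment> \<open>the remainders of the multiples of \<open>s\<close> provide a relation\<close>
  obtain \<sigma> where \<sigma>: "\<And>l. hompoly_xy (int k - int l) (\<sigma> l)" "\<And>v. s v = (\<Sum>l<Suc k. \<sigma> l v * v $ 3 ^ l)"
    by (rule hompoly_expand[OF s]) (rule that)
  have "\<forall>j. \<exists>A m. polyfun A \<and> (\<forall>l. hompoly_xy (int k + int j - int l) (m l)) \<and>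
     (\<forall>v. v $ 3 ^ j * s v = A v * r v + (\<Sum>l<n. m l v * v $ 3 ^ l))"
  proof
    fix j
    define p where "p l = (if j \<le> l then \<sigma> (l - j) else (\<lambda>v. 0))" for l
    have p: "hompoly_xy (int k + int j - int l) (p l)" for l
      using \<sigma>(1)[of "l - j"] by (auto simp: p_def hompoly_xy_zero of_nat_diff algebra_simps)
    have "v $ 3 ^ j * s v = (\<Sum>l<Suc k + j. p l v * v $ 3 ^ l)" for v
    proof -
      have "(\<Sum>l<Suc k + j. p l v * v $ 3 ^ l) = (\<Sum>l\<in>{j..<Suc k + j}. \<sigma> (l - j) v * v $ 3 ^ l)"
        by (rule sum.mono_neutral_cong_right) (auto simp: p_def)
      also have "\<dots> = (\<Sum>l<Suc k. \<sigma> l v * v $ 3 ^ (l + j))"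
        by (rule sum.reindex_bij_witness[of _ "\<lambda>l. l + j" "\<lambda>l. l - j"]) auto
      finally show ?thesis unfolding \<sigma>(2) sum_distrib_left by (simp only: power_add mult_ac)
    qed
    then show "\<exists>A m. polyfun A \<and> (\<forall>l. hompoly_xy (int k + int j - int l) (m l)) \<and>
       (\<forall>v. v $ 3 ^ j * s v = A v * r v + (\<Sum>l<n. m l v * v $ 3 ^ l))"
      using hompoly_remainder[OF r nz(1) p, of "Suc k + j"] by simp
  qed
  then obtain A m where Am: "\<And>j. polyfun (A j)" "\<And>j l. hompoly_xy (int k + int j - int l) (m j l)"
     "\<And>j v. v $ 3 ^ j * s v = A j v * r v + (\<Sum>l<n. m j l v * v $ 3 ^ l)" unfolding choice_iff by blast
  have "\<exists>b D. (\<forall>j. hompoly_xy (D - int j) (b j)) \<and> (\<exists>j\<in>{..<n}. \<exists>v. b j v \<noteq> 0) \<and>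
     (\<forall>i<n - 1. \<forall>v. (\<Sum>j\<in>{..<n}. m j (Suc i) v * b j v) = 0)"
  proof (rule underdetermined_homogeneous_system[of "{..<n}" "n - 1" "\<lambda>i. int k - int (Suc i)" int "\<lambda>i j. m j (Suc i)"])
    show "hompoly_xy (int k - int (Suc i) + int j) (m j (Suc i))" for i j
      using Am(2)[of j "Suc i"] by (simp add: algebra_simps)
  qed (use pos in auto)
  then obtain b D where b: "\<And>j. hompoly_xy (D - int j) (b j)" "\<exists>j\<in>{..<n}. \<exists>v. b j v \<noteq> 0"
     "\<And>i v. i < n - 1 \<Longrightarrow> (\<Sum>j\<in>{..<n}. m j (Suc i) v * b j v) = 0" by blast
  define N where "N v = (\<Sum>j<n. m j 0 v * b j v)" for v
  define B where "B v = - (\<Sum>j<n. A j v * b j v)" for v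
  have hN: "hompoly_xy (int k + D) N" unfolding N_def[abs_def]
    by (intro hompoly_xy_sum hompoly_xy_mult[OF Am(2) b(1)]) simp
  have pB: "polyfun B" unfolding B_def[abs_def]
    by (intro polyfun_minus polyfun_sum polyfun_mult Am(1) hompoly_polyfun[OF hompoly_xyD(1)[OF b(1)]])
  have rel: "B v * r v + (\<Sum>j<n. b j v * v $ 3 ^ j) * s v = N v" for v
  proof -
    have "(\<Sum>j<n. b j v * v $ 3 ^ j) * s v = (\<Sum>j<n. b j v * (A j v * r v + (\<Sum>l<n. m j l v * v $ 3 ^ l)))"
      unfolding sum_distrib_right Am(3)[symmetric] by (simp only: mult.assoc)
    also have "\<dots> = (\<Sum>j<n. A j v * b j v) * r v + (\<Sum>j<n. \<Sum>l<n. m j l v * b j v * v $ 3 ^ l)"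
      by (simp add: sum.distrib sum_distrib_left sum_distrib_right distrib_left mult_ac)
    also have "(\<Sum>j<n. \<Sum>l<n. m j l v * b j v * v $ 3 ^ l) = (\<Sum>l<n. (\<Sum>j<n. m j l v * b j v) * v $ 3 ^ l)"
      unfolding sum_distrib_right by (rule sum.swap)
    also have "\<dots> = (\<Sum>l<n. if l = 0 then N v else 0)"
    proof (intro sum.cong refl)
      fix l assume l: "l \<in> {..<n}"
      show "(\<Sum>j<n. m j l v * b j v) * v $ 3 ^ l = (if l = 0 then N v else 0)"
      proof (cases l)
        case (Suc i)
        then show ?thesis using b(3)[of i v] l by simp
      qed (simp add: N_def)
    qed
    also have "\<dots> = N v" using pos(1) by simp
    finally show ?thesis by (simp add: B_def)
  qed
  have "\<exists>v1. N v1 \<noteq> 0"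
  proof (rule ccontr)
    assume "\<not> ?thesis"
    then have N0: "N v = 0" for v by simp
    have "b j v = 0" if j: "j < n" for j v
    proof (rule polyfun_domain[where Q = "\<lambda>v. v $ 1" and ?v0.0 = "axis 1 1"])
      show "polyfun (b j)" by (rule hompoly_polyfun[OF hompoly_xyD(1)[OF b(1)]])
      fix v
      show "b j v * v $ 1 = 0"
      proof (cases "v $ 1 = 0")
        case False
        then have "b j v = 0" by (intro trivial[OF _ pB b(1) j] disjI1) (simp_all only: rel N0 simp_thms)
        then show ?thesis by simp
      qed simp
    qed auto
    then show False using b(2) by blast
  qed
  then obtain v1 where v1: "N v1 \<noteq> 0" ..
  then have "int k + D \<ge> 0" using hompoly_neg[OF hompoly_xyD(1)[OF hN], of v1] by force
  then have hN': "hompoly_xy (int (nat (int k + D))) N" using hN by simp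
  show False by (rule descent[OF pB b(1) hN' v1 rel])
qed


text \<open>
  If both forms are nonzero, some point avoids both curves, and a linear change of coordinates moves it to
  \<open>(0, 0, 1)\<close>. If one form is zero, a zero of the other on an arbitrary line will do.
\<close>

theorem plane_curves_meet:
  assumes r: "hompoly n r" "0 < n" and s: "hompoly k s" "0 < k"
  shows "\<exists>v. v \<noteq> 0 \<and> r v = 0 \<and> s v = 0"
proof -
  have zero: "\<exists>v. v \<noteq> 0 \<and> p v = 0" if "hompoly m p" "0 < m" for m p
  proof -
    have "axis 1 1 + t *s axis 2 1 \<noteq> (0 :: complex^3)" for t
    proof
      assume "axis 1 1 + t *s axis 2 1 = (0 :: complex^3)"
      then have "(axis 1 1 + t *s axis 2 1 :: complex^3) $ 1 = 0" by simp
      then show False by simp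
    qed
    moreover have "axis 2 1 \<noteq> (0 :: complex^3)" by (metis axis_1_coords(5) zero_index zero_neq_one)
    ultimately show ?thesis using hompoly_zero_on_line[OF that, of "axis 1 1" "axis 2 1"] by blast
  qed
  show ?thesis
  proof (cases "\<forall>v. r v * s v = 0")
    case True
    show ?thesis
    proof (cases "\<exists>v. s v \<noteq> 0")
      case True': True
      then obtain v0 where "s v0 \<noteq> 0" ..
      then have "r v = 0" for v
        using polyfun_domain[OF hompoly_polyfun[OF r(1)] hompoly_polyfun[OF s(1)]] True by blast
      then show ?thesis using zero[OF s] by auto
    qed (use zero[OF r] in auto)
  next
    case False
    then obtain q where q: "r q \<noteq> 0" "s q \<noteq> 0" by auto
    then have "q \<noteq> 0" using hompoly_at_zero[OF r] by auto
    then obtain i where i: "q $ i \<noteq> 0" by (auto simp: vec_eq_iff)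
    obtain j l :: 3 where jl: "j \<noteq> i" "l \<noteq> i" "j \<noteq> l"
    proof -
      have "i = 1 \<or> i = 2 \<or> i = 3" by (rule exhaust_3)
      then show ?thesis by (elim disjE) (auto intro: that[of 2 3] that[of 1 3] that[of 1 2])
    qed
    define L where "L v = v $ 1 *s axis j 1 + v $ 2 *s axis l 1 + v $ 3 *s q" for v :: "complex^3"
    have Lcomp: "hompoly m (\<lambda>v. p (L v))" if "hompoly m p" for m p
    proof -
      have "L (t *s v) = t *s L v" for t v by (simp add: L_def vector_add_ldistrib)
      moreover have "polyfun (\<lambda>v. p (L v))"
        by (rule polyfun_compose_affine[OF hompoly_polyfun[OF that]]) (simp add: L_def)
      ultimately show ?thesis using that by (simp add: hompoly_def)
    qed
    have L3: "L (axis 3 1) = q" by (simp add: L_def)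
    have "\<exists>v. v \<noteq> 0 \<and> r (L v) = 0 \<and> s (L v) = 0"
      by (rule no_common_zero_on_axis[of "nat n" "\<lambda>v. r (L v)" "nat k" "\<lambda>v. s (L v)"])
         (use Lcomp r s q L3 in auto)
    then obtain v where v: "v \<noteq> 0" "r (L v) = 0" "s (L v) = 0" by blast
    have "L v \<noteq> 0"
    proof
      assume "L v = 0"
      then have c: "L v $ m = 0" for m by simp
      have v3: "v $ 3 = 0" using c[of i] i jl by (simp add: L_def axis_def)
      have "v $ 1 = 0" using c[of j] v3 jl by (simp add: L_def axis_def)
      moreover have "v $ 2 = 0" using c[of l] v3 jl by (simp add: L_def axis_def)
      ultimately show False using v(1) v3 by (simp add: vec_eq_iff forall_3)
    qed
    then show ?thesis using v by blast
  qed
qed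

section \<open>A free basis from independent local generators\<close>

text \<open>
  Independence over graded polynomials; after clearing denominators this is independence over sections.
\<close>

definition independent_fields :: "('m::finite \<Rightarrow> int) \<Rightarrow> ('m \<Rightarrow> complex^3 \<Rightarrow> complex^3) \<Rightarrow> bool" where
  "independent_fields \<kappa> \<eta> \<longleftrightarrow> (\<forall>m B. (\<forall>j. hompoly (m - \<kappa> j) (B j)) \<and> (\<forall>w. (\<Sum>j\<in>UNIV. B j w *s \<eta> j w) = 0) \<longrightarrow>
     (\<forall>j w. B j w = 0))"

lemma independent_fieldsD:
  assumes "independent_fields \<kappa> \<eta>" "\<And>j. hompoly (m - \<kappa> j) (B j)" "\<And>w. (\<Sum>j\<in>UNIV. B j w *s \<eta> j w) = 0"
  shows "B j w = 0"
  using assms unfolding independent_fields_def by blast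

lemma independent_fieldsD':
  assumes ind: "independent_fields \<kappa> \<eta>" and B: "\<And>j. hompoly (m - \<kappa> j) (B j)"
    and \<eta>: "\<And>j. hom_field (\<kappa> j) (\<eta> j)"
    and Q: "polyfun Q" "Q v0 \<noteq> 0" and z: "\<And>w. Q w \<noteq> 0 \<Longrightarrow> (\<Sum>j\<in>UNIV. B j w *s \<eta> j w) = 0"
  shows "B j w = 0"
proof (rule independent_fieldsD[OF ind B])
  fix w
  have "(\<Sum>j\<in>UNIV. B j w *s \<eta> j w) $ l = 0" for l
  proof (rule polyfun_zero_off_zeros[of "\<lambda>w. (\<Sum>j\<in>UNIV. B j w *s \<eta> j w) $ l" Q v0])
    show "polyfun (\<lambda>w. (\<Sum>j\<in>UNIV. B j w *s \<eta> j w) $ l)"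
      unfolding sum_component vector_smult_component
      by (intro polyfun_sum polyfun_mult hompoly_polyfun[OF B] hom_field_polyfun[OF \<eta>])
  qed (use Q z in auto)
  then show "(\<Sum>j\<in>UNIV. B j w *s \<eta> j w) = 0" by (simp add: vec_eq_iff)
qed

definition combination ::
    "('m::finite \<Rightarrow> complex^3 \<Rightarrow> complex^3) \<Rightarrow> ('m, 3) sheaf_map" where
  "combination \<eta> U s v = (if v \<in> cone U then \<Sum>j\<in>UNIV. s v $ j *s \<eta> j v else 0)"

text \<open>
  Linear combination with the fields \<open>\<eta> j\<close> maps the sum of line bundles to the bundle. The local
  coefficients of a section exist by assumption and are unique by independence, hence they glue. The
  inverse of a bijective homomorphism is a homomorphism.
\<close>

theorem sheaf_isomorphic_of_basis:
  fixes \<eta> :: "'m::finite \<Rightarrow> complex^3 \<Rightarrow> complex^3"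
  assumes fin: "finite \<A>" and \<eta>: "\<And>j. hom_field (\<kappa> j) (\<eta> j)" and kill: "\<And>j. killed_by_gradient \<A> (\<eta> j)"
    and ind: "independent_fields \<kappa> \<eta>" and gen: "locally_generates \<A> \<kappa> \<eta>"
  shows "sheaf_isomorphic (arrangement_bundle \<A>) (twist_sum (\<chi> j. - \<kappa> j))"
proof -
  define K :: "int^'m" where "K = (\<chi> j. - \<kappa> j)"
  let ?\<psi> = "combination \<eta>"
  have into: "?\<psi> U s \<in> arrangement_bundle \<A> U" if U: "zariski_open U" and s: "s \<in> twist_sum K U" for U s
  proof -
    have "(\<lambda>v. ?\<psi> U s v $ i) \<in> twist_sections 0 U" for i
    proof -
      have "(\<lambda>v. \<Sum>j\<in>UNIV. s v $ j * (if v \<in> cone U then \<eta> j v $ i else 0)) \<in> twist_sections 0 U"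
        by (intro twist_sections_sum[OF U] twist_sections_mult[OF U twist_sum_component[OF s] twist_sections_hompoly[OF hom_fieldD[OF \<eta>] U]])
           (simp add: K_def)
      moreover have "(\<lambda>v. ?\<psi> U s v $ i) = (\<lambda>v. \<Sum>j\<in>UNIV. s v $ j * (if v \<in> cone U then \<eta> j v $ i else 0))"
        by (auto simp: combination_def)
      ultimately show ?thesis by simp
    qed
    moreover have "gradient \<A> v (?\<psi> U s v) = 0" for v
      using kill by (simp add: combination_def gradient_sum gradient_scale killed_by_gradient_def)
    ultimately show ?thesis by (simp add: arrangement_bundle_iff twist_sum_def)
  qed
  have inj: "inj_on (?\<psi> U) (twist_sum K U)" if U: "zariski_open U" for U
  proof (rule inj_onI)
    fix s t assume s: "s \<in> twist_sum K U" and t: "t \<in> twist_sum K U" and e: "?\<psi> U s = ?\<psi> U t"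
    show "s = t"
    proof
      fix v show "s v = t v"
      proof (cases "v \<in> cone U")
        case True
        have reg: "regular_at (K $ j) U (\<lambda>v. s v $ j - t v $ j) v" for j
          by (intro regular_at_diff[OF U True] twist_section_regular[OF U _ True] twist_sum_component s t)
        obtain P Q n where PQ: "hompoly n Q" "0 < n" "\<And>j. hompoly (n + K $ j) (P j)" "Q v \<noteq> 0"
          "\<And>w. Q w \<noteq> 0 \<Longrightarrow> w \<in> cone U" "\<And>j w. Q w \<noteq> 0 \<Longrightarrow> s w $ j - t w $ j = P j w / Q w"
          by (rule common_denominator[of "\<lambda>j. K $ j" U "\<lambda>j w. s w $ j - t w $ j" v, OF reg]) (rule that)
        have "P j v = 0" for j
        proof (rule independent_fieldsD'[OF ind _ \<eta> hompoly_polyfun[OF PQ(1)] PQ(4)])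
          show "hompoly (n - \<kappa> j) (P j)" for j using PQ(3)[of j] by (simp add: K_def)
          fix w assume w: "Q w \<noteq> 0"
          have "(\<Sum>j\<in>UNIV. s w $ j *s \<eta> j w) - (\<Sum>j\<in>UNIV. t w $ j *s \<eta> j w) = 0"
            using fun_cong[OF e, of w] PQ(5)[OF w] by (simp add: combination_def)
          then have "(\<Sum>j\<in>UNIV. (s w $ j - t w $ j) *s \<eta> j w) = 0"
            by (simp add: sum_subtractf vec.scale_left_diff_distrib)
          then have "Q w *s (\<Sum>j\<in>UNIV. (s w $ j - t w $ j) *s \<eta> j w) = 0" by simp
          then show "(\<Sum>j\<in>UNIV. P j w *s \<eta> j w) = 0"
            using w by (simp add: vec.scale_sum_right PQ(6))
        qed
        then show ?thesis using PQ(6)[OF PQ(4)] by (simp add: vec_eq_iff)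
      next
        case False
        then show ?thesis using twist_sum_outside[OF s] twist_sum_outside[OF t] by simp
      qed
    qed
  qed
  have surj: "\<exists>s\<in>twist_sum K U. \<tau> = ?\<psi> U s" if U: "zariski_open U" and \<tau>: "\<tau> \<in> arrangement_bundle \<A> U" for U \<tau>
  proof -
    have "\<forall>v. \<exists>Q n B. v \<in> cone U \<longrightarrow> hompoly n Q \<and> 0 < n \<and> Q v \<noteq> 0 \<and> (\<forall>j. hompoly (n + K $ j) (B j)) \<and>
       (\<forall>w. Q w \<noteq> 0 \<longrightarrow> w \<in> cone U \<and> Q w *s \<tau> w = (\<Sum>j\<in>UNIV. B j w *s \<eta> j w))"
    proof
      fix v
      show "\<exists>Q n B. v \<in> cone U \<longrightarrow> hompoly n Q \<and> 0 < n \<and> Q v \<noteq> 0 \<and> (\<forall>j. hompoly (n + K $ j) (B j)) \<and>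
       (\<forall>w. Q w \<noteq> 0 \<longrightarrow> w \<in> cone U \<and> Q w *s \<tau> w = (\<Sum>j\<in>UNIV. B j w *s \<eta> j w))"
      proof (cases "v \<in> cone U")
        case v: True
        have \<tau>0: "\<tau> \<in> twist_sum 0 U" "\<And>w. gradient \<A> w (\<tau> w) = 0" using \<tau> by (auto simp: arrangement_bundle_iff)
        have reg: "regular_at 0 U (\<lambda>v. \<tau> v $ i) v" for i
          using twist_section_regular[OF U twist_sum_component[OF \<tau>0(1)] v] by simp
        obtain P Q n where PQ: "hompoly n Q" "0 < n" "\<And>i. hompoly (n + 0) (P i)" "Q v \<noteq> 0"
          "\<And>w. Q w \<noteq> 0 \<Longrightarrow> w \<in> cone U" "\<And>i w. Q w \<noteq> 0 \<Longrightarrow> \<tau> w $ i = P i w / Q w"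
          by (rule common_denominator[of "\<lambda>i. 0" U "\<lambda>i w. \<tau> w $ i" v, OF reg]) (rule that)
        define \<pi> :: "complex^3 \<Rightarrow> complex^3" where "\<pi> w = (\<chi> i. P i w)" for w
        have h\<pi>: "hom_field n \<pi>" using PQ(3) by (simp add: hom_field_def \<pi>_def)
        have \<pi>\<tau>: "\<pi> w = Q w *s \<tau> w" if "Q w \<noteq> 0" for w
          using PQ(6)[OF that] that by (simp add: vec_eq_iff \<pi>_def)
        have "gradient \<A> w (\<pi> w) = 0" for w
        proof (rule polyfun_zero_off_zeros[of "\<lambda>w. gradient \<A> w (\<pi> w)" Q v])
          show "polyfun (\<lambda>w. gradient \<A> w (\<pi> w))" by (rule polyfun_gradient[OF fin hom_field_polyfun[OF h\<pi>]])
          show "gradient \<A> w (\<pi> w) = 0" if "Q w \<noteq> 0" for w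
            using \<pi>\<tau>[OF that] \<tau>0(2) by (simp add: gradient_scale)
        qed (use PQ in auto)
        then have k\<pi>: "killed_by_gradient \<A> \<pi>" by (simp add: killed_by_gradient_def)
        have "v \<noteq> 0" using v by (simp add: cone_def)
        then have "\<exists>n' Q' B. hompoly n' Q' \<and> Q' v \<noteq> 0 \<and> (\<forall>j. hompoly (n' + n - \<kappa> j) (B j)) \<and>
            (\<forall>w. Q' w *s \<pi> w = (\<Sum>j\<in>UNIV. B j w *s \<eta> j w))"
          using gen h\<pi> k\<pi> by (simp add: locally_generates_def)
        then obtain n' Q' B where Q': "hompoly n' Q'" "Q' v \<noteq> 0" "\<And>j. hompoly (n' + n - \<kappa> j) (B j)"
          "\<And>w. Q' w *s \<pi> w = (\<Sum>j\<in>UNIV. B j w *s \<eta> j w)"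
          by blast
        have "n' \<ge> 0" using hompoly_neg[OF Q'(1)] Q'(2) by force
        show ?thesis
        proof (intro exI impI conjI allI)
          show "hompoly (n' + n) (\<lambda>w. Q' w * Q w)" by (rule hompoly_mult[OF Q'(1) PQ(1) refl])
          show "0 < n' + n" using \<open>n' \<ge> 0\<close> PQ(2) by simp
          show "hompoly (n' + n + K $ j) (B j)" for j using Q'(3)[of j] by (simp add: K_def)
          fix w assume "Q' w * Q w \<noteq> 0"
          then show "w \<in> cone U" "(Q' w * Q w) *s \<tau> w = (\<Sum>j\<in>UNIV. B j w *s \<eta> j w)"
            using PQ(5)[of w] \<pi>\<tau>[of w] Q'(4)[of w] by auto
        qed (use PQ(4) Q'(2) in auto)
      qed blast
    qed
    then obtain Q n B where QB: "\<And>v. v \<in> cone U \<Longrightarrow> hompoly (n v) (Q v)" "\<And>v. v \<in> cone U \<Longrightarrow> 0 < n v"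
      "\<And>v. v \<in> cone U \<Longrightarrow> Q v v \<noteq> 0" "\<And>v j. v \<in> cone U \<Longrightarrow> hompoly (n v + K $ j) (B v j)"
      "\<And>v w. v \<in> cone U \<Longrightarrow> Q v w \<noteq> 0 \<Longrightarrow> w \<in> cone U"
      "\<And>v w. v \<in> cone U \<Longrightarrow> Q v w \<noteq> 0 \<Longrightarrow> Q v w *s \<tau> w = (\<Sum>j\<in>UNIV. B v j w *s \<eta> j w)"
      unfolding choice_iff by blast
    define s where "s w = (if w \<in> cone U then \<chi> j. B w j w / Q w w else 0)" for w
    have s_eq: "s w $ j = B v j w / Q v w" if v: "v \<in> cone U" and w: "Q v w \<noteq> 0" for v w j
    proof -
      have wU: "w \<in> cone U" by (rule QB(5)[OF v w])
      have "B v j w * Q w w - B w j w * Q v w = 0"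
      proof (rule independent_fieldsD'[OF ind _ \<eta>, where B = "\<lambda>j x. B v j x * Q w x - B w j x * Q v x" and Q = "\<lambda>x. Q v x * Q w x"])
        show "hompoly (n v + n w - \<kappa> j) (\<lambda>x. B v j x * Q w x - B w j x * Q v x)" for j
          by (intro hompoly_diff hompoly_mult[OF QB(4)[OF v] QB(1)[OF wU]] hompoly_mult[OF QB(4)[OF wU] QB(1)[OF v]])
             (simp_all add: K_def)
        show "polyfun (\<lambda>x. Q v x * Q w x)"
          by (intro polyfun_mult hompoly_polyfun[OF QB(1)[OF v]] hompoly_polyfun[OF QB(1)[OF wU]])
        show "Q v w * Q w w \<noteq> 0" using w QB(3)[OF wU] by simp
        fix x assume x: "Q v x * Q w x \<noteq> 0"
        have "(\<Sum>j\<in>UNIV. (B v j x * Q w x - B w j x * Q v x) *s \<eta> j x)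
           = Q w x *s (\<Sum>j\<in>UNIV. B v j x *s \<eta> j x) - Q v x *s (\<Sum>j\<in>UNIV. B w j x *s \<eta> j x)"
          by (simp add: vec.scale_left_diff_distrib sum_subtractf vec.scale_sum_right mult.commute)
        also have "\<dots> = Q w x *s (Q v x *s \<tau> x) - Q v x *s (Q w x *s \<tau> x)"
          using QB(6)[OF v, of x] QB(6)[OF wU, of x] x by simp
        finally show "(\<Sum>j\<in>UNIV. (B v j x * Q w x - B w j x * Q v x) *s \<eta> j x) = 0"
          by (simp add: mult.commute)
      qed
      then show ?thesis using w wU QB(3)[OF wU] by (simp add: s_def field_simps)
    qed
    have "s \<in> twist_sum K U"
    proof -
      have "(\<lambda>v. s v $ j) \<in> twist_sections (K $ j) U" for j
        unfolding twist_sections_iff[OF U]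
      proof (intro conjI allI impI ballI)
        fix v assume v: "v \<in> cone U"
        show "regular_at (K $ j) U (\<lambda>v. s v $ j) v" unfolding regular_at_def
          using QB(1-5)[OF v] s_eq[OF v] by blast
      qed (simp add: s_def)
      then show ?thesis by (simp add: twist_sum_def)
    qed
    moreover have "\<tau> = ?\<psi> U s"
    proof
      fix v show "\<tau> v = ?\<psi> U s v"
      proof (cases "v \<in> cone U")
        case True
        have "Q v v *s (\<Sum>j\<in>UNIV. s v $ j *s \<eta> j v) = Q v v *s \<tau> v"
          using QB(3)[OF True] QB(6)[OF True QB(3)[OF True]] by (simp add: vec.scale_sum_right s_eq[OF True QB(3)[OF True]])
        then show ?thesis using QB(3)[OF True] True by (simp add: combination_def)
      next
        case False
        then show ?thesis using arrangement_bundle_outside[OF \<tau>] by (simp add: combination_def)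
      qed
    qed
    ultimately show ?thesis by blast
  qed
  have bij: "bij_betw (?\<psi> U) (twist_sum K U) (arrangement_bundle \<A> U)" if "zariski_open U" for U
    using inj[OF that] surj[OF that] into[OF that] by (auto simp: bij_betw_def)
  define \<phi> where "\<phi> U = the_inv_into (twist_sum K U) (?\<psi> U)" for U
  have \<phi>\<psi>: "\<phi> U (?\<psi> U s) = s" if "zariski_open U" "s \<in> twist_sum K U" for U s
    unfolding \<phi>_def by (rule the_inv_into_f_f[OF inj[OF that(1)] that(2)])
  have "sheaf_hom (arrangement_bundle \<A>) (twist_sum K) \<phi>"
    unfolding sheaf_hom_def
  proof (intro allI impI conjI ballI)
    fix U assume U: "zariski_open U"
    fix \<sigma> assume \<sigma>: "\<sigma> \<in> arrangement_bundle \<A> U"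
    then obtain s where s: "s \<in> twist_sum K U" "\<sigma> = ?\<psi> U s" using surj[OF U] by blast
    then show "\<phi> U \<sigma> \<in> twist_sum K U" using \<phi>\<psi>[OF U s(1)] by simp
    { fix \<tau> assume "\<tau> \<in> arrangement_bundle \<A> U"
      then obtain t where t: "t \<in> twist_sum K U" "\<tau> = ?\<psi> U t" using surj[OF U] by blast
      have "(\<lambda>v. \<sigma> v + \<tau> v) = ?\<psi> U (\<lambda>v. s v + t v)"
        by (auto simp: s t combination_def sum.distrib vec.scale_left_distrib)
      then show "\<phi> U (\<lambda>v. \<sigma> v + \<tau> v) = (\<lambda>v. \<phi> U \<sigma> v + \<phi> U \<tau> v)"
        using \<phi>\<psi>[OF U twist_sum_add[OF U s(1) t(1)]] \<phi>\<psi>[OF U s(1)] \<phi>\<psi>[OF U t(1)] s t by simp }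
    { fix g assume g: "g \<in> twist_sections 0 U"
      have "(\<lambda>v. g v *s \<sigma> v) = ?\<psi> U (\<lambda>v. g v *s s v)"
        by (auto simp: s combination_def vec.scale_sum_right)
      then show "\<phi> U (\<lambda>v. g v *s \<sigma> v) = (\<lambda>v. g v *s \<phi> U \<sigma> v)"
        using \<phi>\<psi>[OF U twist_sum_scale[OF U g s(1)]] \<phi>\<psi>[OF U s(1)] s by simp }
    { fix V assume V: "zariski_open V \<and> V \<subseteq> U"
      then have "cone V \<subseteq> cone U" by (auto simp: cone_def)
      then have "restrict_section V \<sigma> = ?\<psi> V (restrict_section V s)"
        by (intro ext) (auto simp: s combination_def restrict_section_def)
      then show "\<phi> V (restrict_section V \<sigma>) = restrict_section V (\<phi> U \<sigma>)"
        using \<phi>\<psi>[OF _ twist_sum_restrict[OF U _ _ s(1)]] \<phi>\<psi>[OF U s(1)] s V by simp }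
  qed
  moreover have "bij_betw (\<phi> U) (arrangement_bundle \<A> U) (twist_sum K U)" if "zariski_open U" for U
    unfolding \<phi>_def by (rule bij_betw_the_inv_into[OF bij[OF that]])
  ultimately show ?thesis unfolding sheaf_isomorphic_def K_def by blast
qed

section \<open>Vector fields tangent to an arrangement, restricted to a line\<close>

lemma defines_line_form_of:
  assumes "arrangement \<A>" "H \<in> \<A>" shows "defines_line (form_of H) H"
proof -
  have "\<exists>\<alpha>. defines_line \<alpha> H" using assms by (simp add: arrangement_def)
  then show ?thesis unfolding form_of_def by (rule someI_ex)
qed

lemma form_of_nonzero: "arrangement \<A> \<Longrightarrow> H \<in> \<A> \<Longrightarrow> form_of H \<noteq> 0"
  using defines_line_form_of by (auto simp: defines_line_def)

lemma span_mem_line: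
  assumes "arrangement \<A>" "H \<in> \<A>" "v \<noteq> 0"
  shows "vec.span {v} \<in> H \<longleftrightarrow> form H v = 0"
proof -
  have "H = {p \<in> proj_plane. \<forall>v\<in>p. form H v = 0}"
    using defines_line_form_of[OF assms(1,2)] by (simp add: defines_line_def)
  then have "vec.span {v} \<in> H \<longleftrightarrow> vec.span {v} \<in> proj_plane \<and> (\<forall>w\<in>vec.span {v}. form H w = 0)" by blast
  moreover have "vec.span {v} \<in> proj_plane" using assms(3) by (auto simp: proj_plane_def)
  moreover have "(\<forall>w\<in>vec.span {v}. form H w = 0) \<longleftrightarrow> form H v = 0"
    using vec.span_base[of v "{v}"] by (auto simp: mem_span_singleton)
  ultimately show ?thesis by blast
qed

text \<open>
  Otherwise the two forms would be proportional and define the same line.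
\<close>

lemma distinct_lines_forms:
  assumes arr: "arrangement \<A>" and H: "H \<in> \<A>" "H' \<in> \<A>" "H \<noteq> H'"
  shows "\<exists>v. form H v = 0 \<and> form H' v \<noteq> 0"
proof (rule ccontr)
  assume "\<not> ?thesis"
  then have sub: "form H v = 0 \<Longrightarrow> form H' v = 0" for v by blast
  obtain u where u: "form H u = 1" by (rule linear_form_nonzero[OF form_of_nonzero[OF arr H(1)]])
  have scal: "form H' v = form H v * form H' u" for v
    using sub[of "v - form H v *s u"] u by simp
  have "form H' u \<noteq> 0"
  proof
    assume "form H' u = 0"
    then have "form H' v = 0" for v using scal[of v] by simp
    moreover obtain u' where "form H' u' = 1" by (rule linear_form_nonzero[OF form_of_nonzero[OF arr H(2)]])
    ultimately show False by simp
  qed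
  then have iff: "form H v = 0 \<longleftrightarrow> form H' v = 0" for v using scal[of v] by simp
  have "p \<in> H \<longleftrightarrow> p \<in> H'" for p
  proof (cases "p \<in> proj_plane")
    case True
    then obtain v where "v \<noteq> 0" "p = vec.span {v}" by (auto simp: proj_plane_def)
    then show ?thesis using span_mem_line[OF arr H(1)] span_mem_line[OF arr H(2)] iff by simp
  next
    case False
    then show ?thesis using defines_line_form_of[OF arr H(1)] defines_line_form_of[OF arr H(2)]
      by (auto simp: defines_line_def)
  qed
  then show False using H(3) by blast
qed

lemma defining_poly_nonzero_on_line:
  assumes arr: "arrangement \<A>" and H: "H \<in> \<A>" and \<B>: "\<B> \<subseteq> \<A> - {H}"
  shows "\<exists>v. form H v = 0 \<and> defining_poly \<B> v \<noteq> 0"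
proof -
  have "finite \<A>" using arr by (simp add: arrangement_def)
  then have "finite \<B>" using \<B> finite_subset by blast
  then show ?thesis using \<B>
  proof (induction \<B> rule: finite_induct)
    case empty
    show ?case by (rule exI[of _ 0]) (simp add: defining_poly_def)
  next
    case (insert H' \<B>)
    then obtain v0 where v0: "form H v0 = 0" "defining_poly \<B> v0 \<noteq> 0" by auto
    obtain v1 where v1: "form H v1 = 0" "form H' v1 \<noteq> 0"
      using distinct_lines_forms[OF arr H, of H'] insert.prems by auto
    have e: "defining_poly (insert H' \<B>) v = form H' v * defining_poly \<B> v" for v
      using insert.hyps by (simp add: defining_poly_def)
    show ?case
    proof (rule ccontr)
      assume "\<not> ?thesis"
      then have "form H v = 0 \<Longrightarrow> form H' v * defining_poly \<B> v = 0" for v using e by auto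
      then have "form H' v1 = 0"
        using polyfun_domain_plane[of "form H'" "defining_poly \<B>" "form_of H" v0 v1] v0 v1(1)
          hompoly_polyfun[OF hompoly_defining_poly[OF insert.hyps(1)]] by simp
      then show False using v1(2) by simp
    qed
  qed
qed

text \<open>
  On the line \<open>H\<close> the Leibniz rule leaves \<open>\<alpha>\<^sub>H(\<theta>)\<close> times the product of the other forms, which does not vanish
  identically there.
\<close>

lemma tangent_to_line:
  assumes arr: "arrangement \<A>" and H: "H \<in> \<A>" and \<theta>: "hom_field m \<theta>" "killed_by_gradient \<A> \<theta>"
    and v: "form H v = 0"
  shows "form H (\<theta> v) = 0"
proof -
  have fin: "finite \<A>" using arr by (simp add: arrangement_def)
  obtain v0 where v0: "form H v0 = 0" "defining_poly (\<A> - {H}) v0 \<noteq> 0"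
    using defining_poly_nonzero_on_line[OF arr H subset_refl] by blast
  show ?thesis
  proof (rule polyfun_domain_plane[of "\<lambda>v. form H (\<theta> v)" "defining_poly (\<A> - {H})" "form_of H" v0])
    show "form H (\<theta> v) * defining_poly (\<A> - {H}) v = 0" if "form H v = 0" for v
      using \<theta>(2) gradient_remove[OF fin H, of v "\<theta> v"] that by (simp add: killed_by_gradient_def)
    show "polyfun (\<lambda>v. form H (\<theta> v))" by (rule hompoly_polyfun[OF hompoly_form_field[OF \<theta>(1)]])
    show "polyfun (defining_poly (\<A> - {H}))" using fin by (intro hompoly_polyfun[OF hompoly_defining_poly]) simp
  qed (use v v0 in auto)
qed

definition minor :: "3 \<Rightarrow> 3 \<Rightarrow> complex^3 \<Rightarrow> complex^3 \<Rightarrow> complex" where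
  "minor j k v w = v $ j * w $ k - v $ k * w $ j"

text \<open>
  On the plane over a line, the field is proportional to the position vector, that is, it induces the zero
  vector field on the projective line.
\<close>

definition radial_on :: "complex^3 \<Rightarrow> (complex^3 \<Rightarrow> complex^3) \<Rightarrow> bool" where
  "radial_on \<alpha> \<theta> \<longleftrightarrow> (\<forall>v. linear_form \<alpha> v = 0 \<longrightarrow> (\<forall>j k. minor j k v (\<theta> v) = 0))"

lemma minor_add: "minor j k v (w + w') = minor j k v w + minor j k v w'"
  by (simp add: minor_def algebra_simps)
lemma minor_diff: "minor j k v (w - w') = minor j k v w - minor j k v w'"
  by (simp add: minor_def algebra_simps)
lemma minor_scale: "minor j k v (c *s w) = c * minor j k v w"
  by (simp add: minor_def algebra_simps)
lemma minor_scale_left: "minor j k (c *s v) w = c * minor j k v w"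
  by (simp add: minor_def algebra_simps)
lemma minor_self [simp]: "minor j k v v = 0"
  by (simp add: minor_def)
lemma minor_swap: "minor k j v w = - minor j k v w"
  by (simp add: minor_def)
lemma minor_same [simp]: "minor j j v w = 0"
  by (simp add: minor_def)
lemma minor_zero [simp]: "minor j k v 0 = 0"
  by (simp add: minor_def)
lemma minor_sum: "minor j k v (\<Sum>i\<in>I. w i) = (\<Sum>i\<in>I. minor j k v (w i))"
  by (simp add: minor_def sum_distrib_left sum_subtractf)

lemma hompoly_minor:
  assumes "hom_field m \<theta>" shows "hompoly (m + 1) (\<lambda>v. minor j k v (\<theta> v))"
  unfolding minor_def
  by (intro hompoly_diff hompoly_mult[OF hompoly_coord hom_fieldD[OF assms]]) simp_all

text \<open>
  Coordinates on the plane \<open>linear_form \<alpha> v = 0\<close>: if \<open>\<alpha> $ i\<close> is nonzero, the other two coordinates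
  \<open>j\<close> and \<open>k\<close> determine the point.
\<close>

locale plane_chart =
  fixes \<alpha> :: "complex^3" and i j k :: 3
  assumes \<alpha>i: "\<alpha> $ i \<noteq> 0" and dist: "i \<noteq> j" "i \<noteq> k" "j \<noteq> k"
begin

lemma index_cases: "l = i \<or> l = j \<or> l = k"
proof -
  have "l = 1 \<or> l = 2 \<or> l = 3" "i = 1 \<or> i = 2 \<or> i = 3" "j = 1 \<or> j = 2 \<or> j = 3" "k = 1 \<or> k = 2 \<or> k = 3"
    by (rule exhaust_3)+
  then show ?thesis using dist by auto
qed

lemma UNIV_ijk: "(UNIV :: 3 set) = {i, j, k}" using index_cases by auto

lemma linear_form_ijk: "linear_form \<alpha> v = \<alpha> $ i * v $ i + \<alpha> $ j * v $ j + \<alpha> $ k * v $ k"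
  unfolding linear_form_def UNIV_ijk using dist by simp

lemma coord_i: "linear_form \<alpha> v = 0 \<Longrightarrow> v $ i = - (\<alpha> $ j * v $ j + \<alpha> $ k * v $ k) / \<alpha> $ i"
  using \<alpha>i by (simp add: linear_form_ijk field_simps add_eq_0_iff)

lemma plane_eqI:
  assumes "linear_form \<alpha> v = 0" "linear_form \<alpha> w = 0" "v $ j = w $ j" "v $ k = w $ k"
  shows "v = w"
proof -
  have "v $ i = w $ i" using coord_i[OF assms(1)] coord_i[OF assms(2)] assms(3,4) by simp
  then have "v $ l = w $ l" for l using index_cases[of l] assms(3,4) by auto
  then show ?thesis by (simp add: vec_eq_iff)
qed

lemma plane_minor:
  assumes "linear_form \<alpha> v = 0" "linear_form \<alpha> w = 0" "minor j k v w = 0"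
  shows "minor l m v w = 0"
proof -
  have jk: "v $ j * w $ k = v $ k * w $ j" using assms(3) by (simp add: minor_def)
  have ji: "minor j i v w = 0"
  proof -
    have "\<alpha> $ i * minor j i v w = v $ j * (\<alpha> $ i * w $ i) - (\<alpha> $ i * v $ i) * w $ j"
      by (simp add: minor_def algebra_simps)
    also have "\<alpha> $ i * w $ i = - (\<alpha> $ j * w $ j + \<alpha> $ k * w $ k)" using coord_i[OF assms(2)] \<alpha>i by simp
    also have "\<alpha> $ i * v $ i = - (\<alpha> $ j * v $ j + \<alpha> $ k * v $ k)" using coord_i[OF assms(1)] \<alpha>i by simp
    finally have "\<alpha> $ i * minor j i v w = \<alpha> $ k * (v $ k * w $ j - v $ j * w $ k)" by (simp add: algebra_simps)
    then show ?thesis using jk \<alpha>i by simp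
  qed
  have ki: "minor k i v w = 0"
  proof -
    have "\<alpha> $ i * minor k i v w = v $ k * (\<alpha> $ i * w $ i) - (\<alpha> $ i * v $ i) * w $ k"
      by (simp add: minor_def algebra_simps)
    also have "\<alpha> $ i * w $ i = - (\<alpha> $ j * w $ j + \<alpha> $ k * w $ k)" using coord_i[OF assms(2)] \<alpha>i by simp
    also have "\<alpha> $ i * v $ i = - (\<alpha> $ j * v $ j + \<alpha> $ k * v $ k)" using coord_i[OF assms(1)] \<alpha>i by simp
    finally have "\<alpha> $ i * minor k i v w = \<alpha> $ j * (v $ j * w $ k - v $ k * w $ j)" by (simp add: algebra_simps)
    then show ?thesis using jk \<alpha>i by simp
  qed
  show ?thesis
    using index_cases[of l] index_cases[of m] assms(3) ji ki minor_swap[of i j v w] minor_swap[of i k v w] minor_swap[of k j v w]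
    by auto
qed

lemma plane_span:
  assumes "linear_form \<alpha> v = 0" "linear_form \<alpha> w = 0" "minor j k v w \<noteq> 0" "linear_form \<alpha> z = 0"
  shows "z = (minor j k z w / minor j k v w) *s v + (minor j k v z / minor j k v w) *s w"
proof (rule plane_eqI)
  have *: "minor j k v w * z $ j = minor j k z w * v $ j + minor j k v z * w $ j"
    "minor j k v w * z $ k = minor j k z w * v $ k + minor j k v z * w $ k"
    by (simp_all add: minor_def algebra_simps)
  show "z $ j = ((minor j k z w / minor j k v w) *s v + (minor j k v z / minor j k v w) *s w) $ j"
    using assms(3) * by (simp add: field_simps)
  show "z $ k = ((minor j k z w / minor j k v w) *s v + (minor j k v z / minor j k v w) *s w) $ k"
    using assms(3) * by (simp add: field_simps)
qed (use assms in auto)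

definition lift :: "complex \<Rightarrow> complex \<Rightarrow> complex^3" where
  "lift y z = y *s axis j 1 + z *s axis k 1 - ((\<alpha> $ j * y + \<alpha> $ k * z) / \<alpha> $ i) *s axis i 1"

lemma lift_coords [simp]: "lift y z $ j = y" "lift y z $ k = z"
  using dist by (simp_all add: lift_def axis_def)

lemma lift_in_plane [simp]: "linear_form \<alpha> (lift y z) = 0"
  unfolding linear_form_ijk using dist \<alpha>i by (simp add: lift_def axis_def)

text \<open>
  On the plane, \<open>v $ k * \<theta> v $ j = v $ j * \<theta> v $ k\<close>, so the \<open>j\<close>-th coordinate of \<open>\<theta>\<close> vanishes where \<open>v $ j\<close> does
  and is a multiple \<open>v $ j * g v\<close>. The same \<open>g\<close> serves all coordinates, and \<open>\<theta> v - g v *s v\<close> is divisible by the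
  form \<open>\<alpha>\<close>. The auxiliary map \<open>\<pi>\<close> extends functions from the plane to the space.
\<close>

lemma radial_decomposition:
  assumes \<theta>: "hom_field m \<theta>" and rad: "radial_on \<alpha> \<theta>"
  shows "\<exists>g \<eta>. hompoly (m - 1) g \<and> hom_field (m - 1) \<eta> \<and> (\<forall>v. \<theta> v = linear_form \<alpha> v *s \<eta> v + g v *s v)"
proof -
  have \<alpha>0: "\<alpha> \<noteq> 0" using \<alpha>i by auto
  define \<pi> where "\<pi> v = lift (v $ j) (v $ k)" for v
  have \<pi>_pol: "polyfun (\<lambda>v. \<pi> v $ l)" for l
  proof -
    have "polyfun (\<lambda>v. (\<alpha> $ j * v $ j + \<alpha> $ k * v $ k) / \<alpha> $ i)"
      using polyfun_mult[OF polyfun_const[of "1 / \<alpha> $ i"], of "\<lambda>v. \<alpha> $ j * v $ j + \<alpha> $ k * v $ k"] by simp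
    then show ?thesis
      unfolding \<pi>_def lift_def vector_minus_component vector_add_component vector_smult_component
      by (intro polyfun_diff polyfun_add polyfun_mult polyfun_const polyfun_coord)
  qed
  have \<pi>_id: "\<pi> v = v" if "linear_form \<alpha> v = 0" for v
    by (rule plane_eqI) (use that in \<open>simp_all add: \<pi>_def\<close>)
  have \<pi>_scale: "\<pi> (t *s v) = t *s \<pi> v" for t v
    by (rule plane_eqI) (simp_all add: \<pi>_def)
  define N where "N v = \<theta> (\<pi> v) $ j" for v
  have hN: "hompoly m N" unfolding hompoly_def
  proof (intro conjI allI impI)
    show "polyfun N" unfolding N_def[abs_def] by (rule polyfun_compose_affine[OF hom_field_polyfun[OF \<theta>] \<pi>_pol])
    show "N (t *s v) = t powi m * N v" if "t \<noteq> 0" for t v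
      using hompoly_scale[OF hom_fieldD[OF \<theta>] that] by (simp add: N_def \<pi>_scale)
  qed
  have "N v = 0" if v: "linear_form (axis j 1) v = 0" for v
  proof (rule polyfun_domain_plane[of N "\<lambda>v. v $ k" "axis j 1" "axis k 1"])
    show "linear_form (axis j 1) (axis k 1) = 0" unfolding linear_form_axis using dist by (simp add: axis_def)
    show "axis k 1 $ k \<noteq> (0 :: complex)" by (simp add: axis_def)
    fix v assume "linear_form (axis j 1) v = 0"
    then have vj: "v $ j = 0" by (simp add: linear_form_axis)
    have "minor j k (\<pi> v) (\<theta> (\<pi> v)) = 0" using rad by (simp add: radial_on_def \<pi>_def)
    then show "N v * v $ k = 0" using vj by (simp add: minor_def N_def \<pi>_def mult.commute)
  qed (use v hN in auto)
  moreover have "axis j (1::complex) \<noteq> 0" by (metis axis_eq_0_iff zero_neq_one)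
  ultimately obtain g where g: "polyfun g" "\<And>v. N v = v $ j * g v"
    using polyfun_divide[OF hompoly_polyfun[OF hN], of "axis j 1"] by (auto simp: linear_form_axis)
  have N_eq: "N = (\<lambda>v. v $ j * g v)" using g(2) by auto
  have hg: "hompoly (m - 1) g"
    by (rule hompoly_quotient[where A = "\<lambda>v. v $ j" and ?v0.0 = "axis j 1"]) (use hN N_eq g(1) in auto)
  have on_plane: "\<theta> v $ l - g v * v $ l = 0" if v: "linear_form \<alpha> v = 0" for v l
  proof (rule polyfun_domain_plane[of "\<lambda>v. \<theta> v $ l - g v * v $ l" "\<lambda>v. v $ j" \<alpha> "lift 1 0"])
    fix v assume v: "linear_form \<alpha> v = 0"
    have "v $ j * \<theta> v $ l = v $ l * \<theta> v $ j" using rad v by (simp add: radial_on_def minor_def)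
    also have "\<theta> v $ j = v $ j * g v" using g(2)[of v] by (simp add: N_def \<pi>_id[OF v])
    finally show "(\<theta> v $ l - g v * v $ l) * v $ j = 0" by (simp add: algebra_simps)
  qed (use v g(1) hom_field_polyfun[OF \<theta>] in auto)
  have "\<exists>h. polyfun h \<and> (\<forall>v. \<theta> v $ l - g v * v $ l = linear_form \<alpha> v * h v)" for l
  proof -
    have pf: "polyfun (\<lambda>v. \<theta> v $ l - g v * v $ l)"
      by (intro polyfun_diff polyfun_mult polyfun_coord g(1) hom_field_polyfun[OF \<theta>])
    obtain h where "polyfun h" "\<And>v. \<theta> v $ l - g v * v $ l = linear_form \<alpha> v * h v"
      by (rule polyfun_divide[OF pf \<alpha>0 on_plane]) (assumption, rule that)
    then show ?thesis by blast
  qed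
  then obtain h where h: "\<And>l. polyfun (h l)" "\<And>l v. \<theta> v $ l - g v * v $ l = linear_form \<alpha> v * h l v" by metis
  obtain u where u: "linear_form \<alpha> u = 1" by (rule linear_form_nonzero[OF \<alpha>0])
  have hh: "hompoly (m - 1) (h l)" for l
  proof (rule hompoly_quotient[where A = "linear_form \<alpha>" and ?v0.0 = u])
    have "hompoly m (\<lambda>v. \<theta> v $ l - g v * v $ l)"
      by (rule hompoly_diff[OF hom_fieldD[OF \<theta>] hompoly_mult[OF hg hompoly_coord]]) simp
    then show "hompoly m (\<lambda>v. linear_form \<alpha> v * h l v)" by (simp add: h(2))
  qed (use u h in auto)
  show ?thesis
  proof (intro exI conjI allI)
    show "hompoly (m - 1) g" by (rule hg)
    show "hom_field (m - 1) (\<lambda>v. \<chi> l. h l v)" using hh by (simp add: hom_field_def)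
    show "\<theta> v = linear_form \<alpha> v *s (\<chi> l. h l v) + g v *s v" for v
      using h(2)[of v] by (simp add: vec_eq_iff algebra_simps)
  qed
qed

text \<open>The plane contains infinitely many lines through the origin, already among the \<open>lift 1 t\<close>.\<close>

lemma vector_off_finite_set_of_points:
  assumes "finite S"
  obtains e where "linear_form \<alpha> e = 0" "e \<noteq> 0" "vec.span {e} \<notin> S"
proof -
  have "inj (\<lambda>t. vec.span {lift 1 t})"
  proof (rule injI)
    fix s t assume "vec.span {lift 1 s} = vec.span {lift 1 t}"
    then have "lift 1 s \<in> vec.span {lift 1 t}" using vec.span_base by blast
    then obtain c where c: "lift 1 s = c *s lift 1 t" by (auto simp: mem_span_singleton)
    have "lift 1 s $ j = c * lift 1 t $ j" "lift 1 s $ k = c * lift 1 t $ k" using c by simp_all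
    then show "s = t" by simp
  qed
  then have "\<not> finite (range (\<lambda>t. vec.span {lift 1 t}))"
    using finite_imageD[of "\<lambda>t. vec.span {lift 1 t}" UNIV] infinite_UNIV_char_0[where 'a = complex] by auto
  then have "\<not> range (\<lambda>t. vec.span {lift 1 t}) \<subseteq> S" using finite_subset[OF _ assms] by auto
  then obtain t where "vec.span {lift 1 t} \<notin> S" by auto
  moreover have "lift 1 t \<noteq> 0"
  proof
    assume "lift 1 t = 0"
    then have "lift 1 t $ j = 0" by simp
    then show False by simp
  qed
  ultimately show ?thesis by (intro that[of "lift 1 t"]) auto
qed

end

lemma plane_chart_exists:
  assumes "\<alpha> \<noteq> 0" obtains i j k where "plane_chart \<alpha> i j k"
proof -
  obtain i where i: "\<alpha> $ i \<noteq> 0" using assms by (auto simp: vec_eq_iff)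
  obtain j k :: 3 where "i \<noteq> j" "i \<noteq> k" "j \<noteq> k"
  proof -
    have "i = 1 \<or> i = 2 \<or> i = 3" by (rule exhaust_3)
    then show ?thesis by (elim disjE) (auto intro: that[of 2 3] that[of 1 3] that[of 1 2])
  qed
  then show ?thesis using i that by (auto simp: plane_chart_def)
qed

text \<open>
  At a point where \<open>l\<close> meets another line, \<open>\<theta>\<close> is tangent to both lines and hence radial. So the minor of
  \<open>v\<close> and \<open>\<theta> v\<close>, a form of degree \<open>m + 1\<close> on the plane over \<open>l\<close>, vanishes at all these points. If there are more
  than \<open>m + 1\<close> of them it is zero. If there are exactly \<open>m + 1\<close>, one further zero \<open>e\<close> suffices: on the affine
  line \<open>e1 + t e\<close> it removes the coefficient of degree \<open>m + 1\<close>.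
\<close>

lemma (in plane_chart) radial_of_many_points:
  assumes arr: "arrangement \<A>" and l: "l \<in> \<A>" and \<alpha>: "\<alpha> = form_of l"
    and \<theta>: "hom_field m \<theta>" "killed_by_gradient \<A> \<theta>" and m: "0 \<le> m" "m < int (card (points_on l \<A>))"
    and e: "linear_form \<alpha> e = 0" "e \<noteq> 0" "vec.span {e} \<notin> points_on l \<A>"
    and top: "m + 1 = int (card (points_on l \<A>)) \<Longrightarrow> minor j k e (\<theta> e) = 0"
  shows "radial_on \<alpha> \<theta>"
proof -
  define f where "f v = minor j k v (\<theta> v)" for v
  have hf: "hompoly (int (nat (m + 1))) f" using hompoly_minor[OF \<theta>(1)] m(1) by (simp add: f_def[abs_def])
  have tang: "linear_form \<alpha> (\<theta> v) = 0" if "linear_form \<alpha> v = 0" for v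
    using tangent_to_line[OF arr l \<theta>, of v] that by (simp add: \<alpha>)
  have at_point: "f v = 0" if v: "v \<noteq> 0" "linear_form \<alpha> v = 0" "vec.span {v} \<in> points_on l \<A>" for v
  proof (rule ccontr)
    assume "f v \<noteq> 0"
    then have nz: "minor j k v (\<theta> v) \<noteq> 0" by (simp add: f_def)
    obtain l' where l': "l' \<in> \<A>" "l' \<noteq> l" "vec.span {v} \<in> l'" using v(3) by (auto simp: points_on_def)
    have v': "form l' v = 0" using span_mem_line[OF arr l'(1) v(1)] l'(3) by simp
    have \<theta>': "form l' (\<theta> v) = 0" by (rule tangent_to_line[OF arr l'(1) \<theta> v'])
    obtain z where z: "form l z = 0" "form l' z \<noteq> 0" using distinct_lines_forms[OF arr l l'(1)] l'(2) by blast
    have "form l' z = form l' ((minor j k z (\<theta> v) / minor j k v (\<theta> v)) *s v + (minor j k v z / minor j k v (\<theta> v)) *s \<theta> v)"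
      using plane_span[OF v(2) tang[OF v(2)] nz, of z] z(1) \<alpha> by simp
    also have "\<dots> = 0" by (simp add: v' \<theta>')
    finally show False using z(2) by simp
  qed
  \<comment> \<open>a second basis vector of the plane\<close>
  obtain e1 where e1: "linear_form \<alpha> e1 = 0" "minor j k e1 e \<noteq> 0"
  proof (cases "e $ k = 0")
    case True
    have "e $ j \<noteq> 0"
    proof
      assume "e $ j = 0"
      then have "e = 0" by (intro plane_eqI) (use True e in auto)
      then show False using e by simp
    qed
    then show ?thesis by (intro that[of "lift 0 1"]) (auto simp: minor_def)
  next
    case False
    then show ?thesis by (intro that[of "lift 1 0"]) (auto simp: minor_def)
  qed
  have basis: "\<exists>x y. v = x *s e1 + y *s e" if "linear_form \<alpha> v = 0" for v
    using plane_span[OF e1(1) e(1) e1(2) that] by blast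
  obtain p where p: "\<And>t. f (e1 + t *s e) = poly p t" "degree p \<le> nat (m + 1)" "coeff p (nat (m + 1)) = f e"
    by (rule hompoly_on_line[OF hf, where a = e1 and b = e]) (rule that)
  have "p = 0"
  proof (rule ccontr)
    assume p0: "p \<noteq> 0"
    define T where "T = {t. vec.span {e1 + t *s e} \<in> points_on l \<A>}"
    have nz: "e1 + t *s e \<noteq> 0" for t
    proof
      assume "e1 + t *s e = 0"
      then have "e1 = (- t) *s e" by (simp add: eq_neg_iff_add_eq_0)
      then show False using e1(2) minor_scale_left[of j k "- t" e e] by simp
    qed
    have T_roots: "T \<subseteq> {t. poly p t = 0}"
      using at_point[OF nz] e1(1) e(1) by (auto simp: T_def p(1)[symmetric])
    have finT: "finite T" using T_roots poly_roots_finite[OF p0] finite_subset by blast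
    have sub: "points_on l \<A> \<subseteq> (\<lambda>t. vec.span {e1 + t *s e}) ` T"
    proof
      fix q assume q: "q \<in> points_on l \<A>"
      then have "q \<in> l" by (simp add: points_on_def)
      moreover have "l \<subseteq> proj_plane" using defines_line_form_of[OF arr l] by (auto simp: defines_line_def)
      ultimately obtain v where v: "v \<noteq> 0" "q = vec.span {v}" by (auto simp: proj_plane_def)
      then have "linear_form \<alpha> v = 0" using span_mem_line[OF arr l v(1)] \<open>q \<in> l\<close> \<alpha> by simp
      then obtain x y where xy: "v = x *s e1 + y *s e" using basis by blast
      have x: "x \<noteq> 0"
      proof
        assume "x = 0"
        then have "v = y *s e" "y \<noteq> 0" using xy v(1) by auto
        then have "q = vec.span {e}" using v(2) span_scale by simp
        then show False using q e(3) by simp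
      qed
      then have v_eq: "v = x *s (e1 + (y / x) *s e)" using xy by (simp add: vector_add_ldistrib)
      have "q = vec.span {e1 + (y / x) *s e}" unfolding v(2) v_eq by (rule span_scale[OF x])
      then show "q \<in> (\<lambda>t. vec.span {e1 + t *s e}) ` T" using q by (auto simp: T_def)
    qed
    have "card (points_on l \<A>) \<le> card ((\<lambda>t. vec.span {e1 + t *s e}) ` T)"
      by (rule card_mono[OF _ sub]) (simp add: finT)
    also have "\<dots> \<le> card T" by (rule card_image_le[OF finT])
    also have "\<dots> \<le> card {t. poly p t = 0}" by (rule card_mono[OF poly_roots_finite[OF p0] T_roots])
    also have "\<dots> \<le> degree p" by (rule card_poly_roots_bound[OF p0])
    finally have le: "card (points_on l \<A>) \<le> degree p" .
    then have "m + 1 = int (card (points_on l \<A>))" "degree p = nat (m + 1)" using p(2) m by linarith+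
    then show False using top p(3) p0 by (simp add: f_def) (metis leading_coeff_0_iff)
  qed
  have "f v = 0" if v: "linear_form \<alpha> v = 0" for v
  proof (rule polyfun_domain_plane[of f "\<lambda>v. minor j k v e" \<alpha> e1])
    show "polyfun f" by (rule hompoly_polyfun[OF hf])
    show "polyfun (\<lambda>v. minor j k v e)" unfolding minor_def by simp
    fix v assume "linear_form \<alpha> v = 0"
    then obtain x y where xy: "v = x *s e1 + y *s e" using basis by blast
    show "f v * minor j k v e = 0"
    proof (cases "x = 0")
      case True
      then show ?thesis using xy by (simp add: minor_scale_left)
    next
      case False
      then have v_eq: "v = x *s (e1 + (y / x) *s e)" using xy by (simp add: vector_add_ldistrib)
      have "f v = 0" unfolding v_eq hompoly_scale[OF hf False] p(1) using \<open>p = 0\<close> by simp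
      then show ?thesis by simp
    qed
  qed (use v e1 in auto)
  then show ?thesis unfolding radial_on_def f_def using plane_minor tang by blast
qed

text \<open>
  For \<open>u\<close> in the plane over \<open>l\<close>, the derivation \<open>n f' \<partial>\<^sub>u - \<partial>\<^sub>u(f') E\<close> kills \<open>f = \<alpha>\<^sub>l f'\<close>, where \<open>n\<close> is the number of lines and
  \<open>E\<close> is the Euler field. It is not radial at points where \<open>f'\<close> does not vanish and \<open>u\<close> is not a multiple of \<open>v\<close>.
\<close>

lemma exists_non_radial_field:
  assumes arr: "arrangement \<A>" and l: "l \<in> \<A>"
  shows "\<exists>\<tau>. hom_field (int (card \<A>) - 1) \<tau> \<and> killed_by_gradient \<A> \<tau> \<and> \<not> radial_on (form_of l) \<tau>"
proof -
  have fin: "finite \<A>" using arr by (simp add: arrangement_def)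
  define \<B> where "\<B> = \<A> - {l}"
  have fB: "finite \<B>" using fin by (simp add: \<B>_def)
  have "card \<A> > 0" using l fin by (auto simp: card_gt_0_iff)
  then have n: "int (card \<A>) - 1 = int (card \<B>)" using l fin by (simp add: \<B>_def of_nat_diff)
  obtain i j k where chart: "plane_chart (form_of l) i j k" by (rule plane_chart_exists[OF form_of_nonzero[OF arr l]])
  interpret plane_chart "form_of l" i j k by (rule chart)
  obtain v0 where v0: "form l v0 = 0" "defining_poly \<B> v0 \<noteq> 0"
    using defining_poly_nonzero_on_line[OF arr l subset_refl] by (auto simp: \<B>_def)
  define \<tau> where "\<tau> u v = (of_nat (card \<A>) * defining_poly \<B> v) *s u - gradient \<B> v u *s v" for u v
  have h: "hom_field (int (card \<A>) - 1) (\<tau> u)" for u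
    unfolding \<tau>_def[abs_def] n
  proof (rule hom_field_diff)
    show "hom_field (int (card \<B>)) (\<lambda>v. (of_nat (card \<A>) * defining_poly \<B> v) *s u)"
      by (rule hom_field_scale[OF hompoly_cmult[OF hompoly_defining_poly[OF fB]] hom_field_const]) simp
    have "hompoly (int (card \<B>) - 1 + 0) (\<lambda>v. gradient \<B> v u)" by (rule hompoly_gradient[OF fB hom_field_const])
    then show "hom_field (int (card \<B>)) (\<lambda>v. gradient \<B> v u *s v)"
      by (rule hom_field_scale[OF _ hom_field_euler]) simp
  qed
  have kill: "killed_by_gradient \<A> (\<tau> u)" if u: "form l u = 0" for u
    unfolding killed_by_gradient_def
  proof
    fix v
    have "gradient \<A> v (\<tau> u v) = of_nat (card \<A>) * defining_poly \<B> v * gradient \<A> v u - gradient \<B> v u * gradient \<A> v v"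
      by (simp add: \<tau>_def gradient_diff gradient_scale)
    also have "gradient \<A> v v = of_nat (card \<A>) * (form l v * defining_poly \<B> v)"
      unfolding euler_identity[OF fin] by (simp add: defining_poly_remove[OF fin l] \<B>_def)
    also have "gradient \<A> v u = form l v * gradient \<B> v u"
      unfolding gradient_remove[OF fin l] by (simp add: u \<B>_def)
    finally show "gradient \<A> v (\<tau> u v) = 0" by (simp add: algebra_simps)
  qed
  show ?thesis
  proof (rule ccontr)
    assume "\<not> ?thesis"
    then have rad: "radial_on (form_of l) (\<tau> u)" if "form l u = 0" for u using h kill[OF that] by blast
    have z: "minor j k v0 u = 0" if u: "form l u = 0" for u
    proof -
      have "minor j k v0 (\<tau> u v0) = 0" using rad[OF u] v0(1) by (simp add: radial_on_def)
      then show ?thesis using v0(2) \<open>card \<A> > 0\<close> by (simp add: \<tau>_def minor_diff minor_scale)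
    qed
    have "v0 $ j = 0" "v0 $ k = 0" using z[of "lift 0 1"] z[of "lift 1 0"] by (simp_all add: minor_def)
    then have "v0 = 0" by (intro plane_eqI) (use v0(1) in auto)
    then have 0: "defining_poly \<B> 0 \<noteq> 0" using v0(2) by simp
    have "\<B> = {}"
    proof (rule ccontr)
      assume "\<B> \<noteq> {}"
      then have "0 < int (card \<B>)" using fB by (simp add: card_gt_0_iff)
      then show False using hompoly_at_zero[OF hompoly_defining_poly[OF fB]] 0 by simp
    qed
    then have one: "defining_poly \<B> v = 1" for v by (simp add: defining_poly_def)
    have "minor j k (lift 1 0) (\<tau> (lift 0 1) (lift 1 0)) = 0" using rad[of "lift 0 1"] by (simp add: radial_on_def)
    then show False using \<open>card \<A> > 0\<close> by (simp add: \<tau>_def one minor_diff minor_scale) (simp add: minor_def)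
  qed
qed

section \<open>Changing the generators of a presentation\<close>

lemma presentationD:
  assumes "presentation \<A> e \<delta> \<theta> r"
  shows "hom_field (\<delta> j) (\<theta> j)" "killed_by_gradient \<A> (\<theta> j)" "hompoly (e - \<delta> j) (r j)"
    "\<exists>j v. r j v \<noteq> 0" "(\<Sum>j\<in>UNIV. r j v *s \<theta> j v) = 0"
    "locally_generates \<A> \<delta> \<theta>" "syzygies_generated_by e \<delta> \<theta> r"
  using assms by (auto simp: presentation_def)

lemma locally_generatesE:
  assumes "locally_generates \<A> \<delta> \<theta>" "hom_field m \<tau>" "killed_by_gradient \<A> \<tau>" "v \<noteq> 0"
  obtains n Q P where "hompoly n Q" "Q v \<noteq> 0" "\<And>j. hompoly (n + m - \<delta> j) (P j)"
    "\<And>w. Q w *s \<tau> w = (\<Sum>j\<in>UNIV. P j w *s \<theta> j w)"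
  using assms unfolding locally_generates_def by blast

lemma syzygies_generated_byE:
  assumes "syzygies_generated_by e \<delta> \<theta> r" "\<And>j. hompoly (m - \<delta> j) (A j)"
    "\<And>w. (\<Sum>j\<in>UNIV. A j w *s \<theta> j w) = 0" "v \<noteq> 0"
  obtains n Q E where "hompoly n Q" "Q v \<noteq> 0" "hompoly (n + m - e) E" "\<And>j w. Q w * A j w = E w * r j w"
  using assms unfolding syzygies_generated_by_def by blast

text \<open>
  The generators \<open>\<theta> j - c j \<theta> p\<close> span the same module, and a combination with coefficients \<open>P\<close> of the old
  generators has the coefficient \<open>P p + \<Sum>\<^sub>i c i P i\<close> at \<open>p\<close> with respect to the new ones.
\<close>

lemma presentation_change_generators:
  fixes \<theta> :: "'m::finite \<Rightarrow> complex^3 \<Rightarrow> complex^3"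
  assumes pres: "presentation \<A> e \<delta> \<theta> r" and c: "\<And>j. c j \<noteq> 0 \<Longrightarrow> \<delta> j = \<delta> p" "c p = 0"
  defines "\<theta>' \<equiv> \<lambda>j v. \<theta> j v - c j *s \<theta> p v"
    and "r' \<equiv> \<lambda>j v. r j v + (if j = p then \<Sum>i\<in>UNIV. c i * r i v else 0)"
  shows "presentation \<A> e \<delta> \<theta>' r'"
proof -
  define up where "up P j v = P j v + (if j = p then \<Sum>i\<in>UNIV. c i * P i v else 0)" for P :: "'m \<Rightarrow> complex^3 \<Rightarrow> complex" and j v
  have up_eq: "(\<Sum>j\<in>UNIV. up P j v *s \<theta>' j v) = (\<Sum>j\<in>UNIV. P j v *s \<theta> j v)" for P v
  proof -
    have "(\<Sum>j\<in>UNIV. up P j v *s \<theta>' j v) = (\<Sum>j\<in>UNIV. P j v *s \<theta>' j v + (if j = p then (\<Sum>i\<in>UNIV. c i * P i v) *s \<theta> p v else 0))"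
      by (intro sum.cong) (auto simp: up_def vec.scale_left_distrib \<theta>'_def c(2))
    also have "\<dots> = (\<Sum>j\<in>UNIV. P j v *s \<theta> j v) - (\<Sum>j\<in>UNIV. (c j * P j v) *s \<theta> p v) + (\<Sum>i\<in>UNIV. c i * P i v) *s \<theta> p v"
      by (simp add: sum.distrib \<theta>'_def vec.scale_right_diff_distrib sum_subtractf mult.commute)
    finally show ?thesis by (simp add: vec.scale_sum_left)
  qed
  have h_up: "hompoly (k - \<delta> j) (up P j)" if "\<And>j. hompoly (k - \<delta> j) (P j)" for k P j
  proof -
    have "hompoly (k - \<delta> p) (\<lambda>v. c i * P i v)" for i
      using c(1)[of i] hompoly_cmult[OF that[of i], of "c i"] by (cases "c i = 0") simp_all
    then have "hompoly (k - \<delta> p) (\<lambda>v. \<Sum>i\<in>UNIV. c i * P i v)" by (intro hompoly_sum)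
    then show ?thesis using that unfolding up_def[abs_def] by (cases "j = p") (auto intro: hompoly_add)
  qed
  have r'_up: "r' = up r" by (auto simp: r'_def up_def fun_eq_iff)
  note D = presentationD[OF pres]
  have h\<theta>': "hom_field (\<delta> j) (\<theta>' j)" for j
  proof (cases "c j = 0")
    case True
    then show ?thesis using D(1)[of j] by (simp add: \<theta>'_def)
  next
    case False
    have "hom_field (\<delta> p) (\<lambda>v. c j *s \<theta> p v)" by (rule hom_field_scale[OF hompoly_const D(1)]) simp
    then show ?thesis unfolding \<theta>'_def using D(1)[of j] c(1)[OF False] by (intro hom_field_diff) simp_all
  qed
  have kill: "killed_by_gradient \<A> (\<theta>' j)" for j
    using D(2) by (simp add: \<theta>'_def killed_by_gradient_def gradient_diff gradient_scale)
  have nz: "\<exists>j v. r' j v \<noteq> 0"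
  proof (rule ccontr)
    assume "\<not> ?thesis"
    then have z: "r' j v = 0" for j v by simp
    have a: "r j v = 0" if "j \<noteq> p" for j v using z[of j v] that by (simp add: r'_def)
    have "(\<Sum>i\<in>UNIV. c i * r i v) = 0" for v
      by (rule sum.neutral) (metis a c(2) mult_zero_left mult_zero_right)
    then have "r p v = 0" for v using z[of p v] by (simp add: r'_def)
    then show False using D(4) a by metis
  qed
  have gen: "locally_generates \<A> \<delta> \<theta>'"
    unfolding locally_generates_def
  proof (intro allI impI, elim conjE)
    fix m \<tau> and v :: "complex^3" assume \<tau>: "hom_field m \<tau>" "killed_by_gradient \<A> \<tau>" "v \<noteq> 0"
    obtain n Q P where Q: "hompoly n Q" "Q v \<noteq> 0" "\<And>j. hompoly (n + m - \<delta> j) (P j)"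
      "\<And>w. Q w *s \<tau> w = (\<Sum>j\<in>UNIV. P j w *s \<theta> j w)"
      by (rule locally_generatesE[OF D(6) \<tau>]) (rule that)
    then show "\<exists>n Q P. hompoly n Q \<and> Q v \<noteq> 0 \<and> (\<forall>j. hompoly (n + m - \<delta> j) (P j)) \<and>
        (\<forall>w. Q w *s \<tau> w = (\<Sum>j\<in>UNIV. P j w *s \<theta>' j w))"
      using h_up[OF Q(3)] by (intro exI[of _ n] exI[of _ Q] exI[of _ "up P"]) (simp add: up_eq)
  qed
  have syz: "syzygies_generated_by e \<delta> \<theta>' r'"
    unfolding syzygies_generated_by_def
  proof (intro allI impI, elim conjE)
    fix m A and v :: "complex^3"
    assume A: "\<forall>j. hompoly (m - \<delta> j) (A j)" and z: "\<forall>w. (\<Sum>j\<in>UNIV. A j w *s \<theta>' j w) = 0" and v: "v \<noteq> 0"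
    define P where "P j v = A j v - (if j = p then \<Sum>i\<in>UNIV. c i * A i v else 0)" for j v
    have cP: "(\<Sum>i\<in>UNIV. c i * P i v) = (\<Sum>i\<in>UNIV. c i * A i v)" for v
      by (intro sum.cong) (auto simp: P_def c(2))
    have upP: "up P = A" unfolding up_def[abs_def] cP by (auto simp: P_def fun_eq_iff)
    have hP: "hompoly (m - \<delta> j) (P j)" for j
    proof -
      have "hompoly (m - \<delta> p) (\<lambda>v. c i * A i v)" for i
        using c(1)[of i] hompoly_cmult[OF A[rule_format, of i], of "c i"] by (cases "c i = 0") simp_all
      then have "hompoly (m - \<delta> p) (\<lambda>v. \<Sum>i\<in>UNIV. c i * A i v)" by (intro hompoly_sum)
      then show ?thesis using A unfolding P_def[abs_def] by (cases "j = p") (auto intro: hompoly_diff)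
    qed
    have zP: "(\<Sum>j\<in>UNIV. P j w *s \<theta> j w) = 0" for w using up_eq[of P w] z by (simp add: upP)
    obtain n Q E where Q: "hompoly n Q" "Q v \<noteq> 0" "hompoly (n + m - e) E" "\<And>j w. Q w * P j w = E w * r j w"
      by (rule syzygies_generated_byE[OF D(7) hP zP v]) (rule that)
    have "Q w * A j w = E w * r' j w" for j w
    proof -
      have "Q w * (\<Sum>i\<in>UNIV. c i * P i w) = (\<Sum>i\<in>UNIV. c i * (Q w * P i w))"
        by (simp add: sum_distrib_left mult_ac)
      also have "\<dots> = E w * (\<Sum>i\<in>UNIV. c i * r i w)" unfolding Q(4) by (simp add: sum_distrib_left mult_ac)
      finally have "Q w * up P j w = E w * r' j w" by (simp add: up_def r'_def distrib_left Q(4))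
      then show ?thesis by (simp add: upP)
    qed
    then show "\<exists>n Q E. hompoly n Q \<and> Q v \<noteq> 0 \<and> hompoly (n + m - e) E \<and> (\<forall>j w. Q w * A j w = E w * r' j w)"
      using Q by blast
  qed
  have "(\<Sum>j\<in>UNIV. r' j v *s \<theta>' j v) = 0" for v unfolding r'_up up_eq by (rule D(5))
  then show ?thesis unfolding presentation_def
    using h\<theta>' kill nz gen syz h_up[OF D(3)] by (auto simp: r'_up)
qed

section \<open>The coefficient of the nonradial generator is the equation of the line\<close>

lemma sum_split_index:
  fixes f :: "'m::finite \<Rightarrow> 'b::comm_monoid_add" and \<iota> :: "'k::finite \<Rightarrow> 'm"
  assumes "bij_betw \<iota> UNIV (UNIV - {p})"
  shows "(\<Sum>j\<in>UNIV. f j) = f p + (\<Sum>q\<in>UNIV. f (\<iota> q))"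
proof -
  have "(\<Sum>q\<in>UNIV. f (\<iota> q)) = (\<Sum>j\<in>UNIV - {p}. f j)"
    by (rule sum.reindex_bij_betw[OF assms])
  then show ?thesis by (simp add: sum.remove[of UNIV p])
qed

text \<open>
  Suppose that \<open>r p = 0\<close>. The two other coefficients are curves of positive degree, and by Bezout they
  meet at some \<open>v\<close>. The relation makes the two other generators parallel, so that for every \<open>i\<close> the pair of
  their \<open>i\<close>-th coordinates, with one sign changed, is a syzygy. Being a local multiple of \<open>r\<close>, it shows that
  near \<open>v\<close>, up to a factor that does not vanish at \<open>v\<close>, the generators are the multiples of one field \<open>C\<close>
  by \<open>-r q2\<close> and \<open>r q1\<close>. But \<open>C\<close> lies in the bundle
  and is therefore a combination of the generators; inserting this into \<open>\<theta> q2 = r q1 C\<close> gives a syzygy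
  whose coefficient at \<open>q2\<close> is invertible at \<open>v\<close>, although all multiples of \<open>r\<close> vanish there.
\<close>

lemma presentation_coefficient_nonzero:
  fixes \<theta> :: "3 \<Rightarrow> complex^3 \<Rightarrow> complex^3"
  assumes fin: "finite \<A>" and pres: "presentation \<A> e \<delta> \<theta> r" and deg: "\<And>j. \<delta> j < e"
  shows "\<exists>v. r p v \<noteq> 0"
proof (rule ccontr)
  assume "\<not> ?thesis"
  then have rp: "r p v = 0" for v by simp
  note D = presentationD[OF pres]
  obtain q1 q2 where q: "q1 \<noteq> p" "q2 \<noteq> p" "q1 \<noteq> q2" "UNIV = {p, q1, q2}"
  proof -
    have "p = 1 \<or> p = 2 \<or> p = 3" by (rule exhaust_3)
    then show ?thesis using UNIV_3 by (elim disjE) (auto intro: that[of 2 3] that[of 1 3] that[of 1 2])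
  qed
  have sum3: "(\<Sum>j\<in>UNIV. f j) = f p + f q1 + f q2" for f :: "3 \<Rightarrow> complex^3"
    unfolding q(4) using q(1-3) by (simp add: add.assoc)
  have rel: "r q1 v *s \<theta> q1 v + r q2 v *s \<theta> q2 v = 0" for v using D(5)[of v] rp by (simp add: sum3)
  then have rel_i: "r q1 v * \<theta> q1 v $ i = - (r q2 v * \<theta> q2 v $ i)" for v i
    by (metis add_eq_0_iff2 vector_add_component vector_smult_component zero_index)
  obtain v where v: "v \<noteq> 0" "r q1 v = 0" "r q2 v = 0"
    using plane_curves_meet[OF D(3)[of q1] _ D(3)[of q2]] deg[of q1] deg[of q2] by auto
  have all0: "r j v = 0" for j
  proof -
    have "j \<in> {p, q1, q2}" using q(4) by blast
    then show ?thesis using rp v by auto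
  qed
  obtain j0 v0 where r0: "r j0 v0 \<noteq> 0" "j0 = q1 \<or> j0 = q2"
    using D(4) rp q(4) by (metis UNIV_I insertE singletonD)
  \<comment> \<open>the two remaining generators are parallel, so their coordinates form syzygies\<close>
  have par: "\<theta> q2 w $ i * \<theta> q1 w $ k - \<theta> q1 w $ i * \<theta> q2 w $ k = 0" for i k w
  proof (rule polyfun_domain[where Q = "r j0" and ?v0.0 = v0 and P = "\<lambda>w. \<theta> q2 w $ i * \<theta> q1 w $ k - \<theta> q1 w $ i * \<theta> q2 w $ k"])
    show "polyfun (\<lambda>w. \<theta> q2 w $ i * \<theta> q1 w $ k - \<theta> q1 w $ i * \<theta> q2 w $ k)"
      by (intro polyfun_diff polyfun_mult hom_field_polyfun[OF D(1)])
    show "polyfun (r j0)" by (rule hompoly_polyfun[OF D(3)])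
    fix w
    have 1: "(\<theta> q2 w $ i * \<theta> q1 w $ k - \<theta> q1 w $ i * \<theta> q2 w $ k) * r q1 w
      = \<theta> q2 w $ i * (r q1 w * \<theta> q1 w $ k) - (r q1 w * \<theta> q1 w $ i) * \<theta> q2 w $ k" by (simp add: algebra_simps)
    have 2: "(\<theta> q2 w $ i * \<theta> q1 w $ k - \<theta> q1 w $ i * \<theta> q2 w $ k) * r q2 w
      = (r q2 w * \<theta> q2 w $ i) * \<theta> q1 w $ k - \<theta> q1 w $ i * (r q2 w * \<theta> q2 w $ k)" by (simp add: algebra_simps)
    have 3: "r q2 w * \<theta> q2 w $ i = - (r q1 w * \<theta> q1 w $ i)" for i using rel_i[of w i] by simp
    show "(\<theta> q2 w $ i * \<theta> q1 w $ k - \<theta> q1 w $ i * \<theta> q2 w $ k) * r j0 w = 0"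
      using r0(2)
    proof
      assume "j0 = q1"
      then show ?thesis unfolding \<open>j0 = q1\<close> 1 rel_i by (simp add: algebra_simps)
    next
      assume "j0 = q2"
      then show ?thesis unfolding \<open>j0 = q2\<close> 2 3 by (simp add: algebra_simps)
    qed
  qed (rule r0(1))
  define m where "m = \<delta> q1 + \<delta> q2"
  have "\<exists>n Q E. hompoly n Q \<and> Q v \<noteq> 0 \<and> hompoly (n + m - e) E \<and>
     (\<forall>w. Q w * \<theta> q2 w $ i = E w * r q1 w \<and> Q w * \<theta> q1 w $ i = - (E w * r q2 w))" for i
  proof -
    define A where "A j w = (if j = q1 then \<theta> q2 w $ i else if j = q2 then - \<theta> q1 w $ i else 0)" for j w
    have hA: "hompoly (m - \<delta> j) (A j)" for j
    proof -
      have "hompoly (m - \<delta> q1) (\<lambda>w. \<theta> q2 w $ i)" "hompoly (m - \<delta> q2) (\<lambda>w. - \<theta> q1 w $ i)"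
        using hom_fieldD[OF D(1)[of q2]] hompoly_minus[OF hom_fieldD[OF D(1)[of q1]]] by (simp_all add: m_def)
      then show ?thesis unfolding A_def[abs_def] by (cases "j = q1"; cases "j = q2") auto
    qed
    have zA: "(\<Sum>j\<in>UNIV. A j w *s \<theta> j w) = 0" for w
      unfolding sum3 using q(1-3) par[of w i] by (simp add: A_def vec_eq_iff)
    obtain n Q E where "hompoly n Q" "Q v \<noteq> 0" "hompoly (n + m - e) E" "\<And>j w. Q w * A j w = E w * r j w"
      by (rule syzygies_generated_byE[OF D(7) hA zA v(1)]) (rule that)
    note * = this
    have "Q w * \<theta> q2 w $ i = E w * r q1 w" for w using *(4)[of w q1] by (simp add: A_def)
    moreover have "Q w * \<theta> q1 w $ i = - (E w * r q2 w)" for w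
      using *(4)[of w q2] q(3) by (simp add: A_def) (metis minus_minus)
    ultimately show ?thesis using * by blast
  qed
  then have "\<forall>i. \<exists>n Q E. hompoly n Q \<and> Q v \<noteq> 0 \<and> hompoly (n + m - e) E \<and>
     (\<forall>w. Q w * \<theta> q2 w $ i = E w * r q1 w \<and> Q w * \<theta> q1 w $ i = - (E w * r q2 w))" by blast
  then obtain n Q E where QE: "\<And>i. hompoly (n i) (Q i)" "\<And>i. Q i v \<noteq> 0" "\<And>i. hompoly (n i + m - e) (E i)"
    "\<And>i w. Q i w * \<theta> q2 w $ i = E i w * r q1 w \<and> Q i w * \<theta> q1 w $ i = - (E i w * r q2 w)"
    unfolding choice_iff by blast
  define R where "R w = (\<Prod>i\<in>UNIV. Q i w)" for w
  define C :: "complex^3 \<Rightarrow> complex^3" where "C w = (\<chi> i. E i w * (\<Prod>l\<in>UNIV - {i}. Q l w))" for w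
  define N where "N = (\<Sum>i\<in>UNIV. n i)"
  have R: "R w = Q i w * (\<Prod>l\<in>UNIV - {i}. Q l w)" for i w unfolding R_def by (simp add: prod.remove)
  have hR: "hompoly N R" unfolding R_def[abs_def] N_def by (rule hompoly_prod) (auto simp: QE(1))
  have hC: "hom_field (N + m - e) C" unfolding hom_field_def
  proof
    fix i
    have "hompoly (N + m - e) (\<lambda>w. E i w * (\<Prod>l\<in>UNIV - {i}. Q l w))"
      by (rule hompoly_mult[OF QE(3) hompoly_prod[of _ n]]) (auto simp: QE(1) N_def sum.remove[of UNIV i n])
    then show "hompoly (N + m - e) (\<lambda>w. C w $ i)" by (simp add: C_def)
  qed
  have C2: "R w *s \<theta> q2 w = r q1 w *s C w" for w
  proof -
    have "R w * \<theta> q2 w $ i = r q1 w * C w $ i" for i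
      unfolding R[of w i] C_def using QE(4)[of i w] by (simp add: mult_ac)
    then show ?thesis by (simp add: vec_eq_iff)
  qed
  have C1: "R w *s \<theta> q1 w = - (r q2 w *s C w)" for w
  proof -
    have "R w * \<theta> q1 w $ i = - (r q2 w * C w $ i)" for i
    proof -
      have "R w * \<theta> q1 w $ i = (Q i w * \<theta> q1 w $ i) * (\<Prod>l\<in>UNIV - {i}. Q l w)"
        by (simp only: R[of w i] mult_ac)
      also have "Q i w * \<theta> q1 w $ i = - (E i w * r q2 w)" using QE(4) by blast
      finally show ?thesis by (simp add: C_def mult_ac)
    qed
    then show ?thesis by (simp add: vec_eq_iff)
  qed
  have rC: "r j0 w * gradient \<A> w (C w) = 0" for w
    using r0(2)
  proof
    assume "j0 = q1"
    then have "r j0 w * gradient \<A> w (C w) = gradient \<A> w (R w *s \<theta> q2 w)" unfolding C2 gradient_scale by simp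
    then show ?thesis using D(2)[of q2] by (simp add: gradient_scale killed_by_gradient_def)
  next
    assume "j0 = q2"
    then have "r j0 w * gradient \<A> w (C w) = gradient \<A> w (r q2 w *s C w)" by (simp add: gradient_scale)
    also have "r q2 w *s C w = (- R w) *s \<theta> q1 w" using C1[of w] by (simp add: minus_equation_iff)
    finally show ?thesis using D(2)[of q1] by (simp only: gradient_scale killed_by_gradient_def) simp
  qed
  have "gradient \<A> w (C w) = 0" for w
    by (rule polyfun_domain[where Q = "r j0" and ?v0.0 = v0 and P = "\<lambda>w. gradient \<A> w (C w)"])
       (use rC r0(1) polyfun_gradient[OF fin hom_field_polyfun[OF hC]] hompoly_polyfun[OF D(3)] in \<open>auto simp: mult.commute\<close>)
  then have kC: "killed_by_gradient \<A> C" by (simp add: killed_by_gradient_def)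
  obtain n' Q' P where Q': "hompoly n' Q'" "Q' v \<noteq> 0" "\<And>j. hompoly (n' + (N + m - e) - \<delta> j) (P j)"
    "\<And>w. Q' w *s C w = (\<Sum>j\<in>UNIV. P j w *s \<theta> j w)"
    by (rule locally_generatesE[OF D(6) hC kC v(1)]) (rule that)
  define A where "A j w = r q1 w * P j w - (if j = q2 then Q' w * R w else 0)" for j w
  have hA: "hompoly (n' + N + \<delta> q2 - \<delta> j) (A j)" for j
  proof -
    have "hompoly (n' + N + \<delta> q2 - \<delta> j) (\<lambda>w. r q1 w * P j w)"
      by (rule hompoly_mult[OF D(3) Q'(3)]) (simp add: m_def)
    moreover have "hompoly (n' + N) (\<lambda>w. Q' w * R w)" by (rule hompoly_mult[OF Q'(1) hR refl])
    ultimately show ?thesis unfolding A_def[abs_def] by (cases "j = q2") (auto intro: hompoly_diff)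
  qed
  have zA: "(\<Sum>j\<in>UNIV. A j w *s \<theta> j w) = 0" for w
  proof -
    have "(\<Sum>j\<in>UNIV. A j w *s \<theta> j w) = r q1 w *s (\<Sum>j\<in>UNIV. P j w *s \<theta> j w) - (\<Sum>j\<in>UNIV. if j = q2 then (Q' w * R w) *s \<theta> q2 w else 0)"
      unfolding vec.scale_sum_right sum_subtractf[symmetric]
      by (intro sum.cong) (auto simp: A_def vec.scale_left_diff_distrib)
    also have "\<dots> = Q' w *s (r q1 w *s C w) - Q' w *s (R w *s \<theta> q2 w)"
      by (simp add: Q'(4)[symmetric] mult.commute)
    finally show ?thesis by (simp add: C2)
  qed
  obtain n'' Q'' E'' where Q'': "Q'' v \<noteq> 0" "\<And>j w. Q'' w * A j w = E'' w * r j w"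
    by (rule syzygies_generated_byE[OF D(7) hA zA v(1)]) (rule that)
  have "Q'' v * A q2 v = 0" by (simp add: Q''(2) all0)
  moreover have "A q2 v = - (Q' v * R v)" by (simp add: A_def v)
  moreover have "R v \<noteq> 0" using QE(2) by (simp add: R_def)
  ultimately show False using Q''(1) Q'(2) by simp
qed

section \<open>Deleting the line\<close>

text \<open>
  Write \<open>\<theta> = \<alpha> \<eta>\<^sub>0 + g\<^sub>0 E\<close> with the Euler field \<open>E\<close>. The fields \<open>\<eta>\<^sub>0 + c E\<close> with \<open>g\<^sub>0 - \<alpha> c\<close> in place of \<open>g\<^sub>0\<close> serve as well, and \<open>c\<close>
  is chosen such that the gradient of the deletion kills the result. The equation \<open>\<theta>(f) = 0\<close> says that
  \<open>(\<eta>\<^sub>0(\<alpha>) + n g\<^sub>0) f' = - \<alpha> \<eta>\<^sub>0(f')\<close>, so \<open>\<eta>\<^sub>0(\<alpha>) + n g\<^sub>0 = \<alpha> \<kappa>\<close>, and \<open>c = \<kappa> / (n - 1)\<close> is the right choice.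
\<close>

lemma radial_field_lifts_to_deletion:
  assumes arr: "arrangement \<A>" and l: "l \<in> \<A>" and n: "2 \<le> card \<A>"
    and \<theta>: "hom_field m \<theta>" "killed_by_gradient \<A> \<theta>" and rad: "radial_on (form_of l) \<theta>"
  shows "\<exists>\<eta> g. hom_field (m - 1) \<eta> \<and> hompoly (m - 1) g \<and> killed_by_gradient (\<A> - {l}) \<eta> \<and>
     (\<forall>v. \<theta> v = form l v *s \<eta> v + g v *s v)"
proof -
  have fin: "finite \<A>" using arr by (simp add: arrangement_def)
  define \<B> where "\<B> = \<A> - {l}"
  have fB: "finite \<B>" using fin by (simp add: \<B>_def)
  have cardB: "of_nat (card \<A>) = (of_nat (card \<B>) + 1 :: complex)" "card \<B> \<noteq> 0"
  proof -
    have "card \<A> = Suc (card \<B>)" using card.remove[OF fin l] by (simp add: \<B>_def)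
    then show "of_nat (card \<A>) = (of_nat (card \<B>) + 1 :: complex)" "card \<B> \<noteq> 0" using n by simp_all
  qed
  obtain i j k where chart: "plane_chart (form_of l) i j k" by (rule plane_chart_exists[OF form_of_nonzero[OF arr l]])
  obtain g0 \<eta>0 where g0: "hompoly (m - 1) g0" "hom_field (m - 1) \<eta>0" "\<And>v. \<theta> v = form l v *s \<eta>0 v + g0 v *s v"
    using plane_chart.radial_decomposition[OF chart \<theta>(1) rad] by blast
  define u where "u v = form l (\<eta>0 v) + of_nat (card \<A>) * g0 v" for v
  have hu: "hompoly (m - 1) u" unfolding u_def[abs_def]
    by (intro hompoly_add hompoly_form_field[OF g0(2)] hompoly_cmult g0(1))
  have key: "form l v * (u v * defining_poly \<B> v + form l v * gradient \<B> v (\<eta>0 v)) = 0" for v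
  proof -
    have "gradient \<A> v (\<theta> v) = form l v * gradient \<A> v (\<eta>0 v) + g0 v * gradient \<A> v v"
      unfolding g0(3) by (simp add: gradient_add gradient_scale)
    also have "gradient \<A> v v = of_nat (card \<A>) * (form l v * defining_poly \<B> v)"
      unfolding euler_identity[OF fin] by (simp add: defining_poly_remove[OF fin l] \<B>_def)
    also have "gradient \<A> v (\<eta>0 v) = form l (\<eta>0 v) * defining_poly \<B> v + form l v * gradient \<B> v (\<eta>0 v)"
      unfolding gradient_remove[OF fin l] by (simp add: \<B>_def)
    finally show ?thesis using \<theta>(2) by (simp add: killed_by_gradient_def u_def algebra_simps)
  qed
  have pB: "polyfun (defining_poly \<B>)" by (rule hompoly_polyfun[OF hompoly_defining_poly[OF fB]])
  have pg: "polyfun (\<lambda>v. gradient \<B> v (\<eta>0 v))" by (rule polyfun_gradient[OF fB hom_field_polyfun[OF g0(2)]])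
  obtain w where w: "form l w = 1" by (rule linear_form_nonzero[OF form_of_nonzero[OF arr l]])
  have key': "u v * defining_poly \<B> v + form l v * gradient \<B> v (\<eta>0 v) = 0" for v
    by (rule polyfun_domain[where Q = "form l" and ?v0.0 = w and P = "\<lambda>v. u v * defining_poly \<B> v + form l v * gradient \<B> v (\<eta>0 v)"])
       (use key w pB pg hompoly_polyfun[OF hu] in \<open>auto simp: mult.commute\<close>)
  obtain v0 where v0: "form l v0 = 0" "defining_poly \<B> v0 \<noteq> 0"
    using defining_poly_nonzero_on_line[OF arr l subset_refl] by (auto simp: \<B>_def)
  have "u v = 0" if "form l v = 0" for v
  proof (rule polyfun_domain_plane[of u "defining_poly \<B>" "form_of l" v0])
    show "u v * defining_poly \<B> v = 0" if "form l v = 0" for v using key'[of v] that by simp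
  qed (use that v0 pB hompoly_polyfun[OF hu] in auto)
  then obtain \<kappa> where \<kappa>: "polyfun \<kappa>" "\<And>v. u v = form l v * \<kappa> v"
    using polyfun_divide[OF hompoly_polyfun[OF hu] form_of_nonzero[OF arr l]] by blast
  have u_eq: "u = (\<lambda>v. form l v * \<kappa> v)" using \<kappa>(2) by auto
  have h\<kappa>: "hompoly (m - 1 - 1) \<kappa>"
    by (rule hompoly_quotient[where A = "form l" and ?v0.0 = w]) (use hu u_eq \<kappa>(1) w in auto)
  define c where "c v = (1 / of_nat (card \<B>)) * \<kappa> v" for v
  have hc: "hompoly (m - 1 - 1) c" unfolding c_def[abs_def] by (rule hompoly_cmult[OF h\<kappa>])
  define \<eta> where "\<eta> v = \<eta>0 v + c v *s v" for v
  define g where "g v = g0 v - form l v * c v" for v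
  have h\<eta>: "hom_field (m - 1) \<eta>" unfolding \<eta>_def[abs_def]
    by (intro hom_field_add g0(2) hom_field_scale[OF hc hom_field_euler]) simp
  have "gradient \<B> v (\<eta> v) = 0" for v
  proof (rule polyfun_domain[where Q = "form l" and ?v0.0 = w and P = "\<lambda>v. gradient \<B> v (\<eta> v)"])
    show "polyfun (\<lambda>v. gradient \<B> v (\<eta> v))" by (rule polyfun_gradient[OF fB hom_field_polyfun[OF h\<eta>]])
    fix v
    have "gradient \<B> v (\<eta> v) * form l v = form l v * gradient \<B> v (\<eta>0 v) + c v * (of_nat (card \<B>) * defining_poly \<B> v) * form l v"
      by (simp add: \<eta>_def gradient_add gradient_scale euler_identity[OF fB] algebra_simps)
    also have "c v * (of_nat (card \<B>) * defining_poly \<B> v) * form l v = u v * defining_poly \<B> v"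
      using cardB(2) by (simp add: c_def \<kappa>(2))
    finally show "gradient \<B> v (\<eta> v) * form l v = 0" using key'[of v] by (simp add: add.commute)
  qed (use w in auto)
  then have "killed_by_gradient (\<A> - {l}) \<eta>" by (simp add: killed_by_gradient_def \<B>_def)
  moreover note h\<eta>
  moreover have "hompoly (m - 1) g" unfolding g_def[abs_def]
    by (intro hompoly_diff g0(1) hompoly_mult[OF hompoly_linear_form hc]) simp
  moreover have "\<theta> v = form l v *s \<eta> v + g v *s v" for v
    unfolding g0(3) by (simp add: \<eta>_def g_def vec_eq_iff algebra_simps)
  ultimately show ?thesis by blast
qed

text \<open>
  Applied to the product \<open>f'\<close> of the other forms, both sides give \<open>0 = (n - 1) h f'\<close>, where \<open>n\<close> is the number of lines.
\<close>

lemma deletion_field_unique: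
  assumes arr: "arrangement \<A>" and l: "l \<in> \<A>" and n: "2 \<le> card \<A>"
    and \<xi>: "hom_field m \<xi>" "killed_by_gradient (\<A> - {l}) \<xi>" and h: "polyfun h"
    and eq: "\<And>v. form l v *s \<xi> v = h v *s v"
  shows "\<xi> v = 0"
proof -
  have fin: "finite \<A>" using arr by (simp add: arrangement_def)
  define \<B> where "\<B> = \<A> - {l}"
  have fB: "finite \<B>" using fin by (simp add: \<B>_def)
  have "card \<A> = Suc (card \<B>)" using card.remove[OF fin l] by (simp add: \<B>_def)
  then have cB: "card \<B> \<noteq> 0" using n by simp
  obtain v0 where v0: "defining_poly \<B> v0 \<noteq> 0"
    using defining_poly_nonzero_on_line[OF arr l subset_refl] by (auto simp: \<B>_def)
  obtain w where w: "form l w = 1" by (rule linear_form_nonzero[OF form_of_nonzero[OF arr l]])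
  have h0: "h v = 0" for v
  proof (rule polyfun_domain[where Q = "defining_poly \<B>" and ?v0.0 = v0])
    fix v
    have "gradient \<B> v (form l v *s \<xi> v) = 0" using \<xi>(2) by (simp add: gradient_scale killed_by_gradient_def \<B>_def)
    then have "h v * (of_nat (card \<B>) * defining_poly \<B> v) = 0"
      unfolding eq by (simp only: gradient_scale euler_identity[OF fB])
    then show "h v * defining_poly \<B> v = 0" using cB by simp
  qed (use h v0 hompoly_polyfun[OF hompoly_defining_poly[OF fB]] in auto)
  have "\<xi> v $ i = 0" for i
  proof (rule polyfun_domain[where Q = "form l" and ?v0.0 = w and P = "\<lambda>v. \<xi> v $ i"])
    fix v
    have "(form l v *s \<xi> v) $ i = 0" unfolding eq by (simp add: h0)
    then show "\<xi> v $ i * form l v = 0" by (simp add: mult.commute)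
  qed (use w hom_field_polyfun[OF \<xi>(1)] in auto)
  then show ?thesis by (simp add: vec_eq_iff)
qed

text \<open>
  A field of negative degree is zero, and a zero field is not independent.
\<close>

lemma independent_fields_degree_nonneg:
  assumes ind: "independent_fields \<kappa> \<eta>" and \<eta>: "hom_field (\<kappa> j) (\<eta> j)"
  shows "0 \<le> \<kappa> j"
proof (rule ccontr)
  assume "\<not> ?thesis"
  then have "\<eta> j w = 0" for w using hompoly_neg[OF hom_fieldD[OF \<eta>]] by (simp add: vec_eq_iff)
  then have "(\<Sum>i\<in>UNIV. (if i = j then 1 else 0) *s \<eta> i w) = 0" for w
    by (intro sum.neutral) auto
  moreover have "hompoly (\<kappa> j - \<kappa> i) (\<lambda>w. if i = j then 1 else 0)" for i by simp
  ultimately have "(if j = j then 1 else 0 :: complex) = 0"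
    using independent_fieldsD[OF ind, of "\<kappa> j" "\<lambda>i w. if i = j then 1 else 0" j 0] by blast
  then show False by simp
qed

text \<open>
  The relation, restricted to the line, shows that \<open>r p\<close> vanishes on the line, so it is a nonzero constant
  times the equation \<open>\<alpha>\<close> of the line. Let \<open>\<eta> q\<close> be the lifts of the radial generators to the deletion.
  A field \<open>\<tau>\<close> of the deletion gives the field \<open>\<alpha> \<tau> - \<tau>(\<alpha>) E / n\<close> of the arrangement, which is radial on the line. In
  an expansion of it, the coefficient of \<open>\<theta> p\<close> is therefore divisible by \<open>\<alpha>\<close>, and a multiple of the relation
  removes it. The remaining combination of radial generators is the same combination of the \<open>\<eta> q\<close>, up to
  the factor \<open>\<alpha>\<close> and multiples of \<open>E\<close>. A dependence of the \<open>\<eta> q\<close> gives a syzygy without \<open>\<theta> p\<close>; it is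
  locally a multiple of \<open>r\<close>, hence zero because \<open>r p\<close> is not.
\<close>

theorem basis_of_deletion:
  fixes \<theta> :: "'m::finite \<Rightarrow> complex^3 \<Rightarrow> complex^3" and \<iota> :: "'k::finite \<Rightarrow> 'm"
  assumes arr: "arrangement \<A>" and l: "l \<in> \<A>" and n: "2 \<le> card \<A>"
    and pres: "presentation \<A> e \<delta> \<theta> r" and \<iota>: "bij_betw \<iota> UNIV (UNIV - {p})"
    and rad: "\<And>q. radial_on (form_of l) (\<theta> (\<iota> q))" and nonrad: "\<not> radial_on (form_of l) (\<theta> p)"
    and rp: "\<exists>v. r p v \<noteq> 0" and ep: "e - \<delta> p = 1"
  shows "\<exists>\<eta>. (\<forall>q. hom_field (\<delta> (\<iota> q) - 1) (\<eta> q) \<and> killed_by_gradient (\<A> - {l}) (\<eta> q)) \<and>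
    independent_fields (\<lambda>q. \<delta> (\<iota> q) - 1) \<eta> \<and> locally_generates (\<A> - {l}) (\<lambda>q. \<delta> (\<iota> q) - 1) \<eta>"
proof -
  have fin: "finite \<A>" using arr by (simp add: arrangement_def)
  define \<B> where "\<B> = \<A> - {l}"
  note D = presentationD[OF pres]
  note split = sum_split_index[OF \<iota>]
  have \<iota>p: "\<iota> q \<noteq> p" for q using \<iota> by (auto simp: bij_betw_def)
  obtain w where w: "form l w = 1" by (rule linear_form_nonzero[OF form_of_nonzero[OF arr l]])
  obtain v0 j k where v0: "form l v0 = 0" "minor j k v0 (\<theta> p v0) \<noteq> 0" using nonrad by (auto simp: radial_on_def)
  have pm: "polyfun (\<lambda>v. minor j k v (\<theta> p v))" by (rule hompoly_polyfun[OF hompoly_minor[OF D(1)]])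
  \<comment> \<open>restrict a radial combination to the line and compare the nonradial parts\<close>
  have cut: "P p v = 0" if P: "\<And>j. polyfun (P j)" and v: "form l v = 0"
      and r: "\<And>v. form l v = 0 \<Longrightarrow> minor j k v (\<Sum>j\<in>UNIV. P j v *s \<theta> j v) = 0" for P v
  proof (rule polyfun_domain_plane[of "P p" "\<lambda>v. minor j k v (\<theta> p v)" "form_of l" v0])
    fix v assume v: "form l v = 0"
    have "minor j k v (\<Sum>j\<in>UNIV. P j v *s \<theta> j v) = P p v * minor j k v (\<theta> p v) + (\<Sum>q\<in>UNIV. P (\<iota> q) v * minor j k v (\<theta> (\<iota> q) v))"
      unfolding split by (simp add: minor_add minor_sum minor_scale)
    also have "(\<Sum>q\<in>UNIV. P (\<iota> q) v * minor j k v (\<theta> (\<iota> q) v)) = 0"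
      using rad v by (intro sum.neutral) (simp add: radial_on_def)
    finally show "P p v * minor j k v (\<theta> p v) = 0" using r[OF v] by simp
  qed (use P v v0 pm in auto)
  have "r p v = 0" if "form l v = 0" for v
    by (rule cut[OF hompoly_polyfun[OF D(3)] that]) (simp add: D(5))
  then obtain c where c: "polyfun c" "\<And>v. r p v = form l v * c v"
    using polyfun_divide[OF hompoly_polyfun[OF D(3)] form_of_nonzero[OF arr l]] by blast
  have c_eq: "r p = (\<lambda>v. form l v * c v)" using c(2) by auto
  have "hompoly (1 - 1) c"
    by (rule hompoly_quotient[where A = "form l" and ?v0.0 = w]) (use D(3)[of p] ep c_eq c(1) w in auto)
  then have "c v = c 0" for v using hompoly_0_constant[of c v] by simp
  then have rp_eq: "r p v = c 0 * form l v" for v using c(2)[of v] by (metis mult.commute)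
  then have c0: "c 0 \<noteq> 0" using rp by auto
  have "\<exists>\<eta> g. hom_field (\<delta> (\<iota> q) - 1) \<eta> \<and> hompoly (\<delta> (\<iota> q) - 1) g \<and> killed_by_gradient \<B> \<eta> \<and>
     (\<forall>v. \<theta> (\<iota> q) v = form l v *s \<eta> v + g v *s v)" for q
    unfolding \<B>_def by (rule radial_field_lifts_to_deletion[OF arr l n D(1,2) rad])
  then have "\<forall>q. \<exists>\<eta> g. hom_field (\<delta> (\<iota> q) - 1) \<eta> \<and> hompoly (\<delta> (\<iota> q) - 1) g \<and> killed_by_gradient \<B> \<eta> \<and>
     (\<forall>v. \<theta> (\<iota> q) v = form l v *s \<eta> v + g v *s v)" by blast
  then obtain \<eta> g where \<eta>: "\<And>q. hom_field (\<delta> (\<iota> q) - 1) (\<eta> q)" "\<And>q. hompoly (\<delta> (\<iota> q) - 1) (g q)"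
    "\<And>q. killed_by_gradient \<B> (\<eta> q)" "\<And>q v. \<theta> (\<iota> q) v = form l v *s \<eta> q v + g q v *s v"
    unfolding choice_iff by blast
  have comb: "(\<Sum>q\<in>UNIV. B q v *s \<theta> (\<iota> q) v) = form l v *s (\<Sum>q\<in>UNIV. B q v *s \<eta> q v) + (\<Sum>q\<in>UNIV. B q v * g q v) *s v" for B v
    unfolding \<eta>(4) by (simp add: vec.scale_right_distrib sum.distrib vec.scale_sum_right vec.scale_sum_left mult.commute)
  have ind: "independent_fields (\<lambda>q. \<delta> (\<iota> q) - 1) \<eta>"
    unfolding independent_fields_def
  proof (intro allI impI, elim conjE)
    fix m B q v
    assume B: "\<forall>q. hompoly (m - (\<delta> (\<iota> q) - 1)) (B q)" and z: "\<forall>w. (\<Sum>q\<in>UNIV. B q w *s \<eta> q w) = 0"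
    define h where "h v = (\<Sum>q\<in>UNIV. B q v * g q v)" for v
    have ph: "polyfun h" unfolding h_def[abs_def]
      by (intro polyfun_sum polyfun_mult hompoly_polyfun[OF B[rule_format]] hompoly_polyfun[OF \<eta>(2)])
    have comb0: "(\<Sum>q\<in>UNIV. B q v *s \<theta> (\<iota> q) v) = h v *s v" for v using z by (simp add: comb h_def)
    have pf: "polyfun (defining_poly \<A>)" by (rule hompoly_polyfun[OF hompoly_defining_poly[OF fin]])
    obtain v1 where v1: "defining_poly \<A> v1 \<noteq> 0"
    proof (rule ccontr)
      assume "\<not> thesis"
      then have z: "form l v * defining_poly \<B> v = 0" for v
        using that by (auto simp: defining_poly_remove[OF fin l] \<B>_def)
      obtain v2 where "defining_poly \<B> v2 \<noteq> 0"
        using defining_poly_nonzero_on_line[OF arr l subset_refl] by (auto simp: \<B>_def)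
      then have "form l w = 0"
        using polyfun_domain[of "form l" "defining_poly \<B>"] z fin by (simp add: \<B>_def hompoly_polyfun[OF hompoly_defining_poly])
      then show False using w by simp
    qed
    have h0: "h v = 0" for v
    proof (rule polyfun_domain[where Q = "defining_poly \<A>" and ?v0.0 = v1])
      fix v
      have "gradient \<A> v (\<Sum>q\<in>UNIV. B q v *s \<theta> (\<iota> q) v) = 0"
        using D(2) by (simp add: gradient_sum gradient_scale killed_by_gradient_def)
      then have "h v * (of_nat (card \<A>) * defining_poly \<A> v) = 0"
        by (simp only: comb0 gradient_scale euler_identity[OF fin])
      then show "h v * defining_poly \<A> v = 0" using n by auto
    qed (use ph pf v1 in auto)
    define A where "A j v = (if j = p then 0 else B (inv_into UNIV \<iota> j) v)" for j v
    have A\<iota>: "A (\<iota> q) v = B q v" for q v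
      using \<iota>p \<iota> by (simp add: A_def bij_betw_def)
    have hA: "hompoly (m + 1 - \<delta> j) (A j)" for j
    proof (cases "j = p")
      case False
      then obtain q where q: "j = \<iota> q" using \<iota> by (auto simp: bij_betw_def)
      have "A j = B q" using A\<iota> q by auto
      then show ?thesis using B[rule_format, of q] q by (simp add: algebra_simps)
    qed (simp add: A_def[abs_def])
    have zA: "(\<Sum>j\<in>UNIV. A j v *s \<theta> j v) = 0" for v
      unfolding split A\<iota> comb0 by (simp add: A_def h0)
    have "w \<noteq> 0" using w by auto
    obtain n' Q E where Q: "hompoly n' Q" "Q w \<noteq> 0" "hompoly (n' + (m + 1) - e) E" "\<And>j w. Q w * A j w = E w * r j w"
      by (rule syzygies_generated_byE[OF D(7) hA zA \<open>w \<noteq> 0\<close>]) (rule that)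
    have E0: "E v = 0" for v
    proof (rule polyfun_domain[where Q = "form l" and ?v0.0 = w])
      fix v
      have "E v * (c 0 * form l v) = 0" using Q(4)[of v p] by (simp add: A_def rp_eq)
      then show "E v * form l v = 0" using c0 by simp
    qed (use w hompoly_polyfun[OF Q(3)] in auto)
    show "B q v = 0"
    proof (rule polyfun_domain[where Q = Q and ?v0.0 = w])
      show "B q v * Q v = 0" for v using Q(4)[of v "\<iota> q"] by (simp add: A\<iota> E0 mult.commute)
    qed (use Q hompoly_polyfun[OF B[rule_format]] hompoly_polyfun[OF Q(1)] in auto)
  qed
  have gen: "locally_generates \<B> (\<lambda>q. \<delta> (\<iota> q) - 1) \<eta>"
    unfolding locally_generates_def
  proof (intro allI impI, elim conjE)
    fix m \<tau> and v :: "complex^3"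
    assume \<tau>: "hom_field m \<tau>" "killed_by_gradient \<B> \<tau>" and v: "v \<noteq> 0"
    define u where "u v = (1 / of_nat (card \<A>)) * form l (\<tau> v)" for v
    have hu: "hompoly m u" unfolding u_def[abs_def] by (intro hompoly_cmult hompoly_form_field[OF \<tau>(1)])
    define \<sigma> where "\<sigma> v = form l v *s \<tau> v - u v *s v" for v
    have h\<sigma>: "hom_field (m + 1) \<sigma>" unfolding \<sigma>_def[abs_def]
      by (intro hom_field_diff hom_field_scale[OF hompoly_linear_form \<tau>(1)] hom_field_scale[OF hu hom_field_euler]) simp_all
    have "gradient \<A> v (\<sigma> v) = 0" for v
    proof -
      have "gradient \<A> v (\<sigma> v) = form l v * gradient \<A> v (\<tau> v) - u v * (of_nat (card \<A>) * defining_poly \<A> v)"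
        by (simp add: \<sigma>_def gradient_diff gradient_scale euler_identity[OF fin])
      also have "gradient \<A> v (\<tau> v) = form l (\<tau> v) * defining_poly \<B> v"
        using gradient_remove[OF fin l, of v "\<tau> v"] \<tau>(2) by (simp add: killed_by_gradient_def \<B>_def)
      also have "defining_poly \<A> v = form l v * defining_poly \<B> v"
        using defining_poly_remove[OF fin l] by (simp add: \<B>_def)
      finally show ?thesis using n by (simp add: u_def)
    qed
    then have k\<sigma>: "killed_by_gradient \<A> \<sigma>" by (simp add: killed_by_gradient_def)
    obtain n' Q P where Q: "hompoly n' Q" "Q v \<noteq> 0" "\<And>j. hompoly (n' + (m + 1) - \<delta> j) (P j)"
      "\<And>w. Q w *s \<sigma> w = (\<Sum>j\<in>UNIV. P j w *s \<theta> j w)"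
      by (rule locally_generatesE[OF D(6) h\<sigma> k\<sigma> v]) (rule that)
    have "P p v = 0" if "form l v = 0" for v
    proof (rule cut[OF hompoly_polyfun[OF Q(3)] that])
      fix v assume "form l v = 0"
      then show "minor j k v (\<Sum>j\<in>UNIV. P j v *s \<theta> j v) = 0"
        unfolding Q(4)[symmetric] minor_scale \<sigma>_def minor_diff by simp
    qed
    then obtain P' where P': "polyfun P'" "\<And>v. P p v = form l v * P' v"
      using polyfun_divide[OF hompoly_polyfun[OF Q(3)] form_of_nonzero[OF arr l]] by blast
    have P'_eq: "P p = (\<lambda>v. form l v * P' v)" using P'(2) by auto
    have hP': "hompoly (n' + (m + 1) - \<delta> p - 1) P'"
      by (rule hompoly_quotient[where A = "form l" and ?v0.0 = w]) (use Q(3)[of p] P'_eq P'(1) w in auto)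
    define B where "B q v = c 0 * P (\<iota> q) v - P' v * r (\<iota> q) v" for q v
    have hB: "hompoly (n' + m - (\<delta> (\<iota> q) - 1)) (B q)" for q
      unfolding B_def[abs_def]
    proof (rule hompoly_diff)
      have "hompoly (n' + (m + 1) - \<delta> (\<iota> q)) (\<lambda>v. c 0 * P (\<iota> q) v)" by (rule hompoly_cmult[OF Q(3)])
      then show "hompoly (n' + m - (\<delta> (\<iota> q) - 1)) (\<lambda>v. c 0 * P (\<iota> q) v)" by (simp add: algebra_simps)
      show "hompoly (n' + m - (\<delta> (\<iota> q) - 1)) (\<lambda>v. P' v * r (\<iota> q) v)"
        by (rule hompoly_mult[OF hP' D(3)]) (use ep in simp)
    qed
    define Q' where "Q' v = c 0 * Q v" for v
    have hQ': "hompoly n' Q'" unfolding Q'_def[abs_def] by (rule hompoly_cmult[OF Q(1)])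
    have B\<sigma>: "Q' v *s \<sigma> v = (\<Sum>q\<in>UNIV. B q v *s \<theta> (\<iota> q) v)" for v
    proof -
      have "Q' v *s \<sigma> v = c 0 *s (\<Sum>j\<in>UNIV. P j v *s \<theta> j v) - P' v *s (\<Sum>j\<in>UNIV. r j v *s \<theta> j v)"
        using D(5)[of v] Q(4)[of v] by (simp add: Q'_def flip: vec.scale_scale)
      also have "\<dots> = (c 0 * P p v) *s \<theta> p v - (P' v * r p v) *s \<theta> p v + (\<Sum>q\<in>UNIV. B q v *s \<theta> (\<iota> q) v)"
        unfolding split by (simp add: B_def vec.scale_right_distrib vec.scale_sum_right vec.scale_left_diff_distrib sum_subtractf)
      also have "c 0 * P p v = P' v * r p v" by (simp add: rp_eq P'(2))
      finally show ?thesis by simp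
    qed
    define \<xi> where "\<xi> v = Q' v *s \<tau> v - (\<Sum>q\<in>UNIV. B q v *s \<eta> q v)" for v
    have h\<xi>: "hom_field (n' + m) \<xi>"
    proof -
      have "hom_field (n' + m) (\<lambda>v. \<Sum>q\<in>UNIV. B q v *s \<eta> q v)"
        unfolding hom_field_def sum_component vector_smult_component
        by (intro allI hompoly_sum hompoly_mult[OF hB hom_fieldD[OF \<eta>(1)]]) simp
      then show ?thesis unfolding \<xi>_def[abs_def]
        by (intro hom_field_diff hom_field_scale[OF hQ' \<tau>(1)]) simp_all
    qed
    have k\<xi>: "killed_by_gradient (\<A> - {l}) \<xi>"
      using \<tau>(2) \<eta>(3) by (simp add: killed_by_gradient_def \<xi>_def gradient_diff gradient_scale gradient_sum \<B>_def)
    define h where "h v = Q' v * u v + (\<Sum>q\<in>UNIV. B q v * g q v)" for v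
    have "\<xi> v = 0" for v
    proof (rule deletion_field_unique[OF arr l n h\<xi> k\<xi>])
      show "polyfun h" unfolding h_def[abs_def]
        by (intro polyfun_add polyfun_sum polyfun_mult hompoly_polyfun[OF hQ'] hompoly_polyfun[OF hu] hompoly_polyfun[OF hB] hompoly_polyfun[OF \<eta>(2)])
      fix v
      have "Q' v *s \<sigma> v = form l v *s (\<Sum>q\<in>UNIV. B q v *s \<eta> q v) + (\<Sum>q\<in>UNIV. B q v * g q v) *s v"
        unfolding B\<sigma> comb ..
      moreover have "Q' v *s \<sigma> v = form l v *s (Q' v *s \<tau> v) - (Q' v * u v) *s v"
        by (simp add: \<sigma>_def vec.scale_right_diff_distrib mult.commute)
      ultimately have "form l v *s (Q' v *s \<tau> v) - form l v *s (\<Sum>q\<in>UNIV. B q v *s \<eta> q v)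
          = (\<Sum>q\<in>UNIV. B q v * g q v) *s v + (Q' v * u v) *s v"
        by (simp add: algebra_simps)
      then show "form l v *s \<xi> v = h v *s v"
        by (simp add: \<xi>_def h_def vec.scale_right_diff_distrib vec.scale_left_distrib add.commute)
    qed
    then have "Q' w *s \<tau> w = (\<Sum>q\<in>UNIV. B q w *s \<eta> q w)" for w by (simp add: \<xi>_def)
    moreover have "Q' v \<noteq> 0" using Q(2) c0 by (simp add: Q'_def)
    ultimately show "\<exists>n Q P. hompoly n Q \<and> Q v \<noteq> 0 \<and> (\<forall>q. hompoly (n + m - (\<delta> (\<iota> q) - 1)) (P q)) \<and>
        (\<forall>w. Q w *s \<tau> w = (\<Sum>q\<in>UNIV. P q w *s \<eta> q w))"
      using hQ' hB by blast
  qed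
  show ?thesis using \<eta>(1,3) ind gen unfolding \<B>_def by blast
qed

text \<open>
  The bundle contains a field that is not radial on the line, and the generators span it near each point.
\<close>

lemma nonradial_generator:
  fixes \<theta> :: "'m::finite \<Rightarrow> complex^3 \<Rightarrow> complex^3"
  assumes arr: "arrangement \<A>" and l: "l \<in> \<A>" and pres: "presentation \<A> e \<delta> \<theta> r"
  shows "\<exists>p. \<not> radial_on (form_of l) (\<theta> p)"
proof (rule ccontr)
  assume "\<not> ?thesis"
  then have rad: "radial_on (form_of l) (\<theta> p)" for p by blast
  obtain \<tau> where \<tau>: "hom_field (int (card \<A>) - 1) \<tau>" "killed_by_gradient \<A> \<tau>" "\<not> radial_on (form_of l) \<tau>"
    using exists_non_radial_field[OF arr l] by blast
  obtain v j k where v: "form l v = 0" "minor j k v (\<tau> v) \<noteq> 0" using \<tau>(3) by (auto simp: radial_on_def)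
  then have "v \<noteq> 0" by (auto simp: minor_def)
  obtain n Q P where Q: "Q v \<noteq> 0" "\<And>w. Q w *s \<tau> w = (\<Sum>j\<in>UNIV. P j w *s \<theta> j w)"
    by (rule locally_generatesE[OF presentationD(6)[OF pres] \<tau>(1,2) \<open>v \<noteq> 0\<close>]) (rule that)
  have "Q v * minor j k v (\<tau> v) = minor j k v (Q v *s \<tau> v)" by (simp add: minor_scale)
  also have "\<dots> = (\<Sum>i\<in>UNIV. P i v * minor j k v (\<theta> i v))" unfolding Q(2) by (simp add: minor_sum minor_scale)
  also have "\<dots> = 0" using rad v(1) by (intro sum.neutral) (simp add: radial_on_def)
  finally show False using Q(1) v(2) by simp
qed

theorem proposition2p8:
  fixes \<A> :: "line set" and l :: line and a b d :: int
  assumes "arrangement \<A>"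
    and "plus_one_generated \<A> a b d"
    and "l \<in> \<A>"
    and "int (card (points_on l \<A>)) = d + 1"
  shows "free_with_exponents (\<A> - {l}) (a - 1) (b - 1)"
proof -
  note arr = assms(1) and l = assms(3) and h = assms(4)
  have fin: "finite \<A>" using arr by (simp add: arrangement_def)
  have ord: "0 \<le> a" "a \<le> b" "b \<le> d" using assms(2) by (simp_all add: plus_one_generated_def)
  have finS: "finite (points_on l \<A>)" using h ord by (intro card_ge_0_finite) linarith
  have "points_on l \<A> \<noteq> {}" using h ord by (intro notI) simp
  then obtain l' where l': "l' \<in> \<A> - {l}" by (auto simp: points_on_def)
  have card2: "2 \<le> card \<A>"
  proof -
    have "card {l, l'} \<le> card \<A>" using l l' fin by (intro card_mono) auto
    moreover have "l' \<noteq> l" using l' by blast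
    ultimately show ?thesis by (simp add: card_insert_if)
  qed
  define \<delta> :: "3 \<Rightarrow> int" where "\<delta> j = - (vector [- d, - b, - a] :: int^3) $ j" for j
  have \<delta>: "\<delta> 1 = d" "\<delta> 2 = b" "\<delta> 3 = a" by (simp_all add: \<delta>_def)
  have \<delta>_le: "\<delta> j \<le> d" "0 \<le> \<delta> j" for j using exhaust_3[of j] ord \<delta> by auto
  obtain \<theta> r where "presentation \<A> (- (vector [- 1 - d] :: int^1) $ 1) (\<lambda>j. - (vector [- d, - b, - a] :: int^3) $ j) \<theta> r"
    using assms(2) presentation_of_short_exact[OF fin] unfolding plus_one_generated_def by blast
  then have pres: "presentation \<A> (d + 1) \<delta> \<theta> r" by (simp add: \<delta>_def[abs_def] add.commute)
  note D = presentationD[OF pres]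
  obtain i j k where chart: "plane_chart (form_of l) i j k" by (rule plane_chart_exists[OF form_of_nonzero[OF arr l]])
  interpret plane_chart "form_of l" i j k by (rule chart)
  \<comment> \<open>the point of \<open>l\<close> at which radiality of fields of degree \<open>d\<close> is tested\<close>
  obtain x where x: "form l x = 0" "x \<noteq> 0" "vec.span {x} \<notin> points_on l \<A>"
    by (rule vector_off_finite_set_of_points[OF finS]) (rule that)
  have radial: "radial_on (form_of l) \<eta>"
    if "hom_field m \<eta>" "killed_by_gradient \<A> \<eta>" "0 \<le> m" "m \<le> d" "m = d \<Longrightarrow> minor j k x (\<eta> x) = 0" for m \<eta>
    by (rule radial_of_many_points[OF arr l refl that(1,2) _ _ x]) (use that h in auto)
  obtain p where p: "\<not> radial_on (form_of l) (\<theta> p)" using nonradial_generator[OF arr l pres] by blast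
  have \<delta>p: "\<delta> p = d" and sp: "minor j k x (\<theta> p x) \<noteq> 0"
    using radial[OF D(1,2) \<delta>_le(2,1), of p] p by blast+
  \<comment> \<open>make the other generators of degree \<open>d\<close> radial at \<open>x\<close>; those of smaller degree are radial already\<close>
  define c where "c q = (if q = p \<or> \<delta> q \<noteq> d then 0 else minor j k x (\<theta> q x) / minor j k x (\<theta> p x))" for q
  define \<theta>' where "\<theta>' = (\<lambda>q v. \<theta> q v - c q *s \<theta> p v)"
  define r' where "r' = (\<lambda>q v. r q v + (if q = p then \<Sum>i\<in>UNIV. c i * r i v else 0))"
  have pres': "presentation \<A> (d + 1) \<delta> \<theta>' r'"
    unfolding \<theta>'_def r'_def
    by (rule presentation_change_generators[OF pres]) (auto simp: c_def \<delta>p split: if_splits)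
  note D' = presentationD[OF pres']
  have rad: "radial_on (form_of l) (\<theta>' q)" if "q \<noteq> p" for q
    by (rule radial[OF D'(1,2) \<delta>_le(2,1)]) (use that sp in \<open>simp add: \<theta>'_def c_def minor_diff minor_scale\<close>)
  have nonrad: "\<not> radial_on (form_of l) (\<theta>' p)" using p by (simp add: \<theta>'_def c_def)
  have rp: "\<exists>v. r' p v \<noteq> 0"
    by (rule presentation_coefficient_nonzero[OF fin pres']) (use \<delta>_le in \<open>simp add: zle_add1_eq_le\<close>)
  \<comment> \<open>\<open>p\<close> has degree \<open>d\<close>, so the two remaining generators have degrees \<open>a\<close> and \<open>b\<close> also if \<open>b = d\<close>\<close>
  obtain \<iota> :: "2 \<Rightarrow> 3" where \<iota>: "bij_betw \<iota> UNIV (UNIV - {p})" "\<delta> (\<iota> 1) = a" "\<delta> (\<iota> 2) = b"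
  proof -
    define sel :: "3 \<Rightarrow> 3 \<Rightarrow> 2 \<Rightarrow> 3" where "sel s t q = (if q = 1 then s else t)" for s t q
    have sel: "bij_betw (sel s t) UNIV {s, t}" "sel s t 1 = s" "sel s t 2 = t" if "s \<noteq> t" for s t
      using that by (auto simp: sel_def bij_betw_def inj_on_def UNIV_2)
    have "\<exists>s t. UNIV - {p} = {s, t} \<and> s \<noteq> t \<and> \<delta> s = a \<and> \<delta> t = b"
    proof -
      have ne: "(1::3) \<noteq> 2" "(1::3) \<noteq> 3" "(2::3) \<noteq> 3" by simp_all
      have "p = 1 \<or> p = 2 \<or> p = 3" by (rule exhaust_3)
      then show ?thesis
      proof (elim disjE)
        assume p: "p = 1"
        have "UNIV - {p} = {3, 2}" unfolding p UNIV_3 using ne ne[symmetric] by auto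
        moreover have "\<delta> 3 = a" "\<delta> 2 = b" by (rule \<delta>)+
        ultimately show ?thesis using ne by metis
      next
        assume p: "p = 2"
        have "UNIV - {p} = {3, 1}" unfolding p UNIV_3 using ne ne[symmetric] by auto
        moreover have "\<delta> 3 = a" "\<delta> 1 = b" using \<delta> \<delta>p unfolding p by argo+
        ultimately show ?thesis using ne by metis
      next
        assume p: "p = 3"
        have "UNIV - {p} = {2, 1}" unfolding p UNIV_3 using ne ne[symmetric] by auto
        moreover have "\<delta> 2 = a" "\<delta> 1 = b" using \<delta> \<delta>p ord unfolding p by linarith+
        ultimately show ?thesis using ne by metis
      qed
    qed
    then obtain s t where st: "UNIV - {p} = {s, t}" "s \<noteq> t" "\<delta> s = a" "\<delta> t = b" by blast
    show ?thesis
      by (rule that[of "sel s t"]) (use st sel(1)[OF st(2)] sel(2,3)[OF st(2)] in simp_all)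
  qed
  have \<iota>p: "\<iota> q \<noteq> p" for q using \<iota>(1) by (auto simp: bij_betw_def)
  have "d + 1 - \<delta> p = 1" by (simp add: \<delta>p)
  then obtain \<eta> where \<eta>': "\<forall>q. hom_field (\<delta> (\<iota> q) - 1) (\<eta> q) \<and> killed_by_gradient (\<A> - {l}) (\<eta> q)"
    and \<eta>_ind: "independent_fields (\<lambda>q. \<delta> (\<iota> q) - 1) \<eta>"
    and \<eta>_gen: "locally_generates (\<A> - {l}) (\<lambda>q. \<delta> (\<iota> q) - 1) \<eta>"
    using basis_of_deletion[OF arr l card2 pres' \<iota>(1) rad[OF \<iota>p] nonrad rp] by blast
  have \<eta>_hom: "hom_field (\<delta> (\<iota> q) - 1) (\<eta> q)" and \<eta>_kill: "killed_by_gradient (\<A> - {l}) (\<eta> q)" for q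
    using \<eta>' by simp_all
  have "sheaf_isomorphic (arrangement_bundle (\<A> - {l})) (twist_sum (\<chi> q. - (\<delta> (\<iota> q) - 1)))"
    by (rule sheaf_isomorphic_of_basis[OF _ \<eta>_hom \<eta>_kill \<eta>_ind \<eta>_gen]) (use fin in simp)
  moreover have "(\<chi> q. - (\<delta> (\<iota> q) - 1)) = (vector [- (a - 1), - (b - 1)] :: int^2)"
    by (simp add: vec_eq_iff forall_2 \<iota>)
  moreover have "0 \<le> a - 1" "0 \<le> b - 1"
    using independent_fields_degree_nonneg[OF \<eta>_ind \<eta>_hom, of 1] independent_fields_degree_nonneg[OF \<eta>_ind \<eta>_hom, of 2]
    by (simp_all add: \<iota>)
  ultimately show ?thesis by (simp add: free_with_exponents_def)
qed

end
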